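(* Let $\mathbf{T}$ be a pile of $\Diamond$-tilings of $\mathbf{P}_n$, and let $\varkappa=\varkappa(\mathbf{T})$. (a) Any coherent solution $\mathbf{x}=(x_s)\in(\mathbb{C}^* )^{\varkappa^0}$ of the Kashaev equation such that $x_{v_1}x_{v_3}+x_{v_2}x_{v_4}\neq0$ for every $2$-dimensional face of $\varkappa$ with vertices $v_1,v_2,v_3,v_4$ in cyclic order can be extended to an array $\tilde{\mathbf{x}}=(x_s)_{s\in\varkappa^{02}}$ satisfying the K-hexahedron equations. (b) Conversely, if $\tilde{\mathbf{x}}=(x_s)\in(\mathbb{C}^* )^{\varkappa^{02}}$ satisfies the K-hexahedron equations, then the restriction of $\tilde{\mathbf{x}}$ to $\varkappa^0$ is a coherent solution of the Kashaev equation.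
   Context: Let $e_j=e^{\pi i(j-1)/n}\in\mathbb{C}\cong\mathbb{R}^2$, $j=1,\dots,n$, and let $\mathbf{P}_n=\sum_{j=1}^n[0,e_j]$ (Minkowski sum; a regular $2n$-gon), with $v_0$ the vertex at the origin. A $\Diamond$-tiling of $\mathbf{P}_n$ is a tiling of $\mathbf{P}_n$ by the $\binom n2$ rhombi which are translates of $[0,e_i]+[0,e_j]$, $1\le i<j\le n$ (edge-to-edge). Two tilings are related by a flip if one is obtained from the other by replacing three tiles forming a hexagon with a common interior vertex by the other tiling of that hexagon by three rhombi (which has a different interior vertex). A pile is a sequence $\mathbf{T}=(T_0,\dots,T_\ell)$ of tilings with $T_{i-1},T_i$ related by a flip for each $i$. The directed cubical complex $\varkappa(\mathbf{T})$: start with the $2$-dimensional complex $T_0$; for $i=1,\dots,\ell$, if the flip $T_{i-1}\to T_i$ removes interior vertex $w$ and creates vertex $v$ in a hexagon with vertices $h_1,\dots,h_6$, add a new vertex $v$ and a $3$-dimensional cube with vertices $w,v,h_1,\dots,h_6$ whose six $2$-faces are the three old tiles and three new tiles; $w$ is the bottom vertex and $v$ the top vertex of this cube. $\varkappa^0,\varkappa^2,\varkappa^3$ denote the vertices, $2$-faces (= all tiles appearing in some $T_i$) and $3$-cubes; $\varkappa^{02}=\varkappa^0\cup\varkappa^2$. A vertex is interior if it has a neighbourhood in $\varkappa$ homeomorphic to an open ball in $\mathbb{R}^3$. For a $3$-cube $C$ and an array $\mathbf{x}$ on $\varkappa^0$, label values at vertices of $C$ as $z_{ijk}$ via a cube isomorphism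 $C\cong\{0,1\}^3$; set $a=z_{000}z_{111}$, $b=z_{100}z_{011}$, $c=z_{010}z_{101}$, $d=z_{001}z_{110}$, $s=z_{000}z_{011}z_{101}z_{110}$, $t=z_{111}z_{100}z_{010}z_{001}$, $K^C(\mathbf{x})=2(a^2+b^2+c^2+d^2)-(a+b+c+d)^2-4(s+t)$, and for a vertex $v$ of $C$ (labeling with $z_{000}=x_v$) $K^C_v(\mathbf{x})=\tfrac12(z_{111}z_{000}^2-z_{000}(z_{100}z_{011}+z_{010}z_{101}+z_{001}z_{110}))-z_{100}z_{010}z_{001}$. $\mathbf{x}$ is a coherent solution of the Kashaev equation if $K^C(\mathbf{x})=0$ for all $C\in\varkappa^3$ and for every interior vertex $v$, $\prod_{C\ni v}K^C_v(\mathbf{x})=\prod_{S\ni v}(x_vx_{v_2}+x_{v_1}x_{v_3})$ (products over $3$-cubes, resp. $2$-faces, of $\varkappa$ containing $v$; $v,v_1,v_2,v_3$ the vertices of $S$ in cyclic order). An array $\tilde{\mathbf{x}}=(x_s)_{s\in\varkappa^{02}}$ with nonzero vertex values satisfies the K-hexahedron equations if $x_s^2=x_{v_1}x_{v_3}+x_{v_2}x_{v_4}$ for every $s\in\varkappa^2$ (vertices of $s$ in cyclic order), and for every cube $C$, identifying $C$ with $[0,1]^3$ so that the bottom vertex is $000$ and the top vertex is $111$, writing $z_{ijk}$ for vertex values and $z_{0\frac12\frac12}$ etc. for the value at the face whose center is that point: $z_{1\frac12\frac12}=(z_{\frac120\frac12}z_{\frac12\frac120}+z_{0\frac12\frac12}z_{100})/z_{000}$,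 $z_{\frac121\frac12}=(z_{0\frac12\frac12}z_{\frac12\frac120}+z_{\frac120\frac12}z_{010})/z_{000}$, $z_{\frac12\frac121}=(z_{0\frac12\frac12}z_{\frac120\frac12}+z_{\frac12\frac120}z_{001})/z_{000}$, $z_{111}=(A+2z_{0\frac12\frac12}z_{\frac120\frac12}z_{\frac12\frac120})/z_{000}^2$ with $A=2z_{100}z_{010}z_{001}+z_{000}(z_{100}z_{011}+z_{010}z_{101}+z_{001}z_{110})$. *)

theory Defs
  imports "HOL-Analysis.Analysis"
begin

definition ee :: "nat \<Rightarrow> nat \<Rightarrow> complex" where
  "ee n j = cis (pi * real (j - 1) / real n)"

definition Pn :: "nat \<Rightarrow> complex set" where
  "Pn n = {\<Sum>j\<in>{1..n}. complex_of_real (f j) * ee n j | f.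
             \<forall>j\<in>{1..n}. 0 \<le> f j \<and> f j \<le> 1}"

text \<open>A tile (i,j,t) with i<j is the rhombus t + [0,e_i] + [0,e_j].\<close>
type_synonym tile = "nat \<times> nat \<times> complex"

definition rhomb :: "nat \<Rightarrow> tile \<Rightarrow> complex set" where
  "rhomb n \<tau> = (case \<tau> of (i,j,t) \<Rightarrow>
     {t + complex_of_real a * ee n i + complex_of_real b * ee n j | a b.
        0 \<le> a \<and> a \<le> 1 \<and> 0 \<le> b \<and> b \<le> 1})"

definition corners :: "nat \<Rightarrow> tile \<Rightarrow> complex list" where
  "corners n \<tau> = (case \<tau> of (i,j,t) \<Rightarrow>
     [t, t + ee n i, t + ee n i + ee n j, t + ee n j])"

definition tile_edges :: "nat \<Rightarrow> tile \<Rightarrow> complex set set" where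
  "tile_edges n \<tau> = (case \<tau> of (i,j,t) \<Rightarrow>
     {closed_segment t (t + ee n i),
      closed_segment (t + ee n i) (t + ee n i + ee n j),
      closed_segment (t + ee n j) (t + ee n i + ee n j),
      closed_segment t (t + ee n j)})"

definition is_tiling :: "nat \<Rightarrow> tile set \<Rightarrow> bool" where
  "is_tiling n T \<longleftrightarrow>
     (\<forall>(i,j,t)\<in>T. 1 \<le> i \<and> i < j \<and> j \<le> n) \<and>
     (\<forall>i j. 1 \<le> i \<and> i < j \<and> j \<le> n \<longrightarrow> (\<exists>!t. (i,j,t) \<in> T)) \<and>
     \<Union>(rhomb n ` T) = Pn n \<and>
     (\<forall>\<tau>\<in>T. \<forall>\<sigma>\<in>T. \<tau> \<noteq> \<sigma> \<longrightarrow>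
        interior (rhomb n \<tau>) \<inter> interior (rhomb n \<sigma>) = {} \<and>
        (rhomb n \<tau> \<inter> rhomb n \<sigma> = {} \<or>
         (\<exists>p \<in> set (corners n \<tau>) \<inter> set (corners n \<sigma>). rhomb n \<tau> \<inter> rhomb n \<sigma> = {p}) \<or>
         (\<exists>E \<in> tile_edges n \<tau> \<inter> tile_edges n \<sigma>. rhomb n \<tau> \<inter> rhomb n \<sigma> = E)))"

definition tiling_verts :: "nat \<Rightarrow> tile set \<Rightarrow> complex set" where
  "tiling_verts n T = (\<Union>\<tau>\<in>T. set (corners n \<tau>))"

text \<open>The two rhombus tilings of the hexagon c + [0,e_i]+[0,e_j]+[0,e_k], i<j<k:
  hexA has interior vertex c + e_j, hexB has interior vertex c + e_i + e_k.\<close>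
definition hexA :: "nat \<Rightarrow> nat \<Rightarrow> nat \<Rightarrow> nat \<Rightarrow> complex \<Rightarrow> tile set" where
  "hexA n i j k c = {(i,j,c), (i,k,c + ee n j), (j,k,c)}"

definition hexB :: "nat \<Rightarrow> nat \<Rightarrow> nat \<Rightarrow> nat \<Rightarrow> complex \<Rightarrow> tile set" where
  "hexB n i j k c = {(i,j,c + ee n k), (i,k,c), (j,k,c + ee n i)}"

text \<open>Flip data (i,j,k,c,up): up = True means hexA is replaced by hexB
  (removing w = c+e_j, creating v = c+e_i+e_k); up = False the converse.\<close>
type_synonym flipdat = "nat \<times> nat \<times> nat \<times> complex \<times> bool"

definition flip_data :: "nat \<Rightarrow> tile set \<Rightarrow> tile set \<Rightarrow> flipdat \<Rightarrow> bool" where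
  "flip_data n T T' d = (case d of (i,j,k,c,up) \<Rightarrow>
     1 \<le> i \<and> i < j \<and> j < k \<and> k \<le> n \<and>
     (if up then hexA n i j k c \<subseteq> T \<and> T' = (T - hexA n i j k c) \<union> hexB n i j k c
      else hexB n i j k c \<subseteq> T \<and> T' = (T - hexB n i j k c) \<union> hexA n i j k c))"

definition related_by_flip :: "nat \<Rightarrow> tile set \<Rightarrow> tile set \<Rightarrow> bool" where
  "related_by_flip n T T' \<longleftrightarrow> (\<exists>d. flip_data n T T' d)"

definition is_pile :: "nat \<Rightarrow> tile set list \<Rightarrow> bool" where
  "is_pile n Ts \<longleftrightarrow> Ts \<noteq> [] \<and> (\<forall>T\<in>set Ts. is_tiling n T) \<and>
     (\<forall>m. 1 \<le> m \<and> m < length Ts \<longrightarrow> related_by_flip n (Ts!(m-1)) (Ts!m))"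

definition fdat :: "nat \<Rightarrow> tile set list \<Rightarrow> nat \<Rightarrow> flipdat" where
  "fdat n Ts m = (SOME d. flip_data n (Ts!(m-1)) (Ts!m) d)"

text \<open>Cube coordinates: axes 0,1,2 correspond to directions i,j,k; a vertex of
  the cube {0,1}^3 is a subset B of {0,1,2}.\<close>
definition fidx :: "flipdat \<Rightarrow> nat \<Rightarrow> nat" where
  "fidx d a = (case d of (i,j,k,c,up) \<Rightarrow> if a = 0 then i else if a = 1 then j else k)"

definition wbits :: "flipdat \<Rightarrow> nat set" where
  "wbits d = (case d of (i,j,k,c,up) \<Rightarrow> if up then {1} else {0,2})"

definition symdiff :: "nat set \<Rightarrow> nat set \<Rightarrow> nat set" where
  "symdiff A B = (A - B) \<union> (B - A)"

text \<open>Planar position of cube vertex B; B = {} is the removed (bottom) vertex w,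
  B = {0,1,2} the created (top) vertex v.\<close>
definition fpos :: "nat \<Rightarrow> flipdat \<Rightarrow> nat set \<Rightarrow> complex" where
  "fpos n d B = (case d of (i,j,k,c,up) \<Rightarrow>
     c + (\<Sum>a\<in>symdiff B (wbits d). ee n (fidx d a)))"

definition vnew :: "nat \<Rightarrow> tile set list \<Rightarrow> nat \<Rightarrow> complex" where
  "vnew n Ts m = fpos n (fdat n Ts m) {0,1,2}"

text \<open>Vertices of kappa: Inl p for a vertex p of T_0, Inr m for the new vertex
  created by the m-th flip.\<close>
type_synonym kvert = "complex + nat"
type_synonym kface = "kvert \<times> kvert \<times> kvert \<times> kvert"

text \<open>Name (vertex of kappa) of the planar vertex p of the tiling T_m.\<close>
primrec kname :: "nat \<Rightarrow> tile set list \<Rightarrow> nat \<Rightarrow> complex \<Rightarrow> kvert" where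
  "kname n Ts 0 p = Inl p"
| "kname n Ts (Suc m) p =
     (if p = vnew n Ts (Suc m) then Inr (Suc m) else kname n Ts m p)"

definition tile_face :: "nat \<Rightarrow> tile set list \<Rightarrow> nat \<Rightarrow> tile \<Rightarrow> kface" where
  "tile_face n Ts m \<tau> = (case \<tau> of (i,j,t) \<Rightarrow>
     (kname n Ts m t, kname n Ts m (t + ee n i),
      kname n Ts m (t + ee n i + ee n j), kname n Ts m (t + ee n j)))"

definition kappa0 :: "nat \<Rightarrow> tile set list \<Rightarrow> kvert set" where
  "kappa0 n Ts = {kname n Ts m p | m p. m < length Ts \<and> p \<in> tiling_verts n (Ts!m)}"

definition kappa2 :: "nat \<Rightarrow> tile set list \<Rightarrow> kface set" where
  "kappa2 n Ts = {tile_face n Ts m \<tau> | m \<tau>. m < length Ts \<and> \<tau> \<in> Ts!m}"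

text \<open>3-cubes of kappa are indexed by the flips m = 1..l.\<close>
definition kcubes :: "tile set list \<Rightarrow> nat set" where
  "kcubes Ts = {1..<length Ts}"

definition cvert :: "nat \<Rightarrow> tile set list \<Rightarrow> nat \<Rightarrow> nat set \<Rightarrow> kvert" where
  "cvert n Ts m B = (if B = {0,1,2} then Inr m
                     else kname n Ts (m-1) (fpos n (fdat n Ts m) B))"

text \<open>The 2-face of cube m given by coordinate a being fixed to beta
  (False = 0, contains the bottom vertex; True = 1, contains the top vertex).\<close>
definition cface :: "nat \<Rightarrow> tile set list \<Rightarrow> nat \<Rightarrow> nat \<Rightarrow> bool \<Rightarrow> kface" where
  "cface n Ts m a \<beta> = (let d = fdat n Ts m;
       Bs = (wbits d - {a}) \<union> (if \<beta> then {a} else {});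
       t = fpos n d Bs;
       pq = (if a = 0 then (fidx d 1, fidx d 2)
             else if a = 1 then (fidx d 0, fidx d 2) else (fidx d 0, fidx d 1))
     in tile_face n Ts (if \<beta> then m else m-1) (fst pq, snd pq, t))"

definition face_verts :: "kface \<Rightarrow> kvert set" where
  "face_verts s = (case s of (s1,s2,s3,s4) \<Rightarrow> {s1,s2,s3,s4})"

text \<open>Each vertex u of kappa is sent to the indicator function of u; a cube
  (resp. square) is realized by the multilinear interpolation of its vertices.\<close>
definition cube_weight :: "(nat \<Rightarrow> real) \<Rightarrow> nat set \<Rightarrow> real" where
  "cube_weight t B = (\<Prod>a\<in>{0,1,2::nat}. if a \<in> B then t a else 1 - t a)"

definition cube_cell :: "nat \<Rightarrow> tile set list \<Rightarrow> nat \<Rightarrow> (kvert \<Rightarrow> real) set" where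
  "cube_cell n Ts m =
     {(\<lambda>u. \<Sum>B\<in>Pow {0,1,2}. if cvert n Ts m B = u then cube_weight t B else 0) | t.
        \<forall>a\<in>{0,1,2}. 0 \<le> t a \<and> t a \<le> 1}"

definition face_cell :: "kface \<Rightarrow> (kvert \<Rightarrow> real) set" where
  "face_cell s = (case s of (s1,s2,s3,s4) \<Rightarrow>
     {(\<lambda>u. (if u = s1 then (1-a)*(1-b) else 0) + (if u = s2 then a*(1-b) else 0)
          + (if u = s3 then a*b else 0) + (if u = s4 then (1-a)*b else 0)) | a b.
        0 \<le> a \<and> a \<le> 1 \<and> 0 \<le> b \<and> b \<le> 1})"

definition vpt :: "kvert \<Rightarrow> (kvert \<Rightarrow> real)" where
  "vpt v = (\<lambda>u. if u = v then 1 else 0)"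

definition realization :: "nat \<Rightarrow> tile set list \<Rightarrow> (kvert \<Rightarrow> real) set" where
  "realization n Ts = (\<Union>m\<in>kcubes Ts. cube_cell n Ts m) \<union> (\<Union>s\<in>kappa2 n Ts. face_cell s)"

definition interior_vertex :: "nat \<Rightarrow> tile set list \<Rightarrow> kvert \<Rightarrow> bool" where
  "interior_vertex n Ts v \<longleftrightarrow> v \<in> kappa0 n Ts \<and>
     (\<exists>U. openin (top_of_set (realization n Ts)) U \<and> vpt v \<in> U \<and>
          (\<exists>(c::real^3) r. U homeomorphic ball c r))"

text \<open>z B is the value at the cube vertex with coordinates given by the subset B
  (so z {0} = z_100, z {1,2} = z_011, etc.).\<close>
definition Kpoly :: "(nat set \<Rightarrow> complex) \<Rightarrow> complex" where
  "Kpoly z = (let a = z {} * z {0,1,2}; b = z {0} * z {1,2};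
                  c = z {1} * z {0,2}; d = z {2} * z {0,1};
                  s = z {} * z {1,2} * z {0,2} * z {0,1};
                  t = z {0,1,2} * z {0} * z {1} * z {2}
              in 2*(a^2+b^2+c^2+d^2) - (a+b+c+d)^2 - 4*(s+t))"

definition Kvpoly :: "(nat set \<Rightarrow> complex) \<Rightarrow> complex" where
  "Kvpoly z = (z {0,1,2} * (z {})^2
                 - z {} * (z {0} * z {1,2} + z {1} * z {0,2} + z {2} * z {0,1})) / 2
              - z {0} * z {1} * z {2}"

text \<open>K^C_v for cube m and vertex v of it: relabel so that v sits at 000.\<close>
definition Kv_at :: "nat \<Rightarrow> tile set list \<Rightarrow> nat \<Rightarrow> kvert \<Rightarrow> (kvert \<Rightarrow> complex) \<Rightarrow> complex" where
  "Kv_at n Ts m v x = (let B0 = (SOME B0. B0 \<subseteq> {0,1,2} \<and> cvert n Ts m B0 = v)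
                        in Kvpoly (\<lambda>B. x (cvert n Ts m (symdiff B B0))))"

definition face_term :: "(kvert \<Rightarrow> complex) \<Rightarrow> kvert \<Rightarrow> kface \<Rightarrow> complex" where
  "face_term x v s = (case s of (s1,s2,s3,s4) \<Rightarrow>
     if v = s1 then x s1 * x s3 + x s2 * x s4
     else if v = s2 then x s2 * x s4 + x s3 * x s1
     else if v = s3 then x s3 * x s1 + x s4 * x s2
     else x s4 * x s2 + x s1 * x s3)"

definition face_sum :: "(kvert \<Rightarrow> complex) \<Rightarrow> kface \<Rightarrow> complex" where
  "face_sum x s = (case s of (s1,s2,s3,s4) \<Rightarrow> x s1 * x s3 + x s2 * x s4)"

definition coherent :: "nat \<Rightarrow> tile set list \<Rightarrow> (kvert \<Rightarrow> complex) \<Rightarrow> bool" where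
  "coherent n Ts x \<longleftrightarrow>
     (\<forall>m\<in>kcubes Ts. Kpoly (\<lambda>B. x (cvert n Ts m B)) = 0) \<and>
     (\<forall>v. interior_vertex n Ts v \<longrightarrow>
        (\<Prod>m\<in>{m\<in>kcubes Ts. v \<in> cvert n Ts m ` Pow {0,1,2}}. Kv_at n Ts m v x)
        = (\<Prod>s\<in>{s\<in>kappa2 n Ts. v \<in> face_verts s}. face_term x v s))"

text \<open>K-hexahedron equations for the array given by x on vertices and y on 2-faces.
  F a beta is the value at the face of the cube whose centre has coordinate a equal
  to beta and the other two coordinates equal to 1/2.\<close>
definition khex :: "nat \<Rightarrow> tile set list \<Rightarrow> (kvert \<Rightarrow> complex) \<Rightarrow> (kface \<Rightarrow> complex) \<Rightarrow> bool" where
  "khex n Ts x y \<longleftrightarrow>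
     (\<forall>v\<in>kappa0 n Ts. x v \<noteq> 0) \<and>
     (\<forall>s\<in>kappa2 n Ts. (y s)^2 = face_sum x s) \<and>
     (\<forall>m\<in>kcubes Ts.
        let z = (\<lambda>B. x (cvert n Ts m B)); F = (\<lambda>a \<beta>. y (cface n Ts m a \<beta>));
            A = 2 * z {0} * z {1} * z {2}
                + z {} * (z {0} * z {1,2} + z {1} * z {0,2} + z {2} * z {0,1})
        in F 0 True = (F 1 False * F 2 False + F 0 False * z {0}) / z {} \<and>
           F 1 True = (F 0 False * F 2 False + F 1 False * z {1}) / z {} \<and>
           F 2 True = (F 0 False * F 1 False + F 2 False * z {2}) / z {} \<and>
           z {0,1,2} = (A + 2 * F 0 False * F 1 False * F 2 False) / (z {})^2)"

end

theory Submission
  imports Defs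
begin

text \<open>
  At a vertex \<open>v\<close> of a cube on which the K-hexahedron equations hold, \<open>K\<^sup>C\<^sub>v\<close> equals, up to sign, the
  product of the values at the three faces of the cube through \<open>v\<close>; the sign is \<open>+\<close> at the bottom and
  top vertices and \<open>-\<close> at the other six. Replacing each face value \<open>y\<close> by \<open>-y\<close> makes the sign exceptional
  only at the bottom and the top. A face through an interior vertex is a top face of one cube and a
  bottom face of another, and an interior vertex is the top of exactly one cube and the bottom of
  exactly one cube, so multiplying over all cubes at the vertex gives coherence.

  Conversely, the face values are propagated cube by cube. The only obstruction at a cube is the sign
  of the product of its three bottom face values. If its bottom vertex was created by an earlier flip,
  that vertex is interior and coherence fixes the sign. If it belongs to the initial tiling, the sign
  is arranged by the choice of square roots on the initial tiling: flipping the signs along a partial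
  de Bruijn strip changes the sign conditions at the two ends of one edge only, hence every sign pattern
  at the interior vertices of a tiling is realizable.

  Topologically interior vertices are recognized by an injective continuous map from the complex into
  \<open>\<complex> \<times> \<real>\<close>, namely planar position and height, where the height adds up the lengths of the fibres of
  the planar projections of the cubes. Its image lies between the heights of the first and of the last
  tiling, which by invariance of domain excludes vertices of these two tilings.
\<close>

text \<open>When the Kashaev equation holds on a cube, the square of K^C_v is the product of the
  three face sums at v. Hence coherence is automatic up to sign, and so is the last K-hexahedron
  equation, which says that K^C at the bottom vertex is the product of the three bottom face values;
  the other three equations define the top face values. One division free product formula,
  \<open>star_product\<close>, serves three times: with factors -y for a complete solution, with -y
  for a solution known only before some flip, and with the face sums, where it shows that the
  correction wanted on the initial tiling is a sign. Planar position does not identify a vertex,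
  since the two interior vertices of a regular hexagon coincide in the plane. Combinatorial claims
  are therefore made about names. Topology is needed twice: (b) needs interior vertices to avoid the
  first and last tiling, and (a) needs every removed vertex outside the first tiling to be interior.
  For the latter the image of the complex must fill the whole region between the two extreme
  surfaces.\<close>

declare One_nat_def [simp del]

abbreviation "axes \<equiv> {0,1,2::nat}"

abbreviation "cb t \<equiv> \<forall>a\<in>axes. 0 \<le> t a \<and> t a \<le> (1::real)"

section \<open>Determinants of plane vectors and the edge directions\<close>

definition crs :: "complex \<Rightarrow> complex \<Rightarrow> real" where
  "crs u v = Re u * Im v - Im u * Re v"

lemma crs_simps [simp]:
  "crs (u + v) w = crs u w + crs v w" "crs w (u + v) = crs w u + crs w v"
  "crs (u - v) w = crs u w - crs v w" "crs w (u - v) = crs w u - crs w v"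
  "crs (- u) w = - crs u w" "crs w (- u) = - crs w u"
  "crs (of_real r * u) w = r * crs u w" "crs w (of_real r * u) = r * crs w u"
  "crs u u = 0" "crs 0 w = 0" "crs w 0 = 0"
  by (auto simp: crs_def algebra_simps)

lemma crs_swap: "crs v u = - crs u v"
  by (simp add: crs_def)

text \<open>The linear dependency of three plane vectors given by their minors. It supplies the
  kernel of the projection of a cube to the plane.\<close>

lemma crs_three_term: "of_real (crs v w) * u - of_real (crs u w) * v + of_real (crs u v) * w = 0"
  by (auto simp: crs_def complex_eq_iff algebra_simps)

lemma crs_decompose:
  assumes "crs u v \<noteq> 0"
  shows "z = of_real (crs z v / crs u v) * u + of_real (crs u z / crs u v) * v"
  using assms crs_three_term[of z v u] crs_swap[of u v] crs_swap[of z u]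
  by (simp add: field_simps) (auto simp: crs_def complex_eq_iff algebra_simps)

lemma crs_independent:
  assumes "of_real a * u + of_real b * v = of_real a' * u + of_real b' * v" "crs u v \<noteq> 0"
  shows "a = a' \<and> b = b'"
proof -
  have "crs (of_real a * u + of_real b * v) v = crs (of_real a' * u + of_real b' * v) v"
    "crs u (of_real a * u + of_real b * v) = crs u (of_real a' * u + of_real b' * v)"
    using assms by auto
  then show ?thesis using assms(2) by auto
qed

text \<open>The determinant is the sine of the angle pi (j - i) / n, which lies strictly between 0
  and pi.\<close>

lemma crs_ee_pos:
  assumes "1 \<le> i" "i < j" "j \<le> n"
  shows "crs (ee n i) (ee n j) > 0"
proof -
  let ?t = "pi * real (j - 1) / real n - pi * real (i - 1) / real n"
  have "crs (ee n i) (ee n j) = sin ?t"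
    by (simp add: crs_def ee_def sin_diff mult.commute)
  moreover have t: "?t = pi * (real j - real i) / real n"
    using assms by (simp add: of_nat_diff right_diff_distrib diff_divide_distrib)
  have "real j - real i < real n" using assms by simp
  then have "pi * (real j - real i) < pi * real n" by (rule mult_strict_left_mono) simp
  then have "pi * (real j - real i) / real n < pi"
    using assms by (subst pos_divide_less_eq) auto
  then have "?t < pi" unfolding t .
  moreover have "?t > 0" unfolding t using assms by simp
  ultimately show ?thesis by (simp add: sin_gt_zero)
qed

lemma ee_nonzero: "ee n i \<noteq> 0"
  by (simp add: ee_def cis_neq_zero)

lemma ee_inj: "\<lbrakk>1 \<le> i; i \<le> n; 1 \<le> j; j \<le> n; ee n i = ee n j\<rbrakk> \<Longrightarrow> i = j"
  by (metis crs_ee_pos crs_simps(9) less_irrefl linorder_neqE_nat)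

lemma Im_ee_pos: "\<lbrakk>2 \<le> j; j \<le> n\<rbrakk> \<Longrightarrow> Im (ee n j) > 0"
  using crs_ee_pos[of 1 j n] by (simp add: crs_def ee_def)

lemma Im_ee_nonneg: "\<lbrakk>1 \<le> j; j \<le> n\<rbrakk> \<Longrightarrow> Im (ee n j) \<ge> 0"
  using Im_ee_pos[of j n] by (cases "j = 1") (auto simp: ee_def intro: less_imp_le)

subsection \<open>Rhombi\<close>

lemma rhomb_eq: "rhomb n (i,j,t) = {t + of_real a * ee n i + of_real b * ee n j | a b.
        0 \<le> a \<and> a \<le> 1 \<and> 0 \<le> b \<and> b \<le> 1}"
  by (simp add: rhomb_def)

lemma rhomb_image:
  "rhomb n (i,j,t) = (\<lambda>(a,b). t + of_real a * ee n i + of_real b * ee n j) ` ({0..1} \<times> {0..1})"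
  by (auto simp: rhomb_eq image_iff) (metis+)

lemma compact_rhomb: "compact (rhomb n \<tau>)"
proof -
  obtain i j t where "\<tau> = (i,j,t)" by (cases \<tau>)
  then show ?thesis unfolding \<open>\<tau> = _\<close> rhomb_image case_prod_unfold
    by (intro compact_continuous_image continuous_intros compact_Times compact_Icc)
qed

lemma convex_rhomb: "convex (rhomb n \<tau>)"
proof -
  obtain i j t where t: "\<tau> = (i,j,t)" by (cases \<tau>)
  have "rhomb n \<tau> = (\<lambda>x. t + x) ` (\<lambda>(a,b). of_real a * ee n i + of_real b * ee n j) ` ({0..1::real} \<times> {0..1::real})"
    unfolding t rhomb_image by (auto simp: image_iff add.assoc)
  moreover have "linear (\<lambda>(a::real,b::real). of_real a * ee n i + of_real b * ee n j)"
    by (rule linearI) (auto simp: algebra_simps scaleR_conv_of_real)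
  ultimately show ?thesis
    by (auto intro!: convex_translation convex_linear_image convex_Times)
qed

lemma interior_rhomb_nonempty:
  assumes "1 \<le> i" "i < j" "j \<le> n"
  shows "interior (rhomb n (i,j,t)) \<noteq> {}"
proof -
  let ?u = "ee n i" and ?v = "ee n j"
  have c: "crs ?u ?v > 0" using crs_ee_pos assms by auto
  \<comment> \<open>Cramer coordinates with respect to \<open>t\<close> and the two sides; the
    preimage of the open unit square is an open subset of the rhombus containing its centre.\<close>
  define f where "f = (\<lambda>z. (crs (z - t) ?v / crs ?u ?v, crs ?u (z - t) / crs ?u ?v))"
  have "continuous_on UNIV f" unfolding f_def crs_def
    by (intro continuous_intros) (use c in \<open>auto simp: crs_def\<close>)
  moreover have "open ({0<..<1::real} \<times> {0<..<1::real})" by (intro open_Times) auto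
  ultimately have "open (f -` ({0<..<1} \<times> {0<..<1}))" by (simp add: open_vimage)
  moreover have "f -` ({0<..<1} \<times> {0<..<1}) \<subseteq> rhomb n (i,j,t)"
  proof
    fix z assume "z \<in> f -` ({0<..<1} \<times> {0<..<1})"
    then have "fst (f z) \<in> {0<..<1}" "snd (f z) \<in> {0<..<1}" by (auto simp: mem_Times_iff)
    moreover have "z = t + of_real (fst (f z)) * ?u + of_real (snd (f z)) * ?v"
      using crs_decompose[of ?u ?v "z - t"] c unfolding f_def fst_conv snd_conv
      by (metis add.assoc add.commute diff_add_cancel less_irrefl)
    ultimately show "z \<in> rhomb n (i,j,t)" unfolding rhomb_eq
      by (smt (verit) greaterThanLessThan_iff mem_Collect_eq)
  qed
  moreover have "f (t + of_real (1/2) * ?u + of_real (1/2) * ?v) = (1/2, 1/2)"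
    using c unfolding f_def by (simp only: crs_simps add.assoc add_diff_cancel_left') simp
  then have "t + of_real (1/2) * ?u + of_real (1/2) * ?v \<in> f -` ({0<..<1} \<times> {0<..<1})"
    by simp
  ultimately show ?thesis using interiorI by blast
qed

text \<open>Lets an open set that meets a tile be seen to meet its interior, where different tiles
  are disjoint.\<close>

lemma rhomb_closure_interior:
  assumes "1 \<le> i" "i < j" "j \<le> n"
  shows "closure (interior (rhomb n (i,j,t))) = rhomb n (i,j,t)"
  using convex_closure_interior[OF convex_rhomb interior_rhomb_nonempty[OF assms]]
  by (simp add: compact_imp_closed compact_rhomb)

lemma corners_subset_rhomb: "set (corners n \<tau>) \<subseteq> rhomb n \<tau>"
proof -
  obtain i j t where t: "\<tau> = (i,j,t)" by (cases \<tau>)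
  have "t + of_real a * ee n i + of_real b * ee n j \<in> rhomb n \<tau>" if "a \<in> {0,1}" "b \<in> {0,1}" for a b
    using that unfolding t rhomb_eq by (intro CollectI exI[of _ a] exI[of _ b]) auto
  from this[of 0 0] this[of 0 1] this[of 1 0] this[of 1 1] show ?thesis
    by (auto simp: t corners_def)
qed

subsection \<open>Planar geometry of a flip\<close>

definition valid_flip :: "nat \<Rightarrow> flipdat \<Rightarrow> bool" where
  "valid_flip n d \<longleftrightarrow> (case d of (i,j,k,c,up) \<Rightarrow> 1 \<le> i \<and> i < j \<and> j < k \<and> k \<le> n)"

text \<open>Displacement along an axis when starting from the bottom vertex: an axis already
  contained in its position is walked backwards.\<close>

definition gdir :: "nat \<Rightarrow> flipdat \<Rightarrow> nat \<Rightarrow> complex" where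
  "gdir n d a = (if a \<in> wbits d then - ee n (fidx d a) else ee n (fidx d a))"

definition qpt :: "nat \<Rightarrow> flipdat \<Rightarrow> (nat \<Rightarrow> real) \<Rightarrow> complex" where
  "qpt n d t = fpos n d {} + of_real (t 0) * gdir n d 0 + of_real (t 1) * gdir n d 1
                 + of_real (t 2) * gdir n d 2"

text \<open>The direction \<open>(dcoef 0, dcoef 1, dcoef 2)\<close> spans the kernel of the planar projection
  \<open>qpt\<close> of the cube; all three coefficients are positive.\<close>

definition dcoef :: "nat \<Rightarrow> flipdat \<Rightarrow> nat \<Rightarrow> real" where
  "dcoef n d a = (if a = 0 then crs (ee n (fidx d 1)) (ee n (fidx d 2))
     else if a = 1 then crs (ee n (fidx d 0)) (ee n (fidx d 2))
     else crs (ee n (fidx d 0)) (ee n (fidx d 1)))"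

text \<open>The planar rhombus underlying \<open>cface\<close>, separated from the naming of
  vertices so that it can be located inside a tiling.\<close>

definition ctile :: "nat \<Rightarrow> flipdat \<Rightarrow> nat \<Rightarrow> bool \<Rightarrow> tile" where
  "ctile n d a \<beta> = (let pq = (if a = 0 then (fidx d 1, fidx d 2)
             else if a = 1 then (fidx d 0, fidx d 2) else (fidx d 0, fidx d 1))
     in (fst pq, snd pq, fpos n d ((wbits d - {a}) \<union> (if \<beta> then {a} else {}))))"

lemma cface_ctile: "cface n Ts m a \<beta> = tile_face n Ts (if \<beta> then m else m-1) (ctile n (fdat n Ts m) a \<beta>)"
  by (simp add: cface_def ctile_def Let_def)

lemma fidx_simps [simp]: "fidx (i,j,k,c,up) 0 = i" "fidx (i,j,k,c,up) 1 = j" "fidx (i,j,k,c,up) 2 = k"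
  by (auto simp: fidx_def)

lemma wbits_simps [simp]: "wbits (i,j,k,c,True) = {1}" "wbits (i,j,k,c,False) = {0,2}"
  by (auto simp: wbits_def)

lemma Pow012_cases:
  assumes "B \<subseteq> {0,1,2::nat}"
  obtains "B = {}" | "B = {0}" | "B = {1}" | "B = {2}" | "B = {0,1}" | "B = {0,2}" | "B = {1,2}" | "B = {0,1,2}"
proof -
  have "B \<in> Pow axes" using assms by simp
  then show ?thesis using that unfolding Pow_insert Pow_empty by auto
qed

lemma Pow012: "Pow {0,1,2::nat} = {{},{0},{1},{2},{0,1},{0,2},{1,2},{0,1,2}}"
proof (intro equalityI subsetI)
  fix B assume "B \<in> Pow {0,1,2::nat}"
  then show "B \<in> {{},{0},{1},{2},{0,1},{0,2},{1,2},{0,1,2}}"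
    by (rule PowD[THEN Pow012_cases]) simp_all
next
  fix B :: "nat set" assume "B \<in> {{},{0},{1},{2},{0,1},{0,2},{1,2},{0,1,2}}"
  then show "B \<in> Pow axes" by (elim insertE emptyE) simp_all
qed

lemma symdiff_iff: "x \<in> symdiff A B \<longleftrightarrow> (x \<in> A) \<noteq> (x \<in> B)"
  by (auto simp: symdiff_def)

lemma sum_symdiff_012:
  fixes f :: "nat \<Rightarrow> complex"
  assumes "A \<subseteq> axes" "B \<subseteq> axes"
  shows "sum f (symdiff A B) = (if (0 \<in> A) \<noteq> (0 \<in> B) then f 0 else 0)
    + (if (1 \<in> A) \<noteq> (1 \<in> B) then f 1 else 0) + (if (2 \<in> A) \<noteq> (2 \<in> B) then f 2 else 0)"
proof -
  have "symdiff A B = axes \<inter> symdiff A B" using assms unfolding symdiff_def by blast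
  then have "sum f (symdiff A B) = (\<Sum>a\<in>axes. if a \<in> symdiff A B then f a else 0)"
    using sum.inter_restrict[of "{0,1,2}" f "symdiff A B"] by simp
  then show ?thesis by (simp add: symdiff_iff add.assoc)
qed

lemma fpos_alt:
  assumes "B \<subseteq> axes"
  shows "fpos n (i,j,k,c,up) B = c + (if (0 \<in> B) = up then ee n i else 0)
     + (if (1 \<in> B) = up then 0 else ee n j) + (if (2 \<in> B) = up then ee n k else 0)"
proof -
  have w: "wbits (i,j,k,c,up) \<subseteq> axes" by (cases up) simp_all
  show ?thesis
    unfolding fpos_def prod.case sum_symdiff_012[OF assms w]
    by (cases up) (simp_all add: add_ac)
qed

lemma fpos_qpt:
  assumes "B \<subseteq> axes"
  shows "fpos n d B = qpt n d (\<lambda>a. of_bool (a \<in> B))"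
proof -
  obtain i j k c up where d: "d = (i,j,k,c,up)" by (cases d)
  show ?thesis unfolding d qpt_def gdir_def
    by (cases up) (auto simp: fpos_alt[OF assms] fpos_alt[of "{}"])
qed

text \<open>This is \<open>crs_three_term\<close> up to a global sign: for both directions of the
  flip the middle axis is the one whose sign in \<open>gdir\<close> differs from the other two,
  which is what makes all coefficients positive.\<close>

lemma gdir_dcoef: "of_real (dcoef n d 0) * gdir n d 0 + of_real (dcoef n d 1) * gdir n d 1
   + of_real (dcoef n d 2) * gdir n d 2 = 0"
proof -
  obtain i j k c up where d: "d = (i,j,k,c,up)" by (cases d)
  show ?thesis using crs_three_term[of "ee n j" "ee n k" "ee n i"] unfolding d gdir_def dcoef_def
    by (cases up) (auto simp: algebra_simps)
qed

lemma dcoef_pos: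
  assumes "valid_flip n d"
  shows "dcoef n d a > 0"
proof -
  obtain i j k c up where d: "d = (i,j,k,c,up)" by (cases d)
  show ?thesis using assms unfolding d dcoef_def valid_flip_def by (auto intro!: crs_ee_pos)
qed

text \<open>Axes 0 and 2 carry the same sign in \<open>gdir\<close> whichever way the flip goes, so
  they form a basis with a determinant independent of that direction.\<close>

lemma crs_gdir: "crs (gdir n d 0) (gdir n d 2) = dcoef n d 1"
proof -
  obtain i j k c up where d: "d = (i,j,k,c,up)" by (cases d)
  show ?thesis unfolding d gdir_def dcoef_def by (cases up) auto
qed

lemma qpt_shift: "qpt n d (\<lambda>a. t a + \<mu> * dcoef n d a) = qpt n d t"
proof -
  have "qpt n d (\<lambda>a. t a + \<mu> * dcoef n d a) = qpt n d t + of_real \<mu> *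
   (of_real (dcoef n d 0) * gdir n d 0 + of_real (dcoef n d 1) * gdir n d 1
   + of_real (dcoef n d 2) * gdir n d 2)"
    unfolding qpt_def by (simp add: algebra_simps)
  then show ?thesis unfolding gdir_dcoef by simp
qed

text \<open>The kernel of the projection is one-dimensional: after matching axis 1 by a shift, the
  remaining two axes are independent.\<close>

lemma qpt_eq_imp:
  assumes "valid_flip n d" "qpt n d t = qpt n d s"
  shows "\<exists>\<mu>. \<forall>a\<in>axes. s a = t a + \<mu> * dcoef n d a"
proof -
  let ?D = "dcoef n d"
  note D = dcoef_pos[OF assms(1)]
  define \<mu> where "\<mu> = (s 1 - t 1) / ?D 1"
  have s1: "s 1 = t 1 + \<mu> * ?D 1" using D[of 1] by (simp add: \<mu>_def)
  have "qpt n d (\<lambda>a. t a + \<mu> * ?D a) = qpt n d s" using assms qpt_shift by simp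
  then have "of_real (t 0 + \<mu> * ?D 0) * gdir n d 0 + of_real (t 2 + \<mu> * ?D 2) * gdir n d 2
    = of_real (s 0) * gdir n d 0 + of_real (s 2) * gdir n d 2"
    unfolding qpt_def s1 by simp
  then have "t 0 + \<mu> * ?D 0 = s 0 \<and> t 2 + \<mu> * ?D 2 = s 2"
    by (rule crs_independent) (use crs_gdir D[of 1] in auto)
  then show ?thesis using s1 by (intro exI[of _ \<mu>]) auto
qed

text \<open>The preimage of \<open>p\<close> under \<open>qpt\<close> with coordinate 0 on axis 1.
  It need not lie in the cube; it only selects the fibre.\<close>

definition sect :: "nat \<Rightarrow> flipdat \<Rightarrow> complex \<Rightarrow> nat \<Rightarrow> real" where
  "sect n d p a = (let q = p - fpos n d {} in
     if a = 0 then crs q (gdir n d 2) / dcoef n d 1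
     else if a = 2 then crs (gdir n d 0) q / dcoef n d 1 else 0)"

lemma qpt_sect:
  assumes "valid_flip n d"
  shows "qpt n d (sect n d p) = p"
  using crs_decompose[of "gdir n d 0" "gdir n d 2" "p - fpos n d {}"] dcoef_pos[OF assms, of 1]
  unfolding qpt_def sect_def Let_def crs_gdir
  by (simp add: algebra_simps)

text \<open>\<open>lam\<close> and \<open>ulam\<close> measure how far one can move from \<open>t\<close> inside the unit cube along this kernel
  direction, down and up, so \<open>flen\<close> is the length of the fibre over a point of the plane.\<close>

definition lam :: "nat \<Rightarrow> flipdat \<Rightarrow> (nat \<Rightarrow> real) \<Rightarrow> real" where
  "lam n d t = min (t 0 / dcoef n d 0) (min (t 1 / dcoef n d 1) (t 2 / dcoef n d 2))"

definition ulam :: "nat \<Rightarrow> flipdat \<Rightarrow> (nat \<Rightarrow> real) \<Rightarrow> real" where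
  "ulam n d t = lam n d (\<lambda>a. 1 - t a)"

definition flen :: "nat \<Rightarrow> flipdat \<Rightarrow> complex \<Rightarrow> real" where
  "flen n d p = max 0 (lam n d (sect n d p) + ulam n d (sect n d p))"

lemma lam_ge_iff:
  assumes "valid_flip n d"
  shows "x \<le> lam n d t \<longleftrightarrow> (\<forall>a\<in>axes. x * dcoef n d a \<le> t a)"
  using dcoef_pos[OF assms] by (auto simp: lam_def pos_le_divide_eq)

lemma lam_shift:
  assumes "valid_flip n d" "\<forall>a\<in>axes. s a = t a + \<mu> * dcoef n d a"
  shows "lam n d s = lam n d t + \<mu>"
proof -
  have "s a / dcoef n d a = t a / dcoef n d a + \<mu>" if "a \<in> axes" for a
  proof -
    have "s a = t a + \<mu> * dcoef n d a" using assms(2) that by blast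
    then show ?thesis using dcoef_pos[OF assms(1), of a] by (simp add: field_simps)
  qed
  then show ?thesis by (simp add: lam_def min_def)
qed

lemma ulam_shift:
  assumes "valid_flip n d" "\<forall>a\<in>axes. s a = t a + \<mu> * dcoef n d a"
  shows "ulam n d s = ulam n d t - \<mu>"
  using lam_shift[OF assms(1), of "\<lambda>a. 1 - s a" "\<lambda>a. 1 - t a" "-\<mu>"] assms(2)
  by (simp add: ulam_def)

lemma lam_attained:
  assumes "valid_flip n d"
  obtains a where "a \<in> axes" "t a = lam n d t * dcoef n d a"
proof -
  have "lam n d t = t 0 / dcoef n d 0 \<or> lam n d t = t 1 / dcoef n d 1 \<or> lam n d t = t 2 / dcoef n d 2"
    by (auto simp: lam_def min_def)
  then obtain a where "a \<in> axes" "lam n d t = t a / dcoef n d a" by blast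
  then show ?thesis using that[of a] dcoef_pos[OF assms, of a] by simp
qed

text \<open>A move along the fibre changes \<open>lam\<close> and \<open>ulam\<close> by opposite
  amounts, so their sum depends on the plane point alone and any preimage may replace
  \<open>sect\<close>.\<close>

lemma flen_qpt:
  assumes "valid_flip n d"
  shows "flen n d (qpt n d t) = max 0 (lam n d t + ulam n d t)"
proof -
  obtain \<mu> where "\<forall>a\<in>axes. sect n d (qpt n d t) a = t a + \<mu> * dcoef n d a"
    using qpt_eq_imp[OF assms, of t "sect n d (qpt n d t)"] qpt_sect[OF assms] by auto
  from lam_shift[OF assms this] ulam_shift[OF assms this] show ?thesis
    by (simp add: flen_def)
qed

lemma cube_iff:
  assumes "valid_flip n d"
  shows "(cb t) \<longleftrightarrow> 0 \<le> lam n d t \<and> 0 \<le> ulam n d t"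
  unfolding ulam_def lam_ge_iff[OF assms] by auto

lemma flen_cube:
  assumes "valid_flip n d" "cb t"
  shows "flen n d (qpt n d t) = lam n d t + ulam n d t"
  using assms cube_iff[OF assms(1)] flen_qpt[OF assms(1)] by auto

lemma continuous_on_flen: "valid_flip n d \<Longrightarrow> continuous_on S (flen n d)"
  using dcoef_pos[of n d]
  unfolding flen_def lam_def ulam_def sect_def Let_def crs_def
  by simp (intro continuous_intros; simp add: less_imp_neq[THEN not_sym])

text \<open>Cube coordinates counted from the base point \<open>c\<close> of the hexagon instead of
  from the bottom vertex.\<close>

definition uco :: "flipdat \<Rightarrow> (nat \<Rightarrow> real) \<Rightarrow> nat \<Rightarrow> real" where
  "uco d t b = (if b \<in> wbits d then 1 - t b else t b)"

lemma qpt_uco: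
  "qpt n (i,j,k,c,up) t = c + of_real (uco (i,j,k,c,up) t 0) * ee n i
     + of_real (uco (i,j,k,c,up) t 1) * ee n j + of_real (uco (i,j,k,c,up) t 2) * ee n k"
  by (cases up) (simp_all add: qpt_def gdir_def uco_def fpos_alt[of "{}"] algebra_simps)

lemma uco_cube: "cb (uco d t) \<longleftrightarrow> cb t"
  by (auto simp: uco_def)

lemma ctile_0: "ctile n (i,j,k,c,up) 0 \<beta> = (j, k, c + of_bool (\<beta> = up) * ee n i)"
  by (cases up; cases \<beta>) (simp_all add: ctile_def fpos_alt Let_def insert_Diff_if)

lemma ctile_1: "ctile n (i,j,k,c,up) 1 \<beta> = (i, k, c + of_bool (\<beta> \<noteq> up) * ee n j)"
  by (cases up; cases \<beta>) (simp_all add: ctile_def fpos_alt Let_def insert_Diff_if)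

lemma ctile_2: "ctile n (i,j,k,c,up) 2 \<beta> = (i, j, c + of_bool (\<beta> = up) * ee n k)"
  by (cases up; cases \<beta>) (simp_all add: ctile_def fpos_alt Let_def insert_Diff_if)

lemmas ctile_alt = ctile_0 ctile_1 ctile_2

lemma qpt_in_ctile:
  assumes a: "a \<in> axes" and t: "cb t" "t a = of_bool \<beta>"
  shows "qpt n d t \<in> rhomb n (ctile n d a \<beta>)"
proof -
  obtain i j k c up where d: "d = (i,j,k,c,up)" by (cases d)
  let ?u = "uco d t"
  have u: "cb ?u" using t(1) uco_cube by blast
  show ?thesis using a
  proof (elim insertE emptyE)
    assume a: "a = 0"
    have "?u 0 = of_bool (\<beta> = up)" using t(2) unfolding a d uco_def by (cases up; cases \<beta>) auto
    then show ?thesis using u unfolding a d ctile_0 rhomb_eq qpt_uco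
      by (intro CollectI exI[of _ "?u 1"] exI[of _ "?u 2"]) (auto simp: d)
  next
    assume a: "a = 1"
    have "?u 1 = of_bool (\<beta> \<noteq> up)" using t(2) unfolding a d uco_def by (cases up; cases \<beta>) auto
    then show ?thesis using u unfolding a d ctile_1 rhomb_eq qpt_uco
      by (intro CollectI exI[of _ "?u 0"] exI[of _ "?u 2"]) (auto simp: d)
  next
    assume a: "a = 2"
    have "?u 2 = of_bool (\<beta> = up)" using t(2) unfolding a d uco_def by (cases up; cases \<beta>) auto
    then show ?thesis using u unfolding a d ctile_2 rhomb_eq qpt_uco
      by (intro CollectI exI[of _ "?u 0"] exI[of _ "?u 1"]) (auto simp: d)
  qed
qed

lemma corners_ctile:
  assumes "a \<in> axes"
  shows "set (corners n (ctile n d a \<beta>)) = {fpos n d B | B. B \<subseteq> axes \<and> (a \<in> B \<longleftrightarrow> \<beta>)}"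
proof -
  obtain i j k c up where d: "d = (i,j,k,c,up)" by (cases d)
  have ins: "{B \<in> insert x A. Q B} = (if Q x then insert x {B \<in> A. Q B} else {B \<in> A. Q B})"
    for x A and Q :: "nat set \<Rightarrow> bool" by auto
  have emp: "{B \<in> {}. Q B} = {}" for Q :: "nat set \<Rightarrow> bool" by simp
  have eq: "{fpos n d B | B. B \<subseteq> axes \<and> (a \<in> B \<longleftrightarrow> \<beta>)} = fpos n d ` {B \<in> Pow axes. (a \<in> B \<longleftrightarrow> \<beta>)}"
    by blast
  show ?thesis using assms unfolding eq unfolding Pow012 ins emp d
    by (elim insertE emptyE; cases \<beta>; cases up)
       (simp_all add: corners_def ctile_alt fpos_alt add_ac insert_commute)
qed

text \<open>Kept for an arbitrary function of planar points, so that it applies to the vertex names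
  before the flip and to those after it.\<close>

lemma ctile_corner_sum:
  fixes z :: "complex \<Rightarrow> complex"
  assumes "ctile n d a \<beta> = (p,q,t)" "a \<in> axes"
  shows "z t * z (t + ee n p + ee n q) + z (t + ee n p) * z (t + ee n q) =
    (if a = 0 then (if \<beta> then z (fpos n d {0}) * z (fpos n d {0,1,2}) + z (fpos n d {0,1}) * z (fpos n d {0,2})
                    else z (fpos n d {}) * z (fpos n d {1,2}) + z (fpos n d {1}) * z (fpos n d {2}))
     else if a = 1 then (if \<beta> then z (fpos n d {1}) * z (fpos n d {0,1,2}) + z (fpos n d {0,1}) * z (fpos n d {1,2})
                    else z (fpos n d {}) * z (fpos n d {0,2}) + z (fpos n d {0}) * z (fpos n d {2}))
     else (if \<beta> then z (fpos n d {2}) * z (fpos n d {0,1,2}) + z (fpos n d {0,2}) * z (fpos n d {1,2})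
                    else z (fpos n d {}) * z (fpos n d {0,1}) + z (fpos n d {0}) * z (fpos n d {1})))"
proof -
  obtain i j k c up where d: "d = (i,j,k,c,up)" by (cases d)
  show ?thesis using assms(2,1) unfolding d
    by (elim insertE emptyE; cases \<beta>; cases up)
       (auto simp: ctile_alt fpos_alt add_ac mult_ac)
qed

lemma flip_data_valid: "flip_data n T T' d \<Longrightarrow> valid_flip n d"
  by (auto simp: flip_data_def valid_flip_def)

text \<open>Removes the distinction between the two directions of a flip: the old tiles are the
  faces at the bottom vertex, the new ones those at the top vertex.\<close>

lemma flip_data_ctile:
  assumes "flip_data n T T' d"
  shows "(\<lambda>a. ctile n d a False) ` axes \<subseteq> T"
    "T' = (T - (\<lambda>a. ctile n d a False) ` axes) \<union> (\<lambda>a. ctile n d a True) ` axes"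
proof -
  obtain i j k c up where d: "d = (i,j,k,c,up)" by (cases d)
  have "(\<lambda>a. ctile n d a False) ` axes = (if up then hexA n i j k c else hexB n i j k c)"
    "(\<lambda>a. ctile n d a True) ` axes = (if up then hexB n i j k c else hexA n i j k c)"
    unfolding d by (auto simp: ctile_alt hexA_def hexB_def)
  then show "(\<lambda>a. ctile n d a False) ` axes \<subseteq> T"
    "T' = (T - (\<lambda>a. ctile n d a False) ` axes) \<union> (\<lambda>a. ctile n d a True) ` axes"
    using assms unfolding flip_data_def d by (auto split: if_splits)
qed

lemma ctile_bot_neq_top:
  assumes "valid_flip n d" "a \<in> axes" "b \<in> axes"
  shows "ctile n d a False \<noteq> ctile n d b True"
proof -
  obtain i j k c up where d: "d = (i,j,k,c,up)" by (cases d)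
  show ?thesis using assms ee_nonzero[of n i] ee_nonzero[of n j] ee_nonzero[of n k]
    unfolding d valid_flip_def by (cases up) (auto simp: ctile_alt)
qed

text \<open>The exceptional case occurs in a regular hexagon, where the old and the new interior
  vertex are the same point of the plane.\<close>

lemma fpos_eq_imp:
  assumes "valid_flip n d" "A \<subseteq> axes" "B \<subseteq> axes" "fpos n d A = fpos n d B" "A \<noteq> B"
  shows "A = {} \<and> B = {0,1,2} \<or> A = {0,1,2} \<and> B = {}"
proof -
  obtain \<mu> where "\<forall>a\<in>axes. of_bool (a \<in> B) = (of_bool (a \<in> A) :: real) + \<mu> * dcoef n d a"
    using qpt_eq_imp[OF assms(1)] assms(2-4) by (metis fpos_qpt)
  then have *: "of_bool (a \<in> B) = (of_bool (a \<in> A) :: real) + \<mu> * dcoef n d a" if "a \<in> axes" for a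
    using that by blast
  note D = dcoef_pos[OF assms(1)]
  have sub: "x \<in> axes" if "x \<in> A \<or> x \<in> B" for x
    using that assms(2,3) by (meson subsetD)
  consider "\<mu> = 0" | "\<mu> > 0" | "\<mu> < 0" by linarith
  then show ?thesis
  proof cases
    case 1
    then have "a \<in> A \<longleftrightarrow> a \<in> B" if "a \<in> axes" for a using *[OF that]
      by (simp add: of_bool_def split: if_splits)
    then have "A = B" using sub by (intro set_eqI) metis
    then show ?thesis using assms(5) by simp
  next
    \<comment> \<open>A nonzero shift along the kernel moves all three bits strictly in the same
      direction, so it can only join opposite corners.\<close>
    case 2
    then have "\<mu> * dcoef n d a > 0" for a using D by simp
    then have m: "a \<notin> A" "a \<in> B" if "a \<in> axes" for a using *[OF that]
      by (smt (verit) of_bool_def zero_neq_one)+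
    have "A = {}" using m(1) sub by (metis equals0I)
    moreover have "B = {0,1,2}" using m(2) assms(3) by (intro equalityI subsetI) (metis subsetD)+
    ultimately show ?thesis by simp
  next
    case 3
    then have "\<mu> * dcoef n d a < 0" for a using D mult_neg_pos by blast
    then have m: "a \<notin> B" "a \<in> A" if "a \<in> axes" for a using *[OF that]
      by (smt (verit) of_bool_def zero_neq_one)+
    have "B = {}" using m(1) sub by (metis equals0I)
    moreover have "A = {0,1,2}" using m(2) assms(2) by (intro equalityI subsetI) (metis subsetD)+
    ultimately show ?thesis by simp
  qed
qed

definition center :: "bool \<Rightarrow> nat set" where "center \<beta> = (if \<beta> then {0,1,2} else {})"

text \<open>From the bottom or the top vertex the kernel direction runs into the cube, because its
  components are all positive.\<close>

lemma flen_center_pos: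
  assumes "valid_flip n d"
  shows "flen n d (fpos n d (center \<beta>)) > 0"
  using dcoef_pos[OF assms]
  by (cases \<beta>) (auto simp: center_def fpos_qpt flen_qpt[OF assms] lam_def ulam_def)

lemma hexagon_covered:
  assumes "valid_flip n d" "lam n d t + ulam n d t \<ge> 0"
  shows "\<exists>a\<in>axes. qpt n d t \<in> rhomb n (ctile n d a \<beta>)"
proof -
  \<comment> \<open>Slide along the fibre to its highest or lowest point in the cube; that point
    lies on a face through the top or the bottom vertex.\<close>
  define \<mu> where "\<mu> = (if \<beta> then ulam n d t else - lam n d t)"
  define s where "s = (\<lambda>a. t a + \<mu> * dcoef n d a)"
  have sh: "lam n d s = lam n d t + \<mu>" "ulam n d s = ulam n d t - \<mu>"
    using lam_shift[OF assms(1)] ulam_shift[OF assms(1)] by (auto simp: s_def)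
  then have cube: "cb s"
    unfolding cube_iff[OF assms(1)] using assms(2) by (auto simp: \<mu>_def)
  have q: "qpt n d t = qpt n d s" unfolding s_def qpt_shift ..
  have "\<exists>a\<in>axes. s a = of_bool \<beta>"
  proof (cases \<beta>)
    case True
    with sh have "lam n d (\<lambda>a. 1 - s a) = 0" by (simp add: \<mu>_def ulam_def)
    with lam_attained[OF assms(1), of "\<lambda>a. 1 - s a"] show ?thesis using True by fastforce
  next
    case False
    with sh have "lam n d s = 0" by (simp add: \<mu>_def)
    with lam_attained[OF assms(1), of s] show ?thesis using False by fastforce
  qed
  then obtain a where "a \<in> axes" "s a = of_bool \<beta>" by blast
  then show ?thesis unfolding q by (intro bexI[of _ a] qpt_in_ctile[OF _ cube])
qed

lemma flen_pos_covered:
  assumes "valid_flip n d" "flen n d p > 0"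
  shows "\<exists>a\<in>axes. p \<in> rhomb n (ctile n d a \<beta>)"
  using hexagon_covered[OF assms(1), of "sect n d p" \<beta>] assms(2)
  unfolding qpt_sect[OF assms(1)] flen_def by auto

lemma open_hexagon: "valid_flip n d \<Longrightarrow> open {p. flen n d p > 0}"
  using continuous_on_flen by (intro open_Collect_less) auto

section \<open>Tilings and the open hexagon of a flip\<close>

lemma tiling_tileD:
  assumes "is_tiling n T" "(i,j,t) \<in> T"
  shows "1 \<le> i" "i < j" "j \<le> n"
  using assms unfolding is_tiling_def by auto

lemma tiling_interior_disjoint:
  "\<lbrakk>is_tiling n T; \<tau> \<in> T; \<sigma> \<in> T; \<tau> \<noteq> \<sigma>\<rbrakk> \<Longrightarrow> interior (rhomb n \<tau>) \<inter> interior (rhomb n \<sigma>) = {}"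
  unfolding is_tiling_def by blast

lemma tiling_cover: "is_tiling n T \<Longrightarrow> \<Union>(rhomb n ` T) = Pn n"
  unfolding is_tiling_def by blast

lemma tiling_meet:
  assumes "is_tiling n T" "\<tau> \<in> T" "\<sigma> \<in> T" "\<tau> \<noteq> \<sigma>" "q \<in> rhomb n \<tau>" "q \<in> rhomb n \<sigma>"
  shows "(\<exists>p \<in> set (corners n \<tau>) \<inter> set (corners n \<sigma>). rhomb n \<tau> \<inter> rhomb n \<sigma> = {p}) \<or>
    (\<exists>E \<in> tile_edges n \<tau> \<inter> tile_edges n \<sigma>. rhomb n \<tau> \<inter> rhomb n \<sigma> = E)"
proof -
  have "\<forall>\<tau>\<in>T. \<forall>\<sigma>\<in>T. \<tau> \<noteq> \<sigma> \<longrightarrow> (rhomb n \<tau> \<inter> rhomb n \<sigma> = {} \<or>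
         (\<exists>p \<in> set (corners n \<tau>) \<inter> set (corners n \<sigma>). rhomb n \<tau> \<inter> rhomb n \<sigma> = {p}) \<or>
         (\<exists>E \<in> tile_edges n \<tau> \<inter> tile_edges n \<sigma>. rhomb n \<tau> \<inter> rhomb n \<sigma> = E))"
    using assms(1) unfolding is_tiling_def by simp
  from this[rule_format, OF assms(2-4)] show ?thesis using assms(5,6) by (elim disjE) auto
qed

lemma tiling_unique:
  assumes "is_tiling n T" "(i,j,t) \<in> T" "(i,j,t') \<in> T"
  shows "t = t'"
proof -
  have "\<forall>i j. 1 \<le> i \<and> i < j \<and> j \<le> n \<longrightarrow> (\<exists>!t. (i,j,t) \<in> T)"
    using assms(1) unfolding is_tiling_def by simp
  then have "\<exists>!t. (i,j,t) \<in> T" using tiling_tileD[OF assms(1,2)] by simp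
  then show ?thesis using assms(2,3) by (elim ex1E) metis
qed

lemma tiling_finite:
  assumes "is_tiling n T"
  shows "finite T"
proof -
  have "inj_on (\<lambda>(i,j,t). (i,j)) T" using tiling_unique[OF assms] by (auto simp: inj_on_def)
  moreover have "(\<lambda>(i,j,t). (i,j)) ` T \<subseteq> {0..n} \<times> {0..n}" using tiling_tileD[OF assms] by fastforce
  ultimately show ?thesis by (meson finite_SigmaI finite_atLeastAtMost inj_on_finite)
qed

text \<open>A further tile meeting the open hexagon would have interior points inside one of the
  three rhombi that cover it.\<close>

lemma tiling_hexagon:
  assumes "is_tiling n T" "valid_flip n d" "(\<lambda>a. ctile n d a \<beta>) ` axes \<subseteq> T"
    and "\<tau> \<in> T" "p \<in> rhomb n \<tau>" "flen n d p > 0"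
  shows "\<tau> \<in> (\<lambda>a. ctile n d a \<beta>) ` axes"
proof (rule ccontr)
  assume no: "\<tau> \<notin> (\<lambda>a. ctile n d a \<beta>) ` axes"
  have cl: "closure (interior (rhomb n \<sigma>)) = rhomb n \<sigma>" if "\<sigma> \<in> T" for \<sigma>
    using rhomb_closure_interior tiling_tileD[OF assms(1)] that by (metis prod_cases3)
  let ?O = "interior (rhomb n \<tau>) \<inter> {p. flen n d p > 0}"
  have "{p. flen n d p > 0} \<inter> closure (interior (rhomb n \<tau>)) \<noteq> {}"
    using cl[OF assms(4)] assms(5,6) by blast
  then have "?O \<noteq> {}"
    using open_Int_closure_eq_empty[OF open_hexagon[OF assms(2)]] by blast
  then obtain p where p: "p \<in> ?O" by blast
  then obtain a where a: "a \<in> axes" "p \<in> rhomb n (ctile n d a \<beta>)"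
    using flen_pos_covered[OF assms(2)] by blast
  have aT: "ctile n d a \<beta> \<in> T" using assms(3) a by blast
  have "?O \<inter> closure (interior (rhomb n (ctile n d a \<beta>))) \<noteq> {}"
    using p a cl[OF aT] by blast
  then have "?O \<inter> interior (rhomb n (ctile n d a \<beta>)) \<noteq> {}"
    using open_Int_closure_eq_empty[of ?O] open_hexagon[OF assms(2)] by blast
  moreover have "\<tau> \<noteq> ctile n d a \<beta>" using no a by blast
  ultimately show False using tiling_interior_disjoint[OF assms(1,4) aT] by blast
qed

lemma tiling_star:
  assumes "is_tiling n T" "valid_flip n d" "(\<lambda>a. ctile n d a \<beta>) ` axes \<subseteq> T"
    and "\<tau> \<in> T" "fpos n d (center \<beta>) \<in> rhomb n \<tau>"
  shows "\<tau> \<in> (\<lambda>a. ctile n d a \<beta>) ` axes"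
  by (rule tiling_hexagon[OF assms flen_center_pos[OF assms(2)]])

text \<open>Both centres of a flip are therefore interior points of the polygon, which is where sign
  patterns can be prescribed.\<close>

lemma center_interior_Pn:
  assumes "is_tiling n T" "valid_flip n d" "(\<lambda>a. ctile n d a \<beta>) ` axes \<subseteq> T"
  shows "{p. flen n d p > 0} \<subseteq> interior (Pn n)"
proof (rule interior_maximal)
  show "{p. flen n d p > 0} \<subseteq> Pn n"
    using flen_pos_covered[OF assms(2)] assms(3) tiling_cover[OF assms(1)] by blast
qed (rule open_hexagon[OF assms(2)])

subsection \<open>Sign patterns on the tiles of one tiling\<close>

text \<open>Sides are given as point sets; membership in one of them is turned into a tile
  coordinate being 0 or 1.\<close>

lemma tile_edge_coord:
  assumes "crs (ee n p) (ee n q) \<noteq> 0" "E \<in> tile_edges n (p,q,t)"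
    "t + of_real a * ee n p + of_real b * ee n q \<in> E"
  shows "E = closed_segment t (t + ee n p) \<and> b = 0 \<or>
    E = closed_segment (t + ee n p) (t + ee n p + ee n q) \<and> a = 1 \<or>
    E = closed_segment (t + ee n q) (t + ee n p + ee n q) \<and> b = 1 \<or>
    E = closed_segment t (t + ee n q) \<and> a = 0"
proof -
  let ?z = "t + of_real a * ee n p + of_real b * ee n q"
  note ind = crs_independent[OF _ assms(1)]
  have seg: "\<exists>x. z = p + of_real x * v" if "z \<in> closed_segment p (p + v)" for z p v :: complex
    using that by (auto simp: in_segment scaleR_conv_of_real algebra_simps)
  have 1: "b = 0" if "?z \<in> closed_segment t (t + ee n p)"
    using seg[OF that] ind[of a b _ 0] by (auto simp: add.assoc)
  have 2: "a = 1" if "?z \<in> closed_segment (t + ee n p) (t + ee n p + ee n q)"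
    using seg[OF that] ind[of a b 1] by (auto simp: add.assoc)
  have 3: "b = 1" if "?z \<in> closed_segment (t + ee n q) (t + ee n p + ee n q)"
    using seg[of ?z "t + ee n q" "ee n p"] that ind[of a b _ 1] by (auto simp: add_ac)
  have 4: "a = 0" if "?z \<in> closed_segment t (t + ee n q)"
    using seg[OF that] ind[of a b 0] by (auto simp: add.assoc)
  show ?thesis using assms(2,3) 1 2 3 4 unfolding tile_edges_def by auto
qed

lemma corner_coord:
  assumes "w \<in> set (corners n (p,q,t))"
  obtains a b where "a \<in> {0,1}" "b \<in> {0,1}" "w = t + of_real a * ee n p + of_real b * ee n q"
  using assms that[of 0 0] that[of 0 1] that[of 1 0] that[of 1 1] by (auto simp: corners_def)

lemma ee_not_opposite:
  assumes "1 \<le> i" "i \<le> n" "1 \<le> j" "j \<le> n"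
  shows "ee n i \<noteq> - ee n j"
proof
  assume h: "ee n i = - ee n j"
  consider "i = j" | "i < j" | "j < i" by linarith
  then show False
  proof cases
    case 1 then show False using h ee_nonzero[of n j] by simp
  next
    case 2 then show False using h crs_ee_pos[of i j n] assms by simp
  next
    case 3 then show False using h crs_ee_pos[of j i n] assms by simp
  qed
qed

text \<open>A segment determines its endpoints up to order, and the reversed order would make two of
  the directions opposite, which \<open>ee_not_opposite\<close> excludes.\<close>

lemma tile_edge_direction:
  assumes "1 \<le> p" "p < q" "q \<le> n" "1 \<le> i" "i \<le> n"
    "closed_segment u (u + ee n i) \<in> tile_edges n (p,q,t)"
  shows "i = p \<and> (u = t \<or> u = t + ee n q) \<or> i = q \<and> (u = t \<or> u = t + ee n p)"
proof -
  have one: "i = k \<and> u = v" if "closed_segment u (u + ee n i) = closed_segment v (v + ee n k)"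
      "1 \<le> k" "k \<le> n" for v k
  proof -
    have "{u, u + ee n i} = {v, v + ee n k}" using that(1) by simp
    then have "(u = v \<and> u + ee n i = v + ee n k) \<or> (u = v + ee n k \<and> u + ee n i = v)"
      by (simp add: doubleton_eq_iff)
    then show ?thesis
    proof
      assume h: "u = v \<and> u + ee n i = v + ee n k"
      then have "ee n i = ee n k" by auto
      then show ?thesis using ee_inj[OF assms(4,5) that(2,3)] h by simp
    next
      assume "u = v + ee n k \<and> u + ee n i = v"
      then have "ee n i = - ee n k" by (auto simp: algebra_simps add_eq_0_iff2)
      then show ?thesis using ee_not_opposite[of i n k] assms that by simp
    qed
  qed
  have "t + ee n p + ee n q = (t + ee n q) + ee n p" by simp
  then have "closed_segment u (u + ee n i) \<in> {closed_segment t (t + ee n p),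
      closed_segment (t + ee n p) (t + ee n p + ee n q),
      closed_segment (t + ee n q) (t + ee n q + ee n p), closed_segment t (t + ee n q)}"
    using assms(6) unfolding tile_edges_def prod.case by (simp only:)
  moreover have "1 \<le> q" "p \<le> n" using assms(1-3) by auto
  ultimately show ?thesis using one[OF _ assms(1)] one[of _ q] assms(3) by (elim insertE emptyE) metis+
qed

lemma tile_edges_first:
  assumes "w = t \<or> w = t + ee n q"
  shows "closed_segment w (w + ee n p) \<in> tile_edges n (p,q,t)"
proof -
  have e: "t + ee n q + ee n p = t + ee n p + ee n q" by simp
  show ?thesis using assms
    by (elim disjE) (simp_all only: e tile_edges_def prod.case insert_iff refl simp_thms)
qed

lemma tile_edges_second:
  assumes "w = t \<or> w = t + ee n p"
  shows "closed_segment w (w + ee n q) \<in> tile_edges n (p,q,t)"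
  using assms by (elim disjE) (simp_all only: tile_edges_def prod.case insert_iff refl simp_thms)

text \<open>The tiles missing \<open>q\<close> are finitely many closed sets, so a short enough step
  from \<open>q\<close> stays inside the tiles that contain \<open>q\<close>.\<close>

lemma dir_tile:
  assumes "is_tiling n T" "q \<in> interior (Pn n)"
  obtains \<tau> \<delta> where "\<tau> \<in> T" "\<delta> > 0" "q \<in> rhomb n \<tau>" "q + of_real \<delta> * v \<in> rhomb n \<tau>"
proof -
  let ?N = "interior (Pn n) - \<Union>(rhomb n ` {\<tau>\<in>T. q \<notin> rhomb n \<tau>})"
  have "open ?N"
    using tiling_finite[OF assms(1)]
    by (intro open_Diff open_interior closed_Union) (auto intro: compact_imp_closed compact_rhomb)
  moreover have "((\<lambda>\<delta>. q + of_real \<delta> * v) \<longlongrightarrow> q + of_real 0 * v) (at_right 0)"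
    by (intro tendsto_intros)
  ultimately have "\<forall>\<^sub>F \<delta> in at_right 0. q + of_real \<delta> * v \<in> ?N"
    using assms(2) by (intro topological_tendstoD[where S = ?N]) auto
  moreover have "\<forall>\<^sub>F \<delta> in at_right (0::real). \<delta> > 0" by (rule eventually_at_right_less)
  ultimately have "\<forall>\<^sub>F \<delta> in at_right 0. \<delta> > 0 \<and> q + of_real \<delta> * v \<in> ?N" by (rule eventually_conj[rotated])
  then obtain \<delta> :: real where d: "\<delta> > 0" "q + of_real \<delta> * v \<in> ?N"
    using eventually_happens'[OF trivial_limit_at_right_real] by blast
  then have "q + of_real \<delta> * v \<in> \<Union>(rhomb n ` T)"
    using interior_subset unfolding tiling_cover[OF assms(1)] by blast
  then show ?thesis using d that by blast
qed

text \<open>Crosses an edge: the tile reached by a small step to the left has that edge as a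
  side.\<close>

lemma edge_left_tile:
  assumes T: "is_tiling n T" "S \<in> T" "1 \<le> i" "i \<le> n"
    and E: "closed_segment u (u + ee n i) \<in> tile_edges n S"
    and int: "u \<in> interior (Pn n) \<or> u + ee n i \<in> interior (Pn n)"
  obtains \<tau> z where "\<tau> \<in> T" "closed_segment u (u + ee n i) \<in> tile_edges n \<tau>"
    "z \<in> rhomb n \<tau>" "crs (ee n i) (z - u) > 0"
proof -
  \<comment> \<open>Only an endpoint is known to be interior to the polygon; moving slightly along
    the edge gives a relatively interior point of the edge with this property.\<close>
  have "\<exists>s>0. s < 1 \<and> u + of_real s * ee n i \<in> interior (Pn n)"
  proof -
    have *: "\<exists>s>0. s < (1::real) \<and> x + of_real s * v \<in> interior (Pn n)" if "x \<in> interior (Pn n)" for x v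
    proof -
      have "((\<lambda>\<delta>. x + of_real \<delta> * v) \<longlongrightarrow> x + of_real 0 * v) (at_right 0)"
        by (intro tendsto_intros)
      then have "\<forall>\<^sub>F s in at_right 0. x + of_real s * v \<in> interior (Pn n)"
        using that by (intro topological_tendstoD[where S = "interior (Pn n)"]) auto
      moreover have "\<forall>\<^sub>F s in at_right (0::real). s \<in> {0<..<1}"
        by (rule eventually_at_right_real) simp
      ultimately have "\<forall>\<^sub>F s in at_right 0. s \<in> {0<..<1} \<and> x + of_real s * v \<in> interior (Pn n)"
        by (rule eventually_conj[rotated])
      then show ?thesis
        using eventually_happens'[OF trivial_limit_at_right_real] by fastforce
    qed
    from int show ?thesis
    proof
      assume "u \<in> interior (Pn n)" then show ?thesis using * by blast
    next
      assume "u + ee n i \<in> interior (Pn n)"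
      from *[OF this, of "- ee n i"] obtain s :: real where
        "s > 0" "s < 1" "u + ee n i + of_real s * (- ee n i) \<in> interior (Pn n)" by blast
      then show ?thesis by (intro exI[of _ "1 - s"]) (simp add: algebra_simps)
    qed
  qed
  then obtain s where s: "0 < s" "s < 1" "u + of_real s * ee n i \<in> interior (Pn n)" by blast
  let ?q = "u + of_real s * ee n i"
  \<comment> \<open>The vector \<open>\<i> * ee n i\<close> is the left normal of the edge.\<close>
  obtain \<tau> \<delta> where \<tau>: "\<tau> \<in> T" "\<delta> > 0" "?q \<in> rhomb n \<tau>" "?q + of_real \<delta> * (\<i> * ee n i) \<in> rhomb n \<tau>"
    using dir_tile[OF T(1) s(3)] by blast
  have "crs (ee n i) (\<i> * ee n i) > 0"
    using ee_nonzero[of n i] by (simp add: crs_def complex_neq_0 power2_eq_square[symmetric])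
  then have left: "crs (ee n i) (?q + of_real \<delta> * (\<i> * ee n i) - u) > 0"
    using \<tau>(2) by simp
  have "closed_segment u (u + ee n i) \<in> tile_edges n \<tau>"
  proof (cases "\<tau> = S")
    case False
    obtain p q t where S: "S = (p,q,t)" by (cases S)
    have pq: "1 \<le> p" "p < q" "q \<le> n" using tiling_tileD[OF T(1)] T(2) S by auto
    then have c: "crs (ee n p) (ee n q) \<noteq> 0" using crs_ee_pos by fastforce
    have dirs: "i = p \<and> (u = t \<or> u = t + ee n q) \<or> i = q \<and> (u = t \<or> u = t + ee n p)"
      using tile_edge_direction[OF pq T(3,4)] E S by simp
    from dirs obtain a b where ab: "?q = t + of_real a * ee n p + of_real b * ee n q"
      "i = p \<and> a = s \<and> (b = 0 \<and> u = t \<or> b = 1 \<and> u = t + ee n q) \<or>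
       i = q \<and> b = s \<and> (a = 0 \<and> u = t \<or> a = 1 \<and> u = t + ee n p)"
    proof (elim disjE conjE)
      assume "i = p" "u = t" then show thesis by (intro that[of s 0]) auto
    next
      assume "i = p" "u = t + ee n q" then show thesis by (intro that[of s 1]) auto
    next
      assume "i = q" "u = t" then show thesis by (intro that[of 0 s]) auto
    next
      assume "i = q" "u = t + ee n p" then show thesis by (intro that[of 1 s]) auto
    qed
    have qS: "?q \<in> rhomb n S" unfolding S rhomb_eq using ab s
      by (intro CollectI exI[of _ a] exI[of _ b]) auto
    \<comment> \<open>A relatively interior point of a side is no corner, so the two tiles share a
      whole side rather than a corner.\<close>
    have ncorner: "?q \<notin> set (corners n S)"
    proof
      assume "?q \<in> set (corners n S)"
      then obtain a' b' :: real where "a' \<in> {0,1}" "b' \<in> {0,1}" "?q = t + of_real a' * ee n p + of_real b' * ee n q"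
        unfolding S by (rule corner_coord)
      then have "a = a' \<and> b = b'" using ab(1) by (intro crs_independent[OF _ c]) (simp add: add.assoc)
      then show False using ab(2) s \<open>a' \<in> _\<close> \<open>b' \<in> _\<close> by auto
    qed
    have qq: "?q \<in> rhomb n \<tau> \<inter> rhomb n S" using qS \<tau>(3) by simp
    have "\<not> (\<exists>p \<in> set (corners n \<tau>) \<inter> set (corners n S). rhomb n \<tau> \<inter> rhomb n S = {p})"
      using qq ncorner by (metis IntD2 singletonD)
    then obtain E' where E0: "E' \<in> tile_edges n \<tau> \<inter> tile_edges n S" "rhomb n \<tau> \<inter> rhomb n S = E'"
      using tiling_meet[OF T(1) \<tau>(1) T(2) False \<tau>(3) qS] by metis
    then have E': "E' \<in> tile_edges n \<tau>" "E' \<in> tile_edges n S" "?q \<in> E'" using qq by auto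
    have "E' = closed_segment u (u + ee n i)"
    proof -
      have "t + of_real a * ee n p + of_real b * ee n q \<in> E'" using E'(3) unfolding ab(1) .
      from tile_edge_coord[OF c E'(2)[unfolded S] this] ab(2) s(1,2) show ?thesis
        by (elim disjE conjE) (simp_all add: add_ac)
    qed
    then show ?thesis using E'(1) by simp
  qed (use E in simp)
  then show ?thesis using that \<tau> left by blast
qed

text \<open>A small vertical step from \<open>w\<close> enters a tile at \<open>w\<close>, and one
  of the two sides of that tile at \<open>w\<close> must then ascend. It is not parallel to the
  horizontal direction 1, whence \<open>2 \<le> j\<close>.\<close>

lemma vertex_up_edge:
  assumes T: "is_tiling n T" "w \<in> tiling_verts n T" "w \<in> interior (Pn n)"
  obtains \<tau> j where "\<tau> \<in> T" "2 \<le> j" "j \<le> n" "closed_segment w (w + ee n j) \<in> tile_edges n \<tau>"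
    "w + ee n j \<in> tiling_verts n T"
proof -
  obtain S where S: "S \<in> T" "w \<in> set (corners n S)" using T(2) by (auto simp: tiling_verts_def)
  obtain \<tau> \<delta> where \<tau>: "\<tau> \<in> T" "\<delta> > 0" "w \<in> rhomb n \<tau>" "w + of_real \<delta> * \<i> \<in> rhomb n \<tau>"
    using dir_tile[OF T(1,3)] by blast
  \<comment> \<open>Edge-to-edge tilings have no vertex in the middle of a side: a corner of
    \<open>S\<close> on a shared side is an endpoint of it.\<close>
  have w\<tau>: "w \<in> set (corners n \<tau>)"
  proof (cases "\<tau> = S")
    case False
    have wS: "w \<in> rhomb n S" using S corners_subset_rhomb by blast
    from tiling_meet[OF T(1) \<tau>(1) S(1) False \<tau>(3) wS] show ?thesis
    proof
      assume "\<exists>p\<in>set (corners n \<tau>) \<inter> set (corners n S). rhomb n \<tau> \<inter> rhomb n S = {p}"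
      then obtain p where "p \<in> set (corners n \<tau>)" "rhomb n \<tau> \<inter> rhomb n S = {p}" by blast
      moreover have "w \<in> rhomb n \<tau> \<inter> rhomb n S" using wS \<tau>(3) by simp
      ultimately show ?thesis by simp
    next
      assume "\<exists>E\<in>tile_edges n \<tau> \<inter> tile_edges n S. rhomb n \<tau> \<inter> rhomb n S = E"
      then obtain E where E0: "E \<in> tile_edges n \<tau> \<inter> tile_edges n S" "rhomb n \<tau> \<inter> rhomb n S = E" by (rule bexE)
      then have E: "E \<in> tile_edges n \<tau>" "E \<in> tile_edges n S" "w \<in> E" using wS \<tau>(3) by auto
      obtain p q t where St: "S = (p,q,t)" by (cases S)
      have pq: "1 \<le> p" "p < q" "q \<le> n" using tiling_tileD[OF T(1)] S(1) St by auto
      then have c: "crs (ee n p) (ee n q) \<noteq> 0" using crs_ee_pos by fastforce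
      obtain a b :: real where ab: "a \<in> {0,1}" "b \<in> {0,1}" "w = t + of_real a * ee n p + of_real b * ee n q"
        using S(2) unfolding St by (rule corner_coord)
      have "\<exists>y. E = closed_segment w y"
      proof -
        have "t + of_real a * ee n p + of_real b * ee n q \<in> E" using E(3) unfolding ab(3) .
        from tile_edge_coord[OF c E(2)[unfolded St] this] show ?thesis
        proof (elim disjE conjE)
          assume "E = closed_segment t (t + ee n p)" "b = 0"
          then show ?thesis using ab(1) unfolding ab(3)
            by (elim insertE emptyE) (simp_all only: closed_segment_commute[of t], auto)
        next
          assume "E = closed_segment (t + ee n p) (t + ee n p + ee n q)" "a = 1"
          then show ?thesis using ab(2) unfolding ab(3)
            by (elim insertE emptyE) (simp_all only: closed_segment_commute[of "t + ee n p"], auto)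
        next
          assume "E = closed_segment (t + ee n q) (t + ee n p + ee n q)" "b = 1"
          then show ?thesis using ab(1) unfolding ab(3)
            by (elim insertE emptyE) (simp_all only: closed_segment_commute[of "t + ee n q"], auto)
        next
          assume "E = closed_segment t (t + ee n q)" "a = 0"
          then show ?thesis using ab(2) unfolding ab(3)
            by (elim insertE emptyE) (simp_all only: closed_segment_commute[of t], auto)
        qed
      qed
      then obtain y where y: "E = closed_segment w y" by blast
      obtain p' q' t' where \<tau>t: "\<tau> = (p',q',t')" by (cases \<tau>)
      show ?thesis using E(1) unfolding y \<tau>t tile_edges_def corners_def
        by (auto simp: doubleton_eq_iff)
    qed
  qed (use S in simp)
  obtain p q t where \<tau>t: "\<tau> = (p,q,t)" by (cases \<tau>)
  have pq: "1 \<le> p" "p < q" "q \<le> n" using tiling_tileD[OF T(1)] \<tau>(1) \<tau>t by auto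
  obtain a b :: real where ab: "a \<in> {0,1}" "b \<in> {0,1}" "w = t + of_real a * ee n p + of_real b * ee n q"
    using w\<tau> unfolding \<tau>t by (rule corner_coord)
  obtain a' b' where ab': "w + of_real \<delta> * \<i> = t + of_real a' * ee n p + of_real b' * ee n q"
    "0 \<le> a'" "a' \<le> 1" "0 \<le> b'" "b' \<le> 1" using \<tau>(4) unfolding \<tau>t rhomb_eq by blast
  \<comment> \<open>The imaginary part grows, so some tile coordinate increases along a direction of
    positive imaginary part; being 0 or 1 at \<open>w\<close>, it starts at 0.\<close>
  have "Im (w + of_real \<delta> * \<i>) - Im w = \<delta>" by simp
  then have "(a' - a) * Im (ee n p) + (b' - b) * Im (ee n q) = \<delta>"
    unfolding ab'(1) unfolding ab(3) by (simp add: algebra_simps)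
  then have or: "(a' - a) * Im (ee n p) > 0 \<or> (b' - b) * Im (ee n q) > 0" using \<tau>(2) by linarith
  from or show ?thesis
  proof
    assume h: "(a' - a) * Im (ee n p) > 0"
    then have "a' - a > 0" "Im (ee n p) > 0" using Im_ee_nonneg[of p n] pq by (auto simp: zero_less_mult_iff)
    then have a: "a = 0" using ab ab' by auto
    have "p \<noteq> 1" using \<open>Im (ee n p) > 0\<close> by (auto simp: ee_def)
    moreover have w: "w = t \<or> w = t + ee n q" using ab a by auto
    then have "w + ee n p \<in> set (corners n \<tau>)" unfolding \<tau>t corners_def by auto
    moreover have "closed_segment w (w + ee n p) \<in> tile_edges n \<tau>"
      unfolding \<tau>t using w by (rule tile_edges_first)
    ultimately show ?thesis using that[OF \<tau>(1), of p] pq \<tau>(1) by (auto simp: tiling_verts_def)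
  next
    assume h: "(b' - b) * Im (ee n q) > 0"
    then have "b' - b > 0" using Im_ee_nonneg[of q n] pq by (auto simp: zero_less_mult_iff)
    then have b: "b = 0" using ab ab' by auto
    then have w: "w = t \<or> w = t + ee n p" using ab by auto
    then have "w + ee n q \<in> set (corners n \<tau>)" unfolding \<tau>t corners_def by auto
    moreover have "closed_segment w (w + ee n q) \<in> tile_edges n \<tau>"
      unfolding \<tau>t using w by (rule tile_edges_second)
    ultimately show ?thesis using that[OF \<tau>(1), of q] pq \<tau>(1) by (auto simp: tiling_verts_def)
  qed
qed

text \<open>Vertices on the boundary of the polygon carry no condition, which gives strips of
  flipped tiles a place to end.\<close>

definition tile_realizable :: "nat \<Rightarrow> tile set \<Rightarrow> (complex \<Rightarrow> complex) \<Rightarrow> bool" where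
  "tile_realizable n T g \<longleftrightarrow> (\<exists>\<epsilon>. (\<forall>\<tau>. \<epsilon> \<tau> \<in> {1,-1}) \<and>
     (\<forall>p\<in>interior (Pn n). (\<Prod>\<tau>\<in>{\<tau>\<in>T. p \<in> set (corners n \<tau>)}. \<epsilon> \<tau>) = g p))"

definition sgl :: "complex \<Rightarrow> complex \<Rightarrow> complex" where
  "sgl u p = (if p = u then -1 else 1)"

lemma sgl_sq [simp]: "sgl u p * sgl u p = 1" "sgl u p * (sgl u p * z) = z"
  by (auto simp: sgl_def)

lemma tile_realizable_mult:
  assumes "tile_realizable n T g" "tile_realizable n T h"
  shows "tile_realizable n T (\<lambda>p. g p * h p)"
proof -
  from assms obtain \<epsilon> \<eta> where e: "\<forall>\<tau>. \<epsilon> \<tau> \<in> {1,-1}" "\<forall>\<tau>. \<eta> \<tau> \<in> {1,-1}"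
     and *: "\<forall>p\<in>interior (Pn n). (\<Prod>\<tau>\<in>{\<tau>\<in>T. p \<in> set (corners n \<tau>)}. \<epsilon> \<tau>) = g p"
     "\<forall>p\<in>interior (Pn n). (\<Prod>\<tau>\<in>{\<tau>\<in>T. p \<in> set (corners n \<tau>)}. \<eta> \<tau>) = h p"
    unfolding tile_realizable_def by blast
  have "\<epsilon> \<tau> * \<eta> \<tau> \<in> {1,-1}" for \<tau> using spec[OF e(1), of \<tau>] spec[OF e(2), of \<tau>] by auto
  then show ?thesis unfolding tile_realizable_def using *
    by (intro exI[of _ "\<lambda>\<tau>. \<epsilon> \<tau> * \<eta> \<tau>"]) (simp add: prod.distrib)
qed

lemma tile_realizable_cong:
  assumes "tile_realizable n T g" "\<And>p. p \<in> interior (Pn n) \<Longrightarrow> g p = h p"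
  shows "tile_realizable n T h"
proof -
  from assms(1) obtain \<epsilon> where e: "\<forall>\<tau>. \<epsilon> \<tau> \<in> {1,-1}"
     "\<forall>p\<in>interior (Pn n). (\<Prod>\<tau>\<in>{\<tau>\<in>T. p \<in> set (corners n \<tau>)}. \<epsilon> \<tau>) = g p"
    unfolding tile_realizable_def by blast
  show ?thesis unfolding tile_realizable_def
    by (rule exI[of _ \<epsilon>]) (use e assms(2) in simp)
qed

lemma tile_realizable_one: "tile_realizable n T (\<lambda>p. 1)"
  unfolding tile_realizable_def by (intro exI[of _ "\<lambda>_. 1"]) auto

text \<open>The four corners of a rhombus are distinct, so the sign of one tile affects exactly
  these. They are grouped into two parallel edges, as the strip argument needs them.\<close>

lemma tile_realizable_tile:
  assumes "is_tiling n T" "(i,j,t) \<in> T"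
  shows "tile_realizable n T (\<lambda>p. sgl t p * sgl (t + ee n i) p * (sgl (t + ee n j) p * sgl (t + ee n i + ee n j) p))"
proof -
  let ?\<epsilon> = "\<lambda>\<tau>. if \<tau> = (i,j,t) then -1 else (1::complex)"
  have ij: "1 \<le> i" "i < j" "j \<le> n" using tiling_tileD[OF assms] .
  have d: "ee n i \<noteq> ee n j" using ee_inj[of i n j] ij by auto
  have e: "ee n i + ee n j \<noteq> 0" using ee_not_opposite[of i n j] ij by (auto simp: add_eq_0_iff2)
  have "(\<Prod>\<tau>\<in>{\<tau>\<in>T. p \<in> set (corners n \<tau>)}. ?\<epsilon> \<tau>)
     = sgl t p * sgl (t + ee n i) p * (sgl (t + ee n j) p * sgl (t + ee n i + ee n j) p)" for p
  proof -
    have "finite {\<tau>\<in>T. p \<in> set (corners n \<tau>)}" using tiling_finite[OF assms(1)] by simp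
    then have "(\<Prod>\<tau>\<in>{\<tau>\<in>T. p \<in> set (corners n \<tau>)}. ?\<epsilon> \<tau>) = (if p \<in> set (corners n (i,j,t)) then -1 else 1)"
      by (subst prod.delta) (use assms in auto)
    also have "\<dots> = sgl t p * sgl (t + ee n i) p * (sgl (t + ee n j) p * sgl (t + ee n i + ee n j) p)"
      using d e ee_nonzero[of n i] ee_nonzero[of n j] by (auto simp: corners_def sgl_def add.assoc)
    finally show ?thesis .
  qed
  then show ?thesis unfolding tile_realizable_def by (intro exI[of _ ?\<epsilon>]) auto
qed

lemma tiling_verts_finite: "is_tiling n T \<Longrightarrow> finite (tiling_verts n T)"
  using tiling_finite unfolding tiling_verts_def by blast

text \<open>Termination measure for both climbs through the tiling, once in the direction normal to
  an edge and once vertically.\<close>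

lemma card_above_less:
  fixes f :: "'a \<Rightarrow> real"
  assumes "finite V" "x \<in> V" "f w < f x"
  shows "card {v \<in> V. f v > f x} < card {v \<in> V. f v > f w}"
proof (rule psubset_card_mono)
  show "{v \<in> V. f v > f x} \<subset> {v \<in> V. f v > f w}" using assms(2,3) by force
qed (use assms(1) in simp)

text \<open>Flipping the tile to the left of an edge trades the edge for the parallel side of that
  tile, which lies further left. The process stops at an edge with no end in the interior of the
  polygon, where nothing is required.\<close>

lemma tile_realizable_edge:
  assumes T: "is_tiling n T" "1 \<le> i" "i \<le> n"
    and "S \<in> T" "closed_segment u (u + ee n i) \<in> tile_edges n S"
  shows "tile_realizable n T (\<lambda>p. sgl u p * sgl (u + ee n i) p)"
  using assms(4,5)
proof (induction "card {v \<in> tiling_verts n T. crs (ee n i) v > crs (ee n i) u}" arbitrary: u S rule: less_induct)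
  case less
  show ?case
  proof (cases "u \<in> interior (Pn n) \<or> u + ee n i \<in> interior (Pn n)")
    case False
    then show ?thesis by (intro tile_realizable_cong[OF tile_realizable_one]) (auto simp: sgl_def)
  next
    case True
    then obtain \<tau> z where \<tau>: "\<tau> \<in> T" "closed_segment u (u + ee n i) \<in> tile_edges n \<tau>"
      "z \<in> rhomb n \<tau>" "crs (ee n i) (z - u) > 0"
      using edge_left_tile[OF T(1) less.prems(1) T(2,3) less.prems(2)] by blast
    obtain p q t where \<tau>t: "\<tau> = (p,q,t)" by (cases \<tau>)
    have pq: "1 \<le> p" "p < q" "q \<le> n" using tiling_tileD[OF T(1)] \<tau>(1) \<tau>t by auto
    have c: "crs (ee n p) (ee n q) > 0" using crs_ee_pos[OF pq] .
    then have c': "crs (ee n q) (ee n p) < 0" using crs_swap[of "ee n p" "ee n q"] by simp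
    obtain a b where ab: "z = t + of_real a * ee n p + of_real b * ee n q"
      "0 \<le> a" "a \<le> 1" "0 \<le> b" "b \<le> 1" using \<tau>(3) unfolding \<tau>t rhomb_eq by blast
    have dirs: "i = p \<and> (u = t \<or> u = t + ee n q) \<or> i = q \<and> (u = t \<or> u = t + ee n p)"
      using tile_edge_direction[OF pq T(2,3)] \<tau>(2) \<tau>t by simp
    have "\<exists>u'. closed_segment u' (u' + ee n i) \<in> tile_edges n \<tau> \<and> u' \<in> set (corners n \<tau>) \<and>
        crs (ee n i) u' > crs (ee n i) u \<and>
        tile_realizable n T (\<lambda>x. (sgl u x * sgl (u + ee n i) x) * (sgl u' x * sgl (u' + ee n i) x))"
      using dirs
    proof (elim disjE conjE)
      assume h: "i = p" "u = t"
      have "closed_segment (t + ee n q) (t + ee n q + ee n p) \<in> tile_edges n (p,q,t)"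
        by (rule tile_edges_first) simp
      then show ?thesis using tile_realizable_tile[OF T(1), of p q t] \<tau>(1) c unfolding \<tau>t h
        by (intro exI[of _ "t + ee n q"]) (simp add: corners_def add_ac)
    next
      assume h: "i = p" "u = t + ee n q"
      then have "crs (ee n i) (z - u) = (b - 1) * crs (ee n p) (ee n q)" using ab by (simp add: algebra_simps)
      \<comment> \<open>In this case and the next the tile lies to the right of the edge, against
        the choice of \<open>z\<close>.\<close>
      then show ?thesis using \<tau>(4) c ab by (simp add: zero_less_mult_iff)
    next
      assume h: "i = q" "u = t"
      then have "crs (ee n i) (z - u) = a * crs (ee n q) (ee n p)" using ab by (simp add: algebra_simps)
      then show ?thesis using \<tau>(4) c' ab by (simp add: zero_less_mult_iff)
    next
      assume h: "i = q" "u = t + ee n p"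
      have "closed_segment t (t + ee n q) \<in> tile_edges n (p,q,t)"
        by (rule tile_edges_second) simp
      moreover have "tile_realizable n T (\<lambda>x. (sgl (t + ee n p) x * sgl (t + ee n p + ee n q) x) * (sgl t x * sgl (t + ee n q) x))"
        using tile_realizable_tile[OF T(1) \<tau>(1)[unfolded \<tau>t]]
        by (rule tile_realizable_cong) (simp add: mult_ac)
      ultimately show ?thesis using c' unfolding \<tau>t h
        by (intro exI[of _ t]) (simp add: corners_def)
    qed
    then obtain u' where u': "closed_segment u' (u' + ee n i) \<in> tile_edges n \<tau>" "u' \<in> set (corners n \<tau>)"
        "crs (ee n i) u' > crs (ee n i) u"
        "tile_realizable n T (\<lambda>x. (sgl u x * sgl (u + ee n i) x) * (sgl u' x * sgl (u' + ee n i) x))"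
      by blast
    have "card {v \<in> tiling_verts n T. crs (ee n i) v > crs (ee n i) u'} < card {v \<in> tiling_verts n T. crs (ee n i) v > crs (ee n i) u}"
      by (rule card_above_less[OF tiling_verts_finite[OF T(1)] _ u'(3)])
         (use u'(2) \<tau>(1) in \<open>auto simp: tiling_verts_def\<close>)
    from tile_realizable_mult[OF u'(4) less.hyps[OF this \<tau>(1) u'(1)]]
    show ?thesis by (rule tile_realizable_cong) (simp add: mult_ac)
  qed
qed

text \<open>An edge pattern moves a single flipped sign from one end of the edge to the other. Along
  ascending edges the sign is carried to a boundary vertex, where it is free.\<close>

lemma tile_realizable_sgl:
  assumes T: "is_tiling n T" and "w \<in> tiling_verts n T"
  shows "tile_realizable n T (sgl w)"
  using assms(2)
proof (induction "card {v \<in> tiling_verts n T. Im v > Im w}" arbitrary: w rule: less_induct)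
  case less
  show ?case
  proof (cases "w \<in> interior (Pn n)")
    case False
    then show ?thesis by (intro tile_realizable_cong[OF tile_realizable_one]) (auto simp: sgl_def)
  next
    case True
    then obtain \<tau> j where \<tau>: "\<tau> \<in> T" "2 \<le> j" "j \<le> n" "closed_segment w (w + ee n j) \<in> tile_edges n \<tau>"
      "w + ee n j \<in> tiling_verts n T"
      using vertex_up_edge[OF T less.prems] by blast
    have up: "Im w < Im (w + ee n j)" using Im_ee_pos[OF \<tau>(2,3)] by simp
    have "card {v \<in> tiling_verts n T. Im v > Im (w + ee n j)} < card {v \<in> tiling_verts n T. Im v > Im w}"
      by (rule card_above_less[where f=Im, OF tiling_verts_finite[OF T(1)] \<tau>(5) up])
    from less.hyps[OF this \<tau>(5)] have 1: "tile_realizable n T (sgl (w + ee n j))" .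
    have 2: "tile_realizable n T (\<lambda>p. sgl w p * sgl (w + ee n j) p)"
      using tile_realizable_edge[OF T _ \<tau>(3,1,4)] \<tau>(2) by simp
    show ?thesis using tile_realizable_mult[OF 2 1] by (rule tile_realizable_cong) (simp add: mult.assoc)
  qed
qed

lemma tile_realizable_all:
  assumes T: "is_tiling n T" and g: "\<And>p. g p \<in> {1, -1}"
  shows "\<exists>\<epsilon>. (\<forall>\<tau>. \<epsilon> \<tau> \<in> {1, -1 :: complex}) \<and>
     (\<forall>p\<in>interior (Pn n) \<inter> tiling_verts n T. (\<Prod>\<tau>\<in>{\<tau>\<in>T. p \<in> set (corners n \<tau>)}. \<epsilon> \<tau>) = g p)"
proof -
  have *: "tile_realizable n T (\<lambda>p. if p \<in> V then g p else 1)" if "finite V" "V \<subseteq> tiling_verts n T" for V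
    using that
  proof (induction V rule: finite_induct)
    case empty
    then show ?case using tile_realizable_one by simp
  next
    case (insert v V)
    then have 1: "tile_realizable n T (\<lambda>p. if p \<in> V then g p else 1)" by simp
    have "tile_realizable n T (sgl v)" using tile_realizable_sgl[OF T] insert by simp
    from tile_realizable_mult[OF this 1] show ?case
    proof (cases "g v = 1")
      case True
      then show ?thesis by (intro tile_realizable_cong[OF 1]) auto
    next
      case False
      then have "g v = -1" using g[of v] by auto
      then show ?thesis
        by (intro tile_realizable_cong[OF \<open>tile_realizable n T (\<lambda>p. sgl v p * (if p \<in> V then g p else 1))\<close>])
           (use insert in \<open>auto simp: sgl_def\<close>)
    qed
  qed
  obtain \<epsilon> where e: "\<forall>\<tau>. \<epsilon> \<tau> \<in> {1,-1}" "\<forall>p\<in>interior (Pn n).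
      (\<Prod>\<tau>\<in>{\<tau>\<in>T. p \<in> set (corners n \<tau>)}. \<epsilon> \<tau>) = (if p \<in> tiling_verts n T then g p else 1)"
    using *[OF tiling_verts_finite[OF T] subset_refl] unfolding tile_realizable_def by blast
  show ?thesis by (rule exI[of _ \<epsilon>]) (use e in simp)
qed

subsection \<open>Algebra of one cube\<close>

definition fsum :: "(nat set \<Rightarrow> complex) \<Rightarrow> nat \<Rightarrow> bool \<Rightarrow> complex" where
  "fsum z a \<beta> =
    (if a = 0 then (if \<beta> then z {0} * z {0,1,2} + z {0,1} * z {0,2} else z {} * z {1,2} + z {1} * z {2})
     else if a = 1 then (if \<beta> then z {1} * z {0,1,2} + z {0,1} * z {1,2} else z {} * z {0,2} + z {0} * z {2})
     else (if \<beta> then z {2} * z {0,1,2} + z {0,2} * z {1,2} else z {} * z {0,1} + z {0} * z {1}))"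

definition khex_cube :: "(nat set \<Rightarrow> complex) \<Rightarrow> (nat \<Rightarrow> bool \<Rightarrow> complex) \<Rightarrow> bool" where
  "khex_cube z F \<longleftrightarrow> (let A = 2 * z {0} * z {1} * z {2}
                + z {} * (z {0} * z {1,2} + z {1} * z {0,2} + z {2} * z {0,1})
        in F 0 True = (F 1 False * F 2 False + F 0 False * z {0}) / z {} \<and>
           F 1 True = (F 0 False * F 2 False + F 1 False * z {1}) / z {} \<and>
           F 2 True = (F 0 False * F 1 False + F 2 False * z {2}) / z {} \<and>
           z {0,1,2} = (A + 2 * F 0 False * F 1 False * F 2 False) / (z {})^2)"

definition kvc :: "(nat set \<Rightarrow> complex) \<Rightarrow> nat set \<Rightarrow> complex" where
  "kvc z B = Kvpoly (\<lambda>A. z (symdiff A B))"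

lemma symdiff_table:
  "symdiff A {} = A" "symdiff {} A = A" "symdiff {0} {0} = {}" "symdiff {0} {1} = {0,1}" "symdiff {0} {2} = {0,2}"
  "symdiff {0} {0,1} = {1}" "symdiff {0} {0,2} = {2}" "symdiff {0} {1,2} = {0,1,2}" "symdiff {0} {0,1,2} = {1,2}"
  "symdiff {1} {0} = {0,1}" "symdiff {1} {1} = {}" "symdiff {1} {2} = {1,2}"
  "symdiff {1} {0,1} = {0}" "symdiff {1} {0,2} = {0,1,2}" "symdiff {1} {1,2} = {2}" "symdiff {1} {0,1,2} = {0,2}"
  "symdiff {2} {0} = {0,2}" "symdiff {2} {1} = {1,2}" "symdiff {2} {2} = {}"
  "symdiff {2} {0,1} = {0,1,2}" "symdiff {2} {0,2} = {0}" "symdiff {2} {1,2} = {1}" "symdiff {2} {0,1,2} = {0,1}"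
  "symdiff {0,1} {0} = {1}" "symdiff {0,1} {1} = {0}" "symdiff {0,1} {2} = {0,1,2}"
  "symdiff {0,1} {0,1} = {}" "symdiff {0,1} {0,2} = {1,2}" "symdiff {0,1} {1,2} = {0,2}" "symdiff {0,1} {0,1,2} = {2}"
  "symdiff {0,2} {0} = {2}" "symdiff {0,2} {1} = {0,1,2}" "symdiff {0,2} {2} = {0}"
  "symdiff {0,2} {0,1} = {1,2}" "symdiff {0,2} {0,2} = {}" "symdiff {0,2} {1,2} = {0,1}" "symdiff {0,2} {0,1,2} = {1}"
  "symdiff {1,2} {0} = {0,1,2}" "symdiff {1,2} {1} = {2}" "symdiff {1,2} {2} = {1}"
  "symdiff {1,2} {0,1} = {0,2}" "symdiff {1,2} {0,2} = {0,1}" "symdiff {1,2} {1,2} = {}" "symdiff {1,2} {0,1,2} = {0}"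
  "symdiff {0,1,2} {0} = {1,2}" "symdiff {0,1,2} {1} = {0,2}" "symdiff {0,1,2} {2} = {0,1}"
  "symdiff {0,1,2} {0,1} = {2}" "symdiff {0,1,2} {0,2} = {1}" "symdiff {0,1,2} {1,2} = {0}" "symdiff {0,1,2} {0,1,2} = {}"
  by (simp_all add: symdiff_def insert_Diff_if insert_commute)

lemma neq_012: "{} \<noteq> {0,1,2::nat}" "{0} \<noteq> {0,1,2::nat}" "{1} \<noteq> {0,1,2::nat}" "{2} \<noteq> {0,1,2::nat}"
  "{0,1} \<noteq> {0,1,2::nat}" "{0,2} \<noteq> {0,1,2::nat}" "{1,2} \<noteq> {0,1,2::nat}"
  by (rule notI, drule equalityD2, simp)+

text \<open>One polynomial identity for each corner. When \<open>Kpoly\<close> vanishes, K^C_v is a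
  square root of the product of the three face sums at the corner, so only signs remain to be
  discussed.\<close>

lemma kvc_square:
  assumes "B \<subseteq> axes"
  shows "4 * (kvc z B)^2 = 4 * (\<Prod>a\<in>axes. fsum z a (a \<in> B)) + (z B)^2 * Kpoly z"
  using assms
  by (rule Pow012_cases)
     (simp_all add: kvc_def Kvpoly_def symdiff_table fsum_def Kpoly_def Let_def power2_eq_square field_simps)

text \<open>From the bottom data alone: the Kashaev equation, the square equations on the top faces,
  and the product formula for K^C_v at all eight corners with its sign.\<close>

lemma khex_cube_props:
  assumes kh: "khex_cube z F" and w: "z {} \<noteq> 0"
    and f: "\<And>a. a \<in> axes \<Longrightarrow> (F a False)^2 = fsum z a False"
  shows "Kpoly z = 0"
    and "a \<in> axes \<Longrightarrow> (F a True)^2 = fsum z a True"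
    and "B \<subseteq> axes \<Longrightarrow> kvc z B = (if B = {} \<or> B = {0,1,2} then 1 else -1) * (\<Prod>a\<in>axes. F a (a \<in> B))"
proof -
  define w x0 x1 x2 y0 y1 y2 v where wdefs: "w = z {}" "x0 = z {0}" "x1 = z {1}" "x2 = z {2}"
    "y0 = z {1,2}" "y1 = z {0,2}" "y2 = z {0,1}" "v = z {0,1,2}"
  define f0 f1 f2 where fdefs: "f0 = F 0 False" "f1 = F 1 False" "f2 = F 2 False"
  note zf = wdefs[symmetric] fdefs[symmetric]
  have w0: "w \<noteq> 0" using w wdefs by simp
  \<comment> \<open>The cube is parametrized by the bottom vertex, its three neighbours and the
    three bottom face values; all other values are rational in these, with powers of
    \<open>w\<close> as the only denominators.\<close>
  have y: "y0 = (f0^2 - x1 * x2) / w" "y1 = (f1^2 - x0 * x2) / w" "y2 = (f2^2 - x0 * x1) / w"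
    using f[of 0] f[of 1] f[of 2] w0 unfolding fsum_def by (simp_all add: zf field_simps)
  have v: "v = (x0 * f0^2 + x1 * f1^2 + x2 * f2^2 - x0 * x1 * x2 + 2 * f0 * f1 * f2) / w^2"
  proof -
    have "v = (2 * x0 * x1 * x2 + w * (x0 * y0 + x1 * y1 + x2 * y2) + 2 * f0 * f1 * f2) / w^2"
      using kh unfolding khex_cube_def Let_def zf by simp
    also have "w * (x0 * y0 + x1 * y1 + x2 * y2) = x0 * (w * y0) + x1 * (w * y1) + x2 * (w * y2)"
      by (simp add: algebra_simps)
    also have "\<dots> = x0 * (f0^2 - x1 * x2) + x1 * (f1^2 - x0 * x2) + x2 * (f2^2 - x0 * x1)"
      using w0 unfolding y by simp
    finally show ?thesis by (simp add: algebra_simps)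
  qed
  have g: "F 0 True = (f1 * f2 + f0 * x0) / w" "F 1 True = (f0 * f2 + f1 * x1) / w" "F 2 True = (f0 * f1 + f2 * x2) / w"
    using kh unfolding khex_cube_def Let_def zf by auto
  show "(F a True)^2 = fsum z a True" if "a \<in> axes" for a
    using that w0 by (elim insertE emptyE; simp add: fsum_def zf g v y divide_simps)
      (simp_all add: power2_eq_square power3_eq_cube power_numeral_reduce algebra_simps)
  show kv: "kvc z B = (if B = {} \<or> B = {0,1,2} then 1 else -1) * (\<Prod>a\<in>axes. F a (a \<in> B))" if "B \<subseteq> axes" for B
  proof -
    show ?thesis using w0
    by (rule_tac Pow012_cases[OF that]; simp add: neq_012 kvc_def Kvpoly_def symdiff_table zf g v y divide_simps)
      (simp_all add: power2_eq_square power3_eq_cube power_numeral_reduce algebra_simps)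
  qed
  \<comment> \<open>At the bottom corner the product formula cancels everything in
    \<open>kvc_square\<close> except the \<open>Kpoly\<close> term, and \<open>z {}\<close> is
    nonzero.\<close>
  show "Kpoly z = 0"
    using kvc_square[of "{}" z] kv[of "{}"] w f[of 0] f[of 1] f[of 2]
    by (simp add: power_mult_distrib)
qed

subsection \<open>Combinatorics of a pile\<close>

locale pile =
  fixes n :: nat and Ts :: "tile set list"
  assumes pile: "is_pile n Ts"
begin

text \<open>Left inverse of every \<open>kname\<close>, hence the source of the injectivity of names
  at a fixed time. It is not injective on vertices of the complex.\<close>

definition kpos :: "kvert \<Rightarrow> complex" where
  "kpos u = (case u of Inl p \<Rightarrow> p | Inr m \<Rightarrow> vnew n Ts m)"

lemma kpos_kname [simp]: "kpos (kname n Ts m p) = p"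
  by (induction m) (auto simp: kpos_def)

lemma kname_eq_iff [simp]: "kname n Ts m p = kname n Ts m q \<longleftrightarrow> p = q"
  by (metis kpos_kname)

lemma kname_Inr: "kname n Ts m p = Inr k \<Longrightarrow> 1 \<le> k \<and> k \<le> m"
  by (induction m) (auto split: if_splits)

lemma kname_step:
  assumes "1 \<le> m"
  shows "kname n Ts m p = (if p = vnew n Ts m then Inr m else kname n Ts (m - 1) p)"
  using assms by (cases m) auto

lemma face_verts_tile_face: "face_verts (tile_face n Ts m \<tau>) = kname n Ts m ` set (corners n \<tau>)"
  by (cases \<tau>) (auto simp: face_verts_def tile_face_def corners_def)

text \<open>Positions can be read off from names at any time, so a face remembers its tile even
  across different \<open>m\<close> and \<open>m'\<close>.\<close>

lemma tile_face_inj: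
  assumes "1 \<le> i" "i < j" "j \<le> n" "1 \<le> i'" "i' < j'" "j' \<le> n"
    "tile_face n Ts m (i,j,t) = tile_face n Ts m' (i',j',t')"
  shows "(i,j,t) = (i',j',t')"
proof -
  have "kname n Ts m t = kname n Ts m' t'" "kname n Ts m (t + ee n i) = kname n Ts m' (t' + ee n i')"
    "kname n Ts m (t + ee n j) = kname n Ts m' (t' + ee n j')"
    using assms(7) by (auto simp: tile_face_def)
  then have "t = t'" "t + ee n i = t' + ee n i'" "t + ee n j = t' + ee n j'"
    by (metis kpos_kname)+
  then show ?thesis using ee_inj[of i n i'] ee_inj[of j n j'] assms by auto
qed

definition faces_at :: "nat \<Rightarrow> kface set" where
  "faces_at m = tile_face n Ts m ` (Ts ! m)"

definition verts_at :: "nat \<Rightarrow> kvert set" where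
  "verts_at m = kname n Ts m ` tiling_verts n (Ts ! m)"

lemma verts_at_faces: "verts_at m = \<Union>(face_verts ` faces_at m)"
  by (auto simp: verts_at_def faces_at_def tiling_verts_def face_verts_tile_face)

lemma kappa0_verts: "kappa0 n Ts = (\<Union>m<length Ts. verts_at m)"
  by (auto simp: kappa0_def verts_at_def)

lemma kappa2_faces: "kappa2 n Ts = (\<Union>m<length Ts. faces_at m)"
  by (auto simp: kappa2_def faces_at_def)

lemma verts_at_Inr: "Inr k \<in> verts_at m \<Longrightarrow> 1 \<le> k \<and> k \<le> m"
  unfolding verts_at_def using kname_Inr by (metis imageE)

definition star_at :: "nat \<Rightarrow> kvert \<Rightarrow> kface set" where
  "star_at m v = {s \<in> faces_at m. v \<in> face_verts s}"

definition star_upto :: "nat \<Rightarrow> kvert \<Rightarrow> kface set" where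
  "star_upto m v = {s \<in> (\<Union>k\<le>m. faces_at k). v \<in> face_verts s}"

definition cubes_upto :: "nat \<Rightarrow> kvert \<Rightarrow> nat set" where
  "cubes_upto m v = {k \<in> {1..m}. v \<in> cvert n Ts k ` Pow axes}"

abbreviation "len \<equiv> length Ts"
abbreviation "fd m \<equiv> fdat n Ts m"
abbreviation "bface m a \<equiv> cface n Ts m a False"
abbreviation "tface m a \<equiv> cface n Ts m a True"
abbreviation "cv m B \<equiv> cvert n Ts m B"

lemma tiling: "m < len \<Longrightarrow> is_tiling n (Ts ! m)"
  using pile unfolding is_pile_def by auto

lemma nonempty: "0 < len"
  using pile unfolding is_pile_def by auto

lemma flip: "\<lbrakk>1 \<le> m; m < len\<rbrakk> \<Longrightarrow> flip_data n (Ts ! (m-1)) (Ts ! m) (fd m)"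
  using pile unfolding is_pile_def related_by_flip_def fdat_def by (metis someI_ex)

lemma valid: "\<lbrakk>1 \<le> m; m < len\<rbrakk> \<Longrightarrow> valid_flip n (fd m)"
  using flip flip_data_valid by blast

lemma bot_tiles: "\<lbrakk>1 \<le> m; m < len\<rbrakk> \<Longrightarrow> (\<lambda>a. ctile n (fd m) a False) ` axes \<subseteq> Ts ! (m-1)"
  using flip flip_data_ctile(1) by blast

lemma tiles_step: "\<lbrakk>1 \<le> m; m < len\<rbrakk> \<Longrightarrow>
   Ts ! m = (Ts ! (m-1) - (\<lambda>a. ctile n (fd m) a False) ` axes) \<union> (\<lambda>a. ctile n (fd m) a True) ` axes"
  using flip flip_data_ctile(2) by blast

lemma top_tiles: "\<lbrakk>1 \<le> m; m < len\<rbrakk> \<Longrightarrow> (\<lambda>a. ctile n (fd m) a True) ` axes \<subseteq> Ts ! m"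
  using tiles_step by blast

text \<open>A tiling has one tile per pair of directions, and for this pair the old tiling already
  contains the parallel bottom face.\<close>

lemma top_tile_new:
  assumes "1 \<le> m" "m < len" "a \<in> axes"
  shows "ctile n (fd m) a True \<notin> Ts ! (m-1)"
proof
  assume h: "ctile n (fd m) a True \<in> Ts ! (m-1)"
  have b: "ctile n (fd m) a False \<in> Ts ! (m-1)" using bot_tiles assms by blast
  obtain p q t t' where "ctile n (fd m) a True = (p,q,t)" "ctile n (fd m) a False = (p,q,t')"
    by (auto simp: ctile_def Let_def)
  moreover from this have "t = t'" using tiling_unique[OF tiling, of "m-1" p q t t'] h b assms by auto
  ultimately show False using ctile_bot_neq_top[OF valid[OF assms(1,2)] assms(3,3)] by simp
qed

lemma top_star:
  assumes "1 \<le> m" "m < len" "\<tau> \<in> Ts ! m" "vnew n Ts m \<in> set (corners n \<tau>)"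
  shows "\<tau> \<in> (\<lambda>a. ctile n (fd m) a True) ` axes"
  using tiling_star[OF tiling[OF assms(2)] valid[OF assms(1,2)] top_tiles[OF assms(1,2)] assms(3)]
    assms(4) corners_subset_rhomb[of n \<tau>] by (auto simp: vnew_def center_def)

lemma bot_star:
  assumes "1 \<le> m" "m < len" "\<tau> \<in> Ts ! (m-1)" "fpos n (fd m) {} \<in> set (corners n \<tau>)"
  shows "\<tau> \<in> (\<lambda>a. ctile n (fd m) a False) ` axes"
  using tiling_star[OF tiling valid[OF assms(1,2)] bot_tiles[OF assms(1,2)] assms(3)] assms(2)
    assms(4) corners_subset_rhomb[of n \<tau>] by (auto simp: center_def)

text \<open>A flip renames only the point \<open>vnew\<close>, and only the three new tiles have it
  as a corner.\<close>

lemma tile_face_kept: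
  assumes "1 \<le> m" "m < len" "\<tau> \<in> Ts ! m" "\<tau> \<notin> (\<lambda>a. ctile n (fd m) a True) ` axes"
  shows "tile_face n Ts m \<tau> = tile_face n Ts (m-1) \<tau>"
proof -
  have "kname n Ts m p = kname n Ts (m-1) p" if "p \<in> set (corners n \<tau>)" for p
    using top_star[OF assms(1-3)] assms(4) that kname_step[OF assms(1)] by metis
  then show ?thesis by (cases \<tau>) (auto simp: tile_face_def corners_def)
qed

lemma tile_face_inj_on: "m < len \<Longrightarrow> k < len \<Longrightarrow> \<tau> \<in> Ts ! m \<Longrightarrow> \<sigma> \<in> Ts ! k \<Longrightarrow>
    tile_face n Ts i \<tau> = tile_face n Ts j \<sigma> \<Longrightarrow> \<tau> = \<sigma>"
  using tile_face_inj tiling_tileD[OF tiling] by (metis prod_cases3)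

lemma faces_step:
  assumes "1 \<le> m" "m < len"
  shows "faces_at m = (faces_at (m-1) - bface m ` axes) \<union> tface m ` axes"
proof -
  let ?B = "(\<lambda>a. ctile n (fd m) a False) ` axes" and ?T = "(\<lambda>a. ctile n (fd m) a True) ` axes"
  have kept: "\<tau> \<in> Ts ! m \<and> \<tau> \<notin> ?T" if "\<tau> \<in> Ts ! (m-1) - ?B" for \<tau>
    using that tiles_step[OF assms] top_tile_new[OF assms] by blast
  have "tile_face n Ts m ` (Ts ! (m-1) - ?B) = tile_face n Ts (m-1) ` (Ts ! (m-1) - ?B)"
    using kept tile_face_kept[OF assms] by (intro image_cong) auto
  also have "\<dots> = tile_face n Ts (m-1) ` (Ts ! (m-1)) - tile_face n Ts (m-1) ` ?B"
    using bot_tiles[OF assms] tile_face_inj_on[of "m-1" "m-1" _ _ "m-1" "m-1"] assms(2)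
    by (intro inj_on_image_set_diff[of _ "Ts ! (m-1)"]) (auto simp: inj_on_def)
  also have "tile_face n Ts (m-1) ` ?B = bface m ` axes"
    unfolding image_image cface_ctile by simp
  finally have 1: "tile_face n Ts m ` (Ts ! (m-1) - ?B) = faces_at (m-1) - bface m ` axes"
    by (simp add: faces_at_def)
  have 2: "tile_face n Ts m ` ?T = tface m ` axes"
    unfolding image_image cface_ctile by simp
  show ?thesis unfolding faces_at_def[of m] tiles_step[OF assms] image_Un 1 2 ..
qed

lemma bface_in: "\<lbrakk>1 \<le> m; m < len; a \<in> axes\<rbrakk> \<Longrightarrow> bface m a \<in> faces_at (m-1)"
  using bot_tiles[of m] unfolding faces_at_def cface_ctile by auto

lemma tface_in: "\<lbrakk>1 \<le> m; m < len; a \<in> axes\<rbrakk> \<Longrightarrow> tface m a \<in> faces_at m"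
  using faces_step by auto

lemma cv_simps: "cv m {0,1,2} = Inr m" "B \<noteq> {0,1,2} \<Longrightarrow> cv m B = kname n Ts (m-1) (fpos n (fd m) B)"
  by (auto simp: cvert_def)

text \<open>The bottom vertex is left out because its planar point may be reused by the top vertex,
  so that its later name would be wrong.\<close>

lemma cv_kname:
  assumes "1 \<le> m" "m < len" "B \<subseteq> axes" "B \<noteq> {}"
  shows "cv m B = kname n Ts m (fpos n (fd m) B)"
proof (cases "B = {0,1,2}")
  case True
  then show ?thesis using kname_step[OF assms(1)] by (simp add: cv_simps vnew_def)
next
  case False
  then have "fpos n (fd m) B \<noteq> vnew n Ts m"
    unfolding vnew_def using fpos_eq_imp[OF valid[OF assms(1,2)] assms(3) subset_refl] assms(4) by metis
  then show ?thesis using kname_step[OF assms(1)] False by (simp add: cv_simps)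
qed

text \<open>The only possible coincidence of positions is between bottom and top, and the name
  \<open>Inr m\<close> of the top does not occur before flip \<open>m\<close>.\<close>

lemma cv_inj:
  assumes "1 \<le> m" "m < len"
  shows "inj_on (cvert n Ts m) (Pow axes)"
proof (rule inj_onI)
  fix A B :: "nat set" assume AB: "A \<in> Pow axes" "B \<in> Pow axes" "cv m A = cv m B"
  have *: "A = {0,1,2} \<longleftrightarrow> B = {0,1,2}"
    using AB(3) kname_Inr[of "m-1" _ m] assms(1) unfolding cvert_def
    by (metis One_nat_def Suc_pred' le_less_trans less_irrefl less_le_trans diff_le_self zero_less_one lessI not_less_eq_eq)
  show "A = B"
  proof (cases "A = {0,1,2}")
    case False
    then have "fpos n (fd m) A = fpos n (fd m) B" using AB(3) * by (simp add: cv_simps)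
    then show ?thesis using fpos_eq_imp[OF valid[OF assms]] AB(1,2) * False by (metis PowD)
  qed (use * in simp)
qed

lemma face_verts_cface:
  assumes "1 \<le> m" "m < len" "a \<in> axes"
  shows "face_verts (cface n Ts m a \<beta>) = cvert n Ts m ` {B. B \<subseteq> axes \<and> (a \<in> B \<longleftrightarrow> \<beta>)}"
proof -
  have "face_verts (cface n Ts m a \<beta>) =
    kname n Ts (if \<beta> then m else m - 1) ` {fpos n (fd m) B | B. B \<subseteq> axes \<and> (a \<in> B \<longleftrightarrow> \<beta>)}"
    unfolding cface_ctile face_verts_tile_face corners_ctile[OF assms(3)] ..
  also have "\<dots> = (\<lambda>B. kname n Ts (if \<beta> then m else m - 1) (fpos n (fd m) B)) ` {B. B \<subseteq> axes \<and> (a \<in> B \<longleftrightarrow> \<beta>)}"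
    by blast
  also have "\<dots> = cvert n Ts m ` {B. B \<subseteq> axes \<and> (a \<in> B \<longleftrightarrow> \<beta>)}"
  proof (rule image_cong[OF refl])
    fix B assume "B \<in> {B. B \<subseteq> axes \<and> (a \<in> B \<longleftrightarrow> \<beta>)}"
    then have B: "B \<subseteq> axes" "a \<in> B \<longleftrightarrow> \<beta>" by auto
    show "kname n Ts (if \<beta> then m else m - 1) (fpos n (fd m) B) = cv m B"
    proof (cases \<beta>)
      case True
      then have "B \<noteq> {}" using B by auto
      then show ?thesis using cv_kname[OF assms(1,2) B(1)] True by simp
    next
      case False
      then have "B \<noteq> {0,1,2}" using B assms(3) by auto
      then show ?thesis using False by (simp add: cv_simps)
    qed
  qed
  finally show ?thesis .
qed

lemma cv_in_cface:
  assumes "1 \<le> m" "m < len" "a \<in> axes" "B \<subseteq> axes"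
  shows "cv m B \<in> face_verts (cface n Ts m a \<beta>) \<longleftrightarrow> (a \<in> B \<longleftrightarrow> \<beta>)"
  unfolding face_verts_cface[OF assms(1-3)] using cv_inj[OF assms(1,2)] assms(4)
  by (auto dest: inj_onD)

lemma face_sum_cface:
  assumes "1 \<le> m" "m < len" "a \<in> axes"
  shows "face_sum x (cface n Ts m a \<beta>) = fsum (\<lambda>B. x (cv m B)) a \<beta>"
proof -
  obtain p q t where t: "ctile n (fd m) a \<beta> = (p,q,t)" by (cases "ctile n (fd m) a \<beta>")
  let ?z = "\<lambda>p. x (kname n Ts (if \<beta> then m else m-1) p)"
  have "face_sum x (cface n Ts m a \<beta>) = ?z t * ?z (t + ee n p + ee n q) + ?z (t + ee n p) * ?z (t + ee n q)"
    unfolding cface_ctile t by (simp add: face_sum_def tile_face_def)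
  also have "\<dots> = fsum (\<lambda>B. x (cv m B)) a \<beta>"
  proof (cases \<beta>)
    case True
    note ck = cv_kname[OF assms(1,2)]
    show ?thesis unfolding ctile_corner_sum[OF t assms(3), of ?z] fsum_def using True
      by (simp add: ck)
  next
    case False
    show ?thesis unfolding ctile_corner_sum[OF t assms(3), of ?z] fsum_def using False
      by (simp add: cv_simps(2) neq_012)
  qed
  finally show ?thesis .
qed

lemma tface_fresh:
  assumes "1 \<le> m" "m < len" "a \<in> axes" "k < m"
  shows "tface m a \<notin> faces_at k"
proof
  assume "tface m a \<in> faces_at k"
  moreover have "Inr m \<in> face_verts (tface m a)"
    using cv_in_cface[OF assms(1-3) subset_refl, of True] assms(3) by (simp add: cv_simps)
  ultimately have "Inr m \<in> verts_at k" unfolding verts_at_faces by blast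
  then show False using verts_at_Inr assms(4) by fastforce
qed

lemma cface_inj:
  assumes "1 \<le> m" "m < len" "a \<in> axes" "b \<in> axes" "cface n Ts m a \<beta> = cface n Ts m b \<gamma>"
  shows "a = b \<and> \<beta> = \<gamma>"
proof -
  have "(a \<in> B \<longleftrightarrow> \<beta>) = (b \<in> B \<longleftrightarrow> \<gamma>)" if "B \<subseteq> axes" for B
    using cv_in_cface[OF assms(1,2,3) that, of \<beta>] cv_in_cface[OF assms(1,2,4) that, of \<gamma>] assms(5) by simp
  from this[of "{}"] this[of "{a}"] show ?thesis using assms(3) by (auto split: if_splits)
qed

text \<open>A corner of a new tile other than the top vertex has some coordinate 0, so it lies on a
  bottom face and was there before.\<close>

lemma verts_step:
  assumes "1 \<le> m" "m < len"
  shows "verts_at m \<subseteq> verts_at (m-1) \<union> {Inr m}"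
proof
  fix v assume "v \<in> verts_at m"
  then obtain s where s: "s \<in> faces_at m" "v \<in> face_verts s" unfolding verts_at_faces by blast
  show "v \<in> verts_at (m-1) \<union> {Inr m}"
  proof (cases "s \<in> faces_at (m-1)")
    case False
    then obtain a where a: "a \<in> axes" "s = tface m a" using s faces_step[OF assms] by blast
    then obtain B where B: "B \<subseteq> axes" "v = cv m B" using s(2) face_verts_cface[OF assms] by auto
    show ?thesis
    proof (cases "B = {0,1,2}")
      case False
      then obtain b where b: "b \<in> axes" "b \<notin> B" using B(1) by blast
      then have "v \<in> face_verts (bface m b)" using cv_in_cface[OF assms b(1) B(1)] B(2) by simp
      then show ?thesis using bface_in[OF assms b(1)] unfolding verts_at_faces by blast
    qed (use B in \<open>simp add: cv_simps\<close>)
  qed (use s verts_at_faces in blast)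
qed

lemma bot_vertex_star:
  assumes "1 \<le> m" "m < len"
  shows "star_at (m-1) (cv m {}) = bface m ` axes"
proof (intro equalityI subsetI)
  fix s assume "s \<in> star_at (m-1) (cv m {})"
  then obtain \<tau> where \<tau>: "\<tau> \<in> Ts ! (m-1)" "s = tile_face n Ts (m-1) \<tau>" "cv m {} \<in> face_verts s"
    unfolding star_at_def faces_at_def by blast
  then have "fpos n (fd m) {} \<in> set (corners n \<tau>)"
    by (auto simp: face_verts_tile_face cv_simps(2))
  then show "s \<in> bface m ` axes"
    using bot_star[OF assms \<tau>(1)] \<tau>(2) unfolding cface_ctile by auto
next
  fix s assume "s \<in> bface m ` axes"
  then show "s \<in> star_at (m-1) (cv m {})"
    unfolding star_at_def using bface_in[OF assms] cv_in_cface[OF assms _ empty_subsetI] by auto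
qed

text \<open>Flip \<open>m\<close> removes all faces at its bottom vertex, and each later flip adds
  only one vertex, under a fresh name.\<close>

lemma bot_vertex_dead:
  assumes "1 \<le> m" "m \<le> k" "k < len"
  shows "cv m {} \<notin> verts_at k"
  using assms(2,3)
proof (induction k rule: dec_induct)
  case base
  show ?case
  proof
    assume "cv m {} \<in> verts_at m"
    then obtain s where s: "s \<in> faces_at m" "cv m {} \<in> face_verts s" unfolding verts_at_faces by blast
    have "s \<notin> tface m ` axes"
    proof
      assume "s \<in> tface m ` axes"
      then obtain a where "a \<in> axes" "s = tface m a" by (rule imageE)
      then show False using s(2) cv_in_cface[OF assms(1) base _ empty_subsetI, of a True] by simp
    qed
    then have s': "s \<in> faces_at (m-1)" "s \<notin> bface m ` axes"
      using s(1) unfolding faces_step[OF assms(1) base] by (simp_all only: Un_iff Diff_iff simp_thms)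
    then have "s \<in> star_at (m-1) (cv m {})" using s(2) by (simp add: star_at_def)
    then show False using s'(2) unfolding bot_vertex_star[OF assms(1) base] by simp
  qed
next
  case (step k)
  have "cv m {} \<noteq> Inr (Suc k)"
    using kname_Inr[of "m-1" "fpos n (fd m) {}" "Suc k"] step(1) by (auto simp: cv_simps(2))
  then show ?case using verts_step[of "Suc k"] step assms(1) by auto
qed

lemma finite_faces: "m < len \<Longrightarrow> finite (faces_at m)"
  unfolding faces_at_def using tiling_finite[OF tiling] by blast

lemma finite_star_upto: "m < len \<Longrightarrow> finite (star_upto m v)"
  unfolding star_upto_def using finite_faces by auto

section \<open>Stars of vertices and the product over the cubes at a vertex\<close>

lemma star_step_gen:
  assumes m: "1 \<le> m" "m < len"
  shows "star_at m v = (star_at (m-1) v - bface m ` {a \<in> axes. v \<in> face_verts (bface m a)})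
      \<union> tface m ` {a \<in> axes. v \<in> face_verts (tface m a)}"
    and "star_upto m v = star_upto (m-1) v \<union> tface m ` {a \<in> axes. v \<in> face_verts (tface m a)}"
proof -
  have gen0: "{s \<in> (X - Y) \<union> Z. Q s} = ({s \<in> X. Q s} - {s \<in> Y. Q s}) \<union> {s \<in> Z. Q s}"
    for X Y Z :: "kface set" and Q by blast
  have gen1: "{s \<in> f ` X. Q s} = f ` {a \<in> X. Q (f a)}" for f :: "nat \<Rightarrow> kface" and X Q
    by blast
  have gen2: "A = U \<union> t" if "A = U \<union> S'" "S' = (S - b) \<union> t" "S \<subseteq> U" for A U S S' b t :: "kface set"
    using that by blast
  show 1: "star_at m v = (star_at (m-1) v - bface m ` {a \<in> axes. v \<in> face_verts (bface m a)})
      \<union> tface m ` {a \<in> axes. v \<in> face_verts (tface m a)}"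
    unfolding star_at_def faces_step[OF m] gen0 gen1 ..
  have "(\<Union>k\<le>m. faces_at k) = (\<Union>k\<le>m-1. faces_at k) \<union> faces_at m"
    using m(1) by (cases m) (auto simp: atMost_Suc)
  then have "star_upto m v = star_upto (m-1) v \<union> star_at m v"
    by (auto simp: star_upto_def star_at_def)
  moreover have "star_at (m-1) v \<subseteq> star_upto (m-1) v"
    by (auto simp: star_upto_def star_at_def)
  ultimately show "star_upto m v = star_upto (m-1) v \<union> tface m ` {a \<in> axes. v \<in> face_verts (tface m a)}"
    by (rule gen2[OF _ 1])
qed

lemma star_step:
  assumes m: "1 \<le> m" "m < len" and B: "B \<subseteq> axes"
  shows "star_at m (cv m B) = (star_at (m-1) (cv m B) - bface m ` (axes - B)) \<union> tface m ` (axes \<inter> B)"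
    and "star_upto m (cv m B) = star_upto (m-1) (cv m B) \<union> tface m ` (axes \<inter> B)"
proof -
  have "{a \<in> axes. cv m B \<in> face_verts (bface m a)} = axes - B"
    "{a \<in> axes. cv m B \<in> face_verts (tface m a)} = axes \<inter> B"
    using cv_in_cface[OF m _ B] unfolding set_diff_eq Int_def by (intro Collect_cong conj_cong refl; simp)+
  then show "star_at m (cv m B) = (star_at (m-1) (cv m B) - bface m ` (axes - B)) \<union> tface m ` (axes \<inter> B)"
    "star_upto m (cv m B) = star_upto (m-1) (cv m B) \<union> tface m ` (axes \<inter> B)"
    using star_step_gen[OF m, of "cv m B"] by (simp_all only:)
qed

lemma star_step_other:
  assumes m: "1 \<le> m" "m < len" and v: "v \<notin> cvert n Ts m ` Pow axes"
  shows "star_at m v = star_at (m-1) v" "star_upto m v = star_upto (m-1) v"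
proof -
  have b: "v \<notin> face_verts (cface n Ts m a \<beta>)" if a: "a \<in> axes" for a \<beta>
  proof
    assume "v \<in> face_verts (cface n Ts m a \<beta>)"
    then obtain B where "B \<in> {B. B \<subseteq> axes \<and> (a \<in> B \<longleftrightarrow> \<beta>)}" "v = cv m B"
      unfolding face_verts_cface[OF m a] by (rule imageE)
    then show False using v by (simp add: image_eqI)
  qed
  have "{a \<in> axes. v \<in> face_verts (cface n Ts m a \<beta>)} = {}" for \<beta>
    unfolding Collect_empty_eq using b by metis
  then show "star_at m v = star_at (m-1) v" "star_upto m v = star_upto (m-1) v"
    unfolding star_step_gen[OF m] by (simp_all only: image_empty Diff_empty Un_empty_right)
qed

text \<open>A face at \<open>v\<close> lies on one cube from above and on one from below, except that
  faces of the initial and of the current tiling miss one of the two.\<close>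

lemma star_product:
  fixes g :: "kface \<Rightarrow> complex"
  assumes "m < len"
    and "\<And>k B. \<lbrakk>1 \<le> k; k \<le> m; B \<subseteq> axes; cv k B = v\<rbrakk> \<Longrightarrow>
       h k = \<sigma> k * (\<Prod>a\<in>axes. g (cface n Ts k a (a \<in> B)))"
  shows "(\<Prod>k\<in>cubes_upto m v. h k) * (\<Prod>s\<in>star_at m v. g s) * (\<Prod>s\<in>star_at 0 v. g s)
    = (\<Prod>k\<in>cubes_upto m v. \<sigma> k) * (\<Prod>s\<in>star_upto m v. (g s)^2)"
  using assms
proof (induction m)
  case 0
  \<comment> \<open>At time 0 the initial star is also the current one, which accounts for the
    squares.\<close>
  have "star_upto 0 v = star_at 0 v" by (auto simp: star_upto_def star_at_def)
  then show ?case by (simp add: cubes_upto_def power2_eq_square prod.distrib)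
next
  case (Suc m)
  let ?m = "Suc m"
  have m: "1 \<le> ?m" "?m < len" using Suc.prems by auto
  have IH: "(\<Prod>k\<in>cubes_upto m v. h k) * (\<Prod>s\<in>star_at m v. g s) * (\<Prod>s\<in>star_at 0 v. g s)
    = (\<Prod>k\<in>cubes_upto m v. \<sigma> k) * (\<Prod>s\<in>star_upto m v. (g s)^2)"
    using Suc by auto
  have upto: "{k \<in> {1..Suc m}. P k} = (if P (Suc m) then insert (Suc m) {k \<in> {1..m}. P k} else {k \<in> {1..m}. P k})" for P
    by (auto simp: le_Suc_eq)
  show ?case
  proof (cases "v \<in> cvert n Ts ?m ` Pow axes")
    case False
    then have "cubes_upto ?m v = cubes_upto m v"
      unfolding cubes_upto_def upto by simp
    then show ?thesis using IH star_step_other[OF m False] by simp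
  next
    case True
    then obtain B where B: "B \<subseteq> axes" "v = cv ?m B" by blast
    have cu: "cubes_upto ?m v = insert ?m (cubes_upto m v)"
      using True unfolding cubes_upto_def upto by simp
    have nin: "?m \<notin> cubes_upto m v" "finite (cubes_upto m v)" by (auto simp: cubes_upto_def)
    define Bf Tf where BT: "Bf = bface ?m ` (axes - B)" "Tf = tface ?m ` (axes \<inter> B)"
    let ?bot = "\<Prod>s\<in>Bf. g s" and ?top = "\<Prod>s\<in>Tf. g s"
    have inj: "inj_on (bface ?m) (axes - B)" "inj_on (tface ?m) (axes \<inter> B)"
      using cface_inj[OF m] by (auto intro!: inj_onI)
    have "(\<Prod>a\<in>axes. g (cface n Ts ?m a (a \<in> B))) =
      (\<Prod>a\<in>axes \<inter> B. g (cface n Ts ?m a (a \<in> B))) * (\<Prod>a\<in>axes - B. g (cface n Ts ?m a (a \<in> B)))"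
      by (rule prod.Int_Diff) simp
    also have "\<dots> = ?top * ?bot"
      unfolding BT prod.reindex[OF inj(1)] prod.reindex[OF inj(2)]
      by (intro arg_cong2[where f="(*)"] prod.cong) auto
    finally have h: "h ?m = \<sigma> ?m * (?top * ?bot)" using Suc.prems(2)[OF m(1) order_refl B(1)] B(2) by simp
    have fin: "finite (star_at m v)" using finite_faces[of m] m by (simp add: star_at_def)
    have sub: "Bf \<subseteq> star_at m v"
    proof
      fix s assume "s \<in> Bf"
      then obtain a where a: "a \<in> axes" "a \<notin> B" "s = bface ?m a" unfolding BT by blast
      then show "s \<in> star_at m v"
        using bface_in[OF m a(1)] cv_in_cface[OF m a(1) B(1), of False] B(2) by (simp add: star_at_def)
    qed
    have fresh: "s \<notin> faces_at k" if "s \<in> Tf" "k \<le> m" for s k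
    proof -
      from that(1) obtain a where a: "a \<in> axes \<inter> B" "s = tface ?m a" unfolding BT by (rule imageE)
      show ?thesis unfolding a(2) using a(1) that(2) by (intro tface_fresh[OF m]) auto
    qed
    have disj: "star_at m v \<inter> Tf = {}" "star_upto m v \<inter> Tf = {}"
      using fresh unfolding star_at_def star_upto_def by blast+
    have finT: "finite Tf" unfolding BT by simp
    have "star_at ?m v = (star_at m v - Bf) \<union> Tf"
      using star_step(1)[OF m B(1)] unfolding B(2) BT diff_Suc_1 .
    moreover have "(star_at m v - Bf) \<inter> Tf = {}" using disj(1) by blast
    ultimately have "(\<Prod>s\<in>star_at ?m v. g s) = (\<Prod>s\<in>star_at m v - Bf. g s) * ?top"
      using prod.union_disjoint[OF finite_Diff[OF fin] finT] by simp
    moreover have "(\<Prod>s\<in>star_at m v. g s) = (\<Prod>s\<in>star_at m v - Bf. g s) * ?bot"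
      by (rule prod.subset_diff[OF sub fin])
    \<comment> \<open>The exchange of bottom faces for top faces at \<open>v\<close>, kept
      multiplied out because \<open>g\<close> may vanish.\<close>
    ultimately have st: "?bot * (\<Prod>s\<in>star_at ?m v. g s) = (\<Prod>s\<in>star_at m v. g s) * ?top"
      by (simp add: mult_ac)
    have "star_upto ?m v = star_upto m v \<union> Tf"
      using star_step(2)[OF m B(1)] unfolding B(2) BT diff_Suc_1 .
    then have "(\<Prod>s\<in>star_upto ?m v. (g s)^2) = (\<Prod>s\<in>star_upto m v. (g s)^2) * (\<Prod>s\<in>Tf. (g s)^2)"
      using prod.union_disjoint[OF finite_star_upto finT disj(2)] m by simp
    also have "(\<Prod>s\<in>Tf. (g s)^2) = ?top * ?top"
      by (simp add: power2_eq_square prod.distrib)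
    finally have su: "(\<Prod>s\<in>star_upto ?m v. (g s)^2) = (\<Prod>s\<in>star_upto m v. (g s)^2) * (?top * ?top)" .
    have "(\<Prod>k\<in>cubes_upto ?m v. h k) * (\<Prod>s\<in>star_at ?m v. g s) * (\<Prod>s\<in>star_at 0 v. g s)
      = \<sigma> ?m * ?top * (\<Prod>k\<in>cubes_upto m v. h k) * (?bot * (\<Prod>s\<in>star_at ?m v. g s)) * (\<Prod>s\<in>star_at 0 v. g s)"
      unfolding cu using nin h by (simp add: mult_ac)
    also have "\<dots> = \<sigma> ?m * (?top * ?top) * ((\<Prod>k\<in>cubes_upto m v. h k) * (\<Prod>s\<in>star_at m v. g s) * (\<Prod>s\<in>star_at 0 v. g s))"
      unfolding st by (simp add: mult_ac)
    also have "\<dots> = (\<Prod>k\<in>cubes_upto ?m v. \<sigma> k) * (\<Prod>s\<in>star_upto ?m v. (g s)^2)"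
      unfolding IH su cu using nin by (simp add: mult_ac)
    finally show ?thesis .
  qed
qed

end

subsection \<open>Cells of the realization\<close>

definition bil :: "kface \<Rightarrow> real \<Rightarrow> real \<Rightarrow> kvert \<Rightarrow> real" where
  "bil s a b = (case s of (s1,s2,s3,s4) \<Rightarrow>
     (\<lambda>u. (if u = s1 then (1-a)*(1-b) else 0) + (if u = s2 then a*(1-b) else 0)
          + (if u = s3 then a*b else 0) + (if u = s4 then (1-a)*b else 0)))"

lemma face_cell_bil: "face_cell s = {bil s a b | a b. 0 \<le> a \<and> a \<le> 1 \<and> 0 \<le> b \<and> b \<le> 1}"
  by (cases s) (simp add: face_cell_def bil_def)

lemma cube_weight_alt: "cube_weight t B = (if 0 \<in> B then t 0 else 1 - t 0) * (if 1 \<in> B then t 1 else 1 - t 1)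
     * (if 2 \<in> B then t 2 else 1 - t 2)"
  by (simp add: cube_weight_def mult.assoc)

lemma sum_Pow012:
  fixes F :: "nat set \<Rightarrow> 'a :: comm_monoid_add"
  shows "(\<Sum>B\<in>Pow axes. F B) = F {} + F {0} + F {1} + F {2} + F {0,1} + F {0,2} + F {1,2} + F {0,1,2}"
proof -
  have d: "{0} \<noteq> {1::nat}" "{0} \<noteq> {2::nat}" "{1} \<noteq> {2::nat}"
    "{0} \<noteq> {0,1::nat}" "{0} \<noteq> {0,2::nat}" "{0} \<noteq> {1,2::nat}" "{1} \<noteq> {0,1::nat}" "{1} \<noteq> {0,2::nat}" "{1} \<noteq> {1,2::nat}"
    "{2} \<noteq> {0,1::nat}" "{2} \<noteq> {0,2::nat}" "{2} \<noteq> {1,2::nat}"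
    "{0,1} \<noteq> {0,2::nat}" "{0,1} \<noteq> {1,2::nat}" "{0,2} \<noteq> {1,2::nat}"
    by (simp_all add: doubleton_eq_iff)
  show ?thesis unfolding Pow012 using d neq_012 by (simp add: add.assoc)
qed

text \<open>The weights are a product distribution on the corners with total mass 1 and means
  \<open>t\<close>, so the interpolation of an affine function of the corner is that function at
  \<open>t\<close>.\<close>

lemma sum_cube_weight:
  "(\<Sum>B\<in>Pow axes. cube_weight t B) = 1"
  "(\<Sum>B\<in>Pow axes. cube_weight t B * of_bool (0 \<in> B)) = t 0"
  "(\<Sum>B\<in>Pow axes. cube_weight t B * of_bool (1 \<in> B)) = t 1"
  "(\<Sum>B\<in>Pow axes. cube_weight t B * of_bool (2 \<in> B)) = t 2"
  unfolding sum_Pow012 cube_weight_alt by (simp_all add: algebra_simps)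

context pile
begin

definition cpt :: "nat \<Rightarrow> (nat \<Rightarrow> real) \<Rightarrow> kvert \<Rightarrow> real" where
  "cpt m t = (\<lambda>u. \<Sum>B\<in>Pow axes. if cvert n Ts m B = u then cube_weight t B else 0)"

lemma cube_cell_cpt: "cube_cell n Ts m = {cpt m t | t. \<forall>a\<in>axes. 0 \<le> t a \<and> t a \<le> 1}"
  by (simp add: cube_cell_def cpt_def)

definition surf :: "nat \<Rightarrow> (kvert \<Rightarrow> real) set" where
  "surf m = (\<Union>s\<in>faces_at m. face_cell s)"

definition planar :: "(kvert \<Rightarrow> real) \<Rightarrow> complex" where
  "planar f = (\<Sum>u\<in>kappa0 n Ts. of_real (f u) * kpos u)"

text \<open>Height over \<open>p\<close> of the m-th tiling viewed as a surface, the initial one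
  being at height 0; each flip lifts the surface by the fibre length of its cube.\<close>

definition hgt :: "nat \<Rightarrow> complex \<Rightarrow> real" where
  "hgt m p = (\<Sum>k\<in>{1..m}. flen n (fdat n Ts k) p)"

text \<open>A relation at first, since a point may lie in several cells;
  \<open>has_hgt_unique\<close> shows that they agree. Inside a cube, \<open>lam\<close> is the
  elevation above the surface before the flip.\<close>

definition has_hgt :: "(kvert \<Rightarrow> real) \<Rightarrow> real \<Rightarrow> bool" where
  "has_hgt f h \<longleftrightarrow>
     (\<exists>m t. 1 \<le> m \<and> m < len \<and> (cb t) \<and> f = cpt m t \<and>
        h = hgt (m-1) (planar f) + lam n (fdat n Ts m) t) \<or>
     (\<exists>m<len. f \<in> surf m \<and> h = hgt m (planar f))"

lemma finite_kappa0: "finite (kappa0 n Ts)"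
  unfolding kappa0_verts verts_at_def using tiling_verts_finite[OF tiling] by auto

lemma cv_kappa0:
  assumes "1 \<le> m" "m < len" "B \<subseteq> axes"
  shows "B = {0,1,2} \<longrightarrow> cv m B \<in> verts_at m" "B \<noteq> {0,1,2} \<longrightarrow> cv m B \<in> verts_at (m-1)"
    "cv m B \<in> kappa0 n Ts"
proof -
  have z: "(0::nat) \<in> axes" by simp
  show 1: "B = {0,1,2} \<longrightarrow> cv m B \<in> verts_at m"
    using cv_in_cface[OF assms(1,2) z assms(3), of True] tface_in[OF assms(1,2) z]
    unfolding verts_at_faces by auto
  show 2: "B \<noteq> {0,1,2} \<longrightarrow> cv m B \<in> verts_at (m-1)"
  proof
    assume "B \<noteq> {0,1,2}"
    then obtain b where b: "b \<in> axes" "b \<notin> B" using assms(3) by blast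
    then have "cv m B \<in> face_verts (bface m b)" using cv_in_cface[OF assms(1,2) b(1) assms(3)] by simp
    then show "cv m B \<in> verts_at (m-1)" using bface_in[OF assms(1,2) b(1)] unfolding verts_at_faces by blast
  qed
  show "cv m B \<in> kappa0 n Ts" unfolding kappa0_verts using 1 2 assms(2) by (metis UN_I lessThan_iff less_imp_diff_less)
qed

lemma kpos_cv:
  shows "kpos (cv m B) = fpos n (fd m) B"
  by (cases "B = {0,1,2}") (simp_all add: cv_simps, simp add: kpos_def vnew_def)

lemma planar_comb:
  assumes "finite I" "c ` I \<subseteq> kappa0 n Ts"
  shows "planar (\<lambda>u. \<Sum>i\<in>I. if c i = u then w i else 0) = (\<Sum>i\<in>I. of_real (w i) * kpos (c i))"
proof -
  have "planar (\<lambda>u. \<Sum>i\<in>I. if c i = u then w i else 0)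
    = (\<Sum>u\<in>kappa0 n Ts. \<Sum>i\<in>I. (if c i = u then of_real (w i) * kpos (c i) else 0))"
    unfolding planar_def of_real_sum sum_distrib_right by (intro sum.cong refl) auto
  also have "\<dots> = (\<Sum>i\<in>I. \<Sum>u\<in>kappa0 n Ts. (if c i = u then of_real (w i) * kpos (c i) else 0))"
    by (rule sum.swap)
  also have "\<dots> = (\<Sum>i\<in>I. of_real (w i) * kpos (c i))"
    using assms finite_kappa0 by (intro sum.cong refl) (auto simp: sum.delta')
  finally show ?thesis .
qed

lemma planar_cpt:
  assumes "1 \<le> m" "m < len"
  shows "planar (cpt m t) = qpt n (fd m) t"
proof -
  have img: "cvert n Ts m ` Pow axes \<subseteq> kappa0 n Ts"
    by (intro image_subsetI cv_kappa0(3)[OF assms]) (simp only: Pow_iff)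
  have fin: "finite (Pow {0,1,2::nat})" by simp
  have "planar (cpt m t) = (\<Sum>B\<in>Pow axes. of_real (cube_weight t B) * fpos n (fd m) B)"
    unfolding cpt_def planar_comb[OF fin img] kpos_cv ..
  also have "\<dots> = (\<Sum>B\<in>Pow axes. of_real (cube_weight t B) * qpt n (fd m) (\<lambda>a. of_bool (a \<in> B)))"
    by (rule sum.cong[OF refl], subst fpos_qpt) (simp_all only: Pow_iff)
  also have "\<dots> = of_real (\<Sum>B\<in>Pow axes. cube_weight t B) * fpos n (fd m) {}
     + of_real (\<Sum>B\<in>Pow axes. cube_weight t B * of_bool (0 \<in> B)) * gdir n (fd m) 0
     + of_real (\<Sum>B\<in>Pow axes. cube_weight t B * of_bool (1 \<in> B)) * gdir n (fd m) 1
     + of_real (\<Sum>B\<in>Pow axes. cube_weight t B * of_bool (2 \<in> B)) * gdir n (fd m) 2"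
    by (simp only: qpt_def distrib_left sum.distrib of_real_sum sum_distrib_right of_real_mult mult.assoc)
  also have "\<dots> = qpt n (fd m) t"
    unfolding sum_cube_weight by (simp add: qpt_def)
  finally show ?thesis .
qed

lemma planar_add: "planar (\<lambda>u. f u + g u) = planar f + planar g"
  by (simp add: planar_def distrib_right sum.distrib)

lemma planar_single:
  assumes "v \<in> kappa0 n Ts"
  shows "planar (\<lambda>u. if u = v then w else 0) = of_real w * kpos v"
proof -
  have "planar (\<lambda>u. if u = v then w else 0) = (\<Sum>u\<in>kappa0 n Ts. if u = v then of_real w * kpos v else 0)"
    unfolding planar_def by (intro sum.cong refl) simp
  then show ?thesis using assms finite_kappa0 by simp
qed

lemma planar_bil:
  assumes "m < len" "(i,j,t) \<in> Ts ! m"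
  shows "planar (bil (tile_face n Ts m (i,j,t)) a b) = t + of_real a * ee n i + of_real b * ee n j"
proof -
  have k: "kname n Ts m p \<in> kappa0 n Ts" if "p \<in> set (corners n (i,j,t))" for p
    using assms that unfolding kappa0_def tiling_verts_def by blast
  have k4: "kname n Ts m t \<in> kappa0 n Ts" "kname n Ts m (t + ee n i) \<in> kappa0 n Ts"
    "kname n Ts m (t + ee n i + ee n j) \<in> kappa0 n Ts" "kname n Ts m (t + ee n j) \<in> kappa0 n Ts"
    by (rule k, simp add: corners_def)+
  show ?thesis unfolding bil_def tile_face_def prod.case planar_add
      planar_single[OF k4(1)] planar_single[OF k4(2)] planar_single[OF k4(3)] planar_single[OF k4(4)]
    by (simp add: algebra_simps)
qed

text \<open>A tile lists its corners starting from its own base point and not from the bottom vertex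
  of the cube, so the free coordinates are measured by \<open>uco\<close>.\<close>

lemma cpt_cface:
  assumes m: "1 \<le> m" "m < len" and a: "a \<in> axes" and t: "t a = of_bool \<beta>"
  shows "cpt m t = bil (cface n Ts m a \<beta>)
     (if a = 0 then uco (fd m) t 1 else uco (fd m) t 0)
     (if a = 2 then uco (fd m) t 1 else uco (fd m) t 2)"
proof -
  obtain i j k c up where d: "fd m = (i,j,k,c,up)" by (cases "fd m")
  have bil: "bil (s1,s2,s3,s4) x y = (\<lambda>u. (if s1 = u then (1-x)*(1-y) else 0) + (if s2 = u then x*(1-y) else 0)
          + (if s3 = u then x*y else 0) + (if s4 = u then (1-x)*y else 0))" for s1 s2 s3 s4 x y
    unfolding bil_def prod.case by (simp only: eq_commute[of _ s1] eq_commute[of _ s2] eq_commute[of _ s3] eq_commute[of _ s4])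
  have bot: "cv m B = kname n Ts (m-1) (fpos n (fd m) B)" if "B \<noteq> {0,1,2}" for B
    using that by (rule cv_simps(2))
  note top = cv_kname[OF m]
  show ?thesis
  proof (cases \<beta>)
    case True
    then show ?thesis using a t
      by (elim insertE emptyE; cases up)
        (simp_all add: fun_eq_iff bil tile_face_def cface_ctile d ctile_alt cpt_def sum_Pow012 cube_weight_alt
          top fpos_alt uco_def add_ac mult_ac)
  next
    case False
    then show ?thesis using a t
      by (elim insertE emptyE; cases up)
        (simp_all add: fun_eq_iff bil tile_face_def cface_ctile d ctile_alt cpt_def sum_Pow012 cube_weight_alt
          bot neq_012 fpos_alt uco_def add_ac mult_ac)
  qed
qed

lemma face_cell_cface:
  assumes m: "1 \<le> m" "m < len" and a: "a \<in> axes"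
  shows "face_cell (cface n Ts m a \<beta>) = {cpt m t | t. cb t \<and> t a = of_bool \<beta>}"
proof (intro equalityI subsetI)
  fix f assume "f \<in> {cpt m t | t. cb t \<and> t a = of_bool \<beta>}"
  then obtain t where t: "f = cpt m t" "cb t" "t a = of_bool \<beta>" by blast
  have "cb (uco (fd m) t)" using t(2) uco_cube by blast
  then show "f \<in> face_cell (cface n Ts m a \<beta>)"
    unfolding t(1) cpt_cface[where t = t and a = a, OF assms t(3)] face_cell_bil by auto
next
  fix f assume "f \<in> face_cell (cface n Ts m a \<beta>)"
  then obtain x y where xy: "f = bil (cface n Ts m a \<beta>) x y" "0 \<le> x" "x \<le> 1" "0 \<le> y" "y \<le> 1"
    unfolding face_cell_bil by blast
  \<comment> \<open>The two tile parameters are spread over the axes other than \<open>a\<close>;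
    the entry at \<open>a\<close> is a filler in the unit interval, overwritten in
    \<open>t\<close>.\<close>
  define u where "u = (\<lambda>b::nat. if b = 0 then x else if b = 1 then (if a = 0 then x else y) else y)"
  define t where "t = (\<lambda>b. if b = a then of_bool \<beta> else uco (fd m) u b)"
  have ta: "t a = of_bool \<beta>" by (simp add: t_def)
  have "cb u" using xy by (simp add: u_def)
  then have "cb t" using uco_cube[of "fd m" u] by (simp add: t_def)
  moreover have "uco (fd m) t b = u b" if "b \<noteq> a" for b using that by (simp add: t_def uco_def)
  then have "cpt m t = f" unfolding cpt_cface[where t = t and a = a, OF assms ta] xy(1) using a
    by (elim insertE emptyE) (simp_all add: u_def)
  ultimately show "f \<in> {cpt m t | t. cb t \<and> t a = of_bool \<beta>}" using ta by blast
qed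

lemma cpt_in_surf:
  assumes m: "1 \<le> m" "m < len" and a: "a \<in> axes" and t: "cb t" "t a = of_bool \<beta>"
  shows "cpt m t \<in> surf (if \<beta> then m else m-1)"
proof -
  have "cpt m t \<in> face_cell (cface n Ts m a \<beta>)" unfolding face_cell_cface[OF m a] using t by blast
  moreover have "cface n Ts m a \<beta> \<in> faces_at (if \<beta> then m else m-1)"
    using bface_in[OF m a] tface_in[OF m a] by simp
  ultimately show ?thesis unfolding surf_def by blast
qed

lemma cpt_at_vertex:
  assumes m: "1 \<le> m" "m < len" and B: "B \<subseteq> axes"
  shows "cpt m t (cv m B) = cube_weight t B"
proof -
  have "cpt m t (cv m B) = (\<Sum>A\<in>Pow axes. if A = B then cube_weight t A else 0)"
    unfolding cpt_def using cv_inj[OF m] B by (intro sum.cong refl) (auto dest: inj_onD)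
  then show ?thesis using B by (subst (asm) sum.delta) simp_all
qed

lemma cpt_support:
  assumes "cpt m t u \<noteq> 0"
  obtains B where "B \<subseteq> axes" "u = cv m B" "cube_weight t B \<noteq> 0"
proof -
  obtain B where "B \<in> Pow axes" "(if cv m B = u then cube_weight t B else 0) \<noteq> 0"
    using assms unfolding cpt_def by (rule sum.not_neutral_contains_not_neutral)
  then show ?thesis using that[of B] by (simp split: if_splits)
qed

lemma bil_support: "bil s a b u \<noteq> 0 \<Longrightarrow> u \<in> face_verts s"
  by (cases s) (auto simp: bil_def face_verts_def split: if_splits)

lemma surf_support:
  assumes "f \<in> surf m" "f u \<noteq> 0"
  shows "u \<in> verts_at m"
  using assms bil_support unfolding surf_def verts_at_faces face_cell_bil by blast

lemma lam_zero_iff: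
  assumes m: "1 \<le> m" "m < len" and t: "cb t"
  shows "lam n (fd m) t = 0 \<longleftrightarrow> (\<exists>a\<in>axes. t a = 0)" "ulam n (fd m) t = 0 \<longleftrightarrow> (\<exists>a\<in>axes. t a = 1)"
proof -
  note v = valid[OF m]
  note D = dcoef_pos[OF v]
  have *: "lam n (fd m) s = 0 \<longleftrightarrow> (\<exists>a\<in>axes. s a = 0)" if s: "cb s" for s
  proof
    assume h: "lam n (fd m) s = 0"
    obtain a where "a \<in> axes" "s a = lam n (fd m) s * dcoef n (fd m) a" by (rule lam_attained[OF v])
    then show "\<exists>a\<in>axes. s a = 0" using h by (intro bexI[of _ a]) auto
  next
    assume "\<exists>a\<in>axes. s a = 0"
    then obtain a where a: "a \<in> axes" "s a = 0" by blast
    have "lam n (fd m) s * dcoef n (fd m) a \<le> s a" using lam_ge_iff[OF v, of "lam n (fd m) s" s] a(1) by blast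
    then have "lam n (fd m) s \<le> 0" using a(2) D[of a] by (simp add: mult_le_0_iff)
    moreover have "0 \<le> lam n (fd m) s" using s cube_iff[OF v] by blast
    ultimately show "lam n (fd m) s = 0" by simp
  qed
  show "lam n (fd m) t = 0 \<longleftrightarrow> (\<exists>a\<in>axes. t a = 0)" by (rule *[OF t])
  have "cb (\<lambda>a. 1 - t a)" using t by simp
  from *[OF this] show "ulam n (fd m) t = 0 \<longleftrightarrow> (\<exists>a\<in>axes. t a = 1)" by (simp add: ulam_def)
qed

lemma cube_weight_zero:
  "cube_weight t {} = 0 \<longleftrightarrow> (\<exists>a\<in>axes. t a = 1)" "cube_weight t {0,1,2} = 0 \<longleftrightarrow> (\<exists>a\<in>axes. t a = 0)"
  by (auto simp: cube_weight_alt)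

lemma surf_planar:
  assumes "m < len" "\<tau> \<in> Ts ! m" "f \<in> face_cell (tile_face n Ts m \<tau>)"
  shows "planar f \<in> rhomb n \<tau>"
proof -
  obtain i j t where \<tau>: "\<tau> = (i,j,t)" by (cases \<tau>)
  obtain a b where "f = bil (tile_face n Ts m \<tau>) a b" "0 \<le> a" "a \<le> 1" "0 \<le> b" "b \<le> 1"
    using assms(3) unfolding face_cell_bil by blast
  then show ?thesis using planar_bil[OF assms(1), of i j t a b] assms(2) unfolding \<tau> rhomb_eq by blast
qed

text \<open>Outside the open hexagon the flip changes nothing. A point of a bottom face has weight 0
  at the bottom vertex only if some coordinate is 1, that is, where bottom and top faces meet and
  the fibre is a single point.\<close>

lemma surf_persist:
  assumes m: "1 \<le> m" "m < len" and f: "f \<in> surf (m-1)"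
  shows "flen n (fd m) (planar f) = 0 \<Longrightarrow> f \<in> surf m"
    and "f (cv m {}) = 0 \<Longrightarrow> flen n (fd m) (planar f) = 0"
proof -
  note v = valid[OF m]
  obtain \<tau> where \<tau>: "\<tau> \<in> Ts ! (m-1)" "f \<in> face_cell (tile_face n Ts (m-1) \<tau>)"
    using f unfolding surf_def faces_at_def by blast
  have P: "planar f \<in> rhomb n \<tau>" using surf_planar[OF _ \<tau>] m by simp
  have "(flen n (fd m) (planar f) = 0 \<longrightarrow> f \<in> surf m) \<and> (f (cv m {}) = 0 \<longrightarrow> flen n (fd m) (planar f) = 0)"
  proof (cases "\<tau> \<in> (\<lambda>a. ctile n (fd m) a False) ` axes")
    case True
    then obtain a where a: "a \<in> axes" "\<tau> = ctile n (fd m) a False" by (rule imageE)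
    then have "f \<in> face_cell (bface m a)" using \<tau>(2) by (simp add: cface_ctile)
    then obtain t where t: "f = cpt m t" "cb t" "t a = of_bool False"
      unfolding face_cell_cface[OF m a(1)] by blast
    have l: "lam n (fd m) t = 0" using lam_zero_iff(1)[OF m t(2)] a(1) t(3) by auto
    have fl: "flen n (fd m) (planar f) = ulam n (fd m) t"
      unfolding t(1) planar_cpt[OF m] using flen_cube[OF v t(2)] l by simp
    show ?thesis
    proof (intro conjI impI)
      assume "flen n (fd m) (planar f) = 0"
      then obtain b where b: "b \<in> axes" "t b = 1" using lam_zero_iff(2)[OF m t(2)] fl by auto
      then show "f \<in> surf m" using cpt_in_surf[OF m b(1) t(2), of True] t(1) by simp
    next
      assume "f (cv m {}) = 0"
      then have "\<exists>b\<in>axes. t b = 1"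
        using cpt_at_vertex[OF m, of "{}" t] cube_weight_zero(1)[of t] t(1) by simp
      then show "flen n (fd m) (planar f) = 0" using lam_zero_iff(2)[OF m t(2)] fl by simp
    qed
  next
    case False
    have "\<not> flen n (fd m) (planar f) > 0"
    proof -
      have "m - 1 < len" using m by simp
      from tiling_hexagon[OF tiling[OF this] v bot_tiles[OF m] \<tau>(1) P] False show ?thesis by blast
    qed
    moreover have "flen n (fd m) (planar f) \<ge> 0" by (simp add: flen_def)
    moreover have \<tau>': "\<tau> \<in> Ts ! m" "\<tau> \<notin> (\<lambda>a. ctile n (fd m) a True) ` axes"
      using \<tau>(1) False tiles_step[OF m] top_tile_new[OF m] by blast+
    have "f \<in> face_cell (tile_face n Ts m \<tau>)" using tile_face_kept[OF m \<tau>'] \<tau>(2) by simp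
    then have "f \<in> surf m" unfolding surf_def faces_at_def by (intro UN_I[OF imageI[OF \<tau>'(1)]])
    ultimately show ?thesis by auto
  qed
  then show "flen n (fd m) (planar f) = 0 \<Longrightarrow> f \<in> surf m"
    "f (cv m {}) = 0 \<Longrightarrow> flen n (fd m) (planar f) = 0" by auto
qed

lemma hgt_Suc: "hgt (Suc k) p = hgt k p + flen n (fd (Suc k)) p"
  by (simp add: hgt_def)

lemma hgt_step: "1 \<le> m \<Longrightarrow> hgt m p = hgt (m-1) p + flen n (fd m) p"
  using hgt_Suc[of "m-1" p] by simp

lemma flen_nonneg: "flen n d p \<ge> 0"
  by (simp add: flen_def)

lemma hgt_mono: "k \<le> m \<Longrightarrow> hgt k p \<le> hgt m p"
  unfolding hgt_def by (intro sum_mono2) (auto simp: flen_nonneg)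

text \<open>Fibre lengths are nonnegative, so equal heights force every increment in between to
  vanish.\<close>

lemma surf_chain:
  assumes "k \<le> m" "m < len" "f \<in> surf k"
    and "hgt m (planar f) = hgt k (planar f)"
  shows "f \<in> surf m"
  using assms(1,2,4)
proof (induction m rule: dec_induct)
  case base
  then show ?case using assms(3) by simp
next
  case (step m)
  have "hgt k (planar f) \<le> hgt m (planar f)" using hgt_mono step(1) by simp
  moreover have "0 \<le> flen n (fd (Suc m)) (planar f)" by (rule flen_nonneg)
  ultimately have z: "flen n (fd (Suc m)) (planar f) = 0" "hgt m (planar f) = hgt k (planar f)"
    using step.prems(2) hgt_Suc[of m "planar f"] by auto
  then have "f \<in> surf m" using step.IH step.prems by simp
  then show ?case using surf_persist(1)[of "Suc m" f] z step.prems by simp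
qed

text \<open>A vertex alive at time \<open>m\<close> is not removed by any flip up to
  \<open>m\<close>, so \<open>f\<close> has no weight at the removed vertices and its height never
  grows.\<close>

lemma surf_chain_support:
  assumes "k \<le> m" "m < len" "f \<in> surf k" and s: "\<And>u. f u \<noteq> 0 \<Longrightarrow> u \<in> verts_at m"
  shows "hgt m (planar f) = hgt k (planar f)"
proof -
  have "j \<le> m \<Longrightarrow> f \<in> surf j \<and> hgt j (planar f) = hgt k (planar f)" if "k \<le> j" for j
    using that
  proof (induction j rule: dec_induct)
    case (step j)
    have "cv (Suc j) {} \<notin> verts_at m" using bot_vertex_dead[of "Suc j" m] step.prems assms(2) by simp
    then have "f (cv (Suc j) {}) = 0" using s by blast
    then show ?case using surf_persist[of "Suc j" f] step assms(2) hgt_Suc[of j "planar f"] by auto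
  qed (use assms(3) in simp)
  from this[OF assms(1)] show ?thesis by simp
qed

end

subsection \<open>Heights\<close>

definition ept :: "kvert \<Rightarrow> kvert \<Rightarrow> real \<Rightarrow> kvert \<Rightarrow> real" where
  "ept x y s = (\<lambda>u. (if u = x then 1 - s else 0) + (if u = y then s else 0))"

lemma ept_flip: "ept y x (1 - s) = ept x y s"
  by (auto simp: ept_def)

context pile
begin

lemma bil_corner:
  assumes "(i,j,t) \<in> Ts ! m" "m < len" "p \<in> set (corners n (i,j,t))"
    "p = t + of_real a * ee n i + of_real b * ee n j"
  shows "bil (tile_face n Ts m (i,j,t)) a b = vpt (kname n Ts m p)"
proof -
  have ij: "1 \<le> i" "i < j" "j \<le> n" using tiling_tileD[OF tiling[OF assms(2)] assms(1)] .
  have c: "crs (ee n i) (ee n j) \<noteq> 0" using crs_ee_pos[OF ij] by simp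
  obtain a' b' :: real where ab: "a' \<in> {0,1}" "b' \<in> {0,1}" "p = t + of_real a' * ee n i + of_real b' * ee n j"
    using assms(3) by (rule corner_coord)
  have "a = a' \<and> b = b'" using ab(3) assms(4) by (intro crs_independent[OF _ c]) (simp add: add.assoc)
  then show ?thesis using ab
    by (elim insertE emptyE) (simp_all add: bil_def tile_face_def vpt_def fun_eq_iff)
qed

lemma bil_edge:
  assumes "(i,j,t) \<in> Ts ! m" "m < len" "E \<in> tile_edges n (i,j,t)"
    "t + of_real a * ee n i + of_real b * ee n j \<in> E"
  obtains x y s where "E = closed_segment x y" "x \<noteq> y"
    "t + of_real a * ee n i + of_real b * ee n j = (1 - of_real s) * x + of_real s * y"
    "bil (tile_face n Ts m (i,j,t)) a b = ept (kname n Ts m x) (kname n Ts m y) s"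
proof -
  have ij: "1 \<le> i" "i < j" "j \<le> n" using tiling_tileD[OF tiling[OF assms(2)] assms(1)] .
  have c: "crs (ee n i) (ee n j) \<noteq> 0" using crs_ee_pos[OF ij] by simp
  show ?thesis
    using tile_edge_coord[OF c assms(3,4)]
  proof (elim disjE conjE)
    assume "E = closed_segment t (t + ee n i)" "b = 0"
    then show ?thesis
      by (intro that[of t "t + ee n i" a])
        (auto simp: bil_def tile_face_def ept_def fun_eq_iff ee_nonzero algebra_simps)
  next
    assume "E = closed_segment (t + ee n i) (t + ee n i + ee n j)" "a = 1"
    then show ?thesis
      by (intro that[of "t + ee n i" "t + ee n i + ee n j" b])
        (auto simp: bil_def tile_face_def ept_def fun_eq_iff ee_nonzero algebra_simps)
  next
    assume "E = closed_segment (t + ee n j) (t + ee n i + ee n j)" "b = 1"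
    then show ?thesis
      by (intro that[of "t + ee n j" "t + ee n i + ee n j" a])
        (auto simp: bil_def tile_face_def ept_def fun_eq_iff ee_nonzero algebra_simps)
  next
    assume "E = closed_segment t (t + ee n j)" "a = 0"
    then show ?thesis
      by (intro that[of t "t + ee n j" b])
        (auto simp: bil_def tile_face_def ept_def fun_eq_iff ee_nonzero algebra_simps)
  qed
qed

lemma segment_param_unique:
  fixes x y :: complex
  assumes "x \<noteq> y" "(1 - of_real s) * x + of_real s * y = (1 - of_real s') * x + of_real s' * y"
  shows "s = s'"
proof -
  have "of_real (s - s') * (y - x) = 0" using assms(2) by (simp add: algebra_simps)
  then show ?thesis using assms(1) by simp
qed

text \<open>Different tiles meet in a common corner or a whole common side, where both bilinear
  interpolations see only the shared names. So each tiling surface is a graph over the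
  plane.\<close>

lemma surf_unique:
  assumes m: "m < len" and f: "f \<in> surf m" and g: "g \<in> surf m"
    and P: "planar f = planar g"
  shows "f = g"
proof -
  obtain \<tau> where \<tau>: "\<tau> \<in> Ts ! m" "f \<in> face_cell (tile_face n Ts m \<tau>)"
    using f unfolding surf_def faces_at_def by blast
  obtain \<sigma> where \<sigma>: "\<sigma> \<in> Ts ! m" "g \<in> face_cell (tile_face n Ts m \<sigma>)"
    using g unfolding surf_def faces_at_def by blast
  obtain i j t where ijt: "\<tau> = (i,j,t)" by (cases \<tau>)
  obtain i' j' t' where ijt': "\<sigma> = (i',j',t')" by (cases \<sigma>)
  note \<tau>1 = \<tau>(1)[unfolded ijt] and \<sigma>1 = \<sigma>(1)[unfolded ijt']
  obtain a b where ab: "f = bil (tile_face n Ts m (i,j,t)) a b"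
    using \<tau>(2) unfolding face_cell_bil ijt by blast
  obtain a' b' where ab': "g = bil (tile_face n Ts m (i',j',t')) a' b'"
    using \<sigma>(2) unfolding face_cell_bil ijt' by blast
  let ?p = "planar f"
  have p: "?p = t + of_real a * ee n i + of_real b * ee n j" unfolding ab using planar_bil[OF m \<tau>1] .
  have p': "?p = t' + of_real a' * ee n i' + of_real b' * ee n j'" unfolding P ab' using planar_bil[OF m \<sigma>1] .
  have in\<tau>: "?p \<in> rhomb n \<tau>" using surf_planar[OF m \<tau>] .
  have in\<sigma>: "?p \<in> rhomb n \<sigma>" using surf_planar[OF m \<sigma>] P by simp
  show ?thesis
  proof (cases "\<tau> = \<sigma>")
    case True
    have ij: "1 \<le> i" "i < j" "j \<le> n" using tiling_tileD[OF tiling[OF m] \<tau>1] .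
    have c: "crs (ee n i) (ee n j) \<noteq> 0" using crs_ee_pos[OF ij] by simp
    have eq: "i = i'" "j = j'" "t = t'" using True ijt ijt' by auto
    have "a = a' \<and> b = b'" using p p' unfolding eq[symmetric]
      by (intro crs_independent[OF _ c]) (simp add: add.assoc)
    then show ?thesis using ab ab' eq by simp
  next
    case False
    from tiling_meet[OF tiling[OF m] \<tau>(1) \<sigma>(1) False in\<tau> in\<sigma>] show ?thesis
    proof
      assume "\<exists>p\<in>set (corners n \<tau>) \<inter> set (corners n \<sigma>). rhomb n \<tau> \<inter> rhomb n \<sigma> = {p}"
      then obtain q where q: "q \<in> set (corners n \<tau>) \<inter> set (corners n \<sigma>)" "rhomb n \<tau> \<inter> rhomb n \<sigma> = {q}" by (rule bexE)
      have pq: "?p = q" using in\<tau> in\<sigma> q(2) by (metis IntI singletonD)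
      have c: "?p \<in> set (corners n (i,j,t))" "?p \<in> set (corners n (i',j',t'))" using q(1) pq ijt ijt' by auto
      have "f = vpt (kname n Ts m ?p)" using bil_corner[OF \<tau>1 m c(1) p] ab by simp
      moreover have "g = vpt (kname n Ts m ?p)" using bil_corner[OF \<sigma>1 m c(2) p'] ab' by simp
      ultimately show ?thesis by simp
    next
      assume "\<exists>E\<in>tile_edges n \<tau> \<inter> tile_edges n \<sigma>. rhomb n \<tau> \<inter> rhomb n \<sigma> = E"
      then obtain E where E: "E \<in> tile_edges n \<tau> \<inter> tile_edges n \<sigma>" "rhomb n \<tau> \<inter> rhomb n \<sigma> = E" by (rule bexE)
      have pE: "?p \<in> E" using in\<tau> in\<sigma> E(2) by blast
      have E\<tau>: "E \<in> tile_edges n (i,j,t)" and E\<sigma>: "E \<in> tile_edges n (i',j',t')" using E(1) ijt ijt' by auto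
      obtain x y s where xy: "E = closed_segment x y" "x \<noteq> y" "?p = (1 - of_real s) * x + of_real s * y"
        "f = ept (kname n Ts m x) (kname n Ts m y) s"
        using bil_edge[OF \<tau>1 m E\<tau> pE[unfolded p]] unfolding p[symmetric] ab[symmetric] by metis
      obtain x' y' s' where xy': "E = closed_segment x' y'" "x' \<noteq> y'" "?p = (1 - of_real s') * x' + of_real s' * y'"
        "g = ept (kname n Ts m x') (kname n Ts m y') s'"
        using bil_edge[OF \<sigma>1 m E\<sigma> pE[unfolded p']] unfolding p'[symmetric] ab'[symmetric] by metis
      have "{x,y} = {x',y'}" using xy(1) xy'(1) by simp
      then consider "x = x'" "y = y'" | "x = y'" "y = x'" by (auto simp: doubleton_eq_iff)
      then show ?thesis
      proof cases
        case 1
        then have "s = s'" using xy(2,3) xy'(3) by (intro segment_param_unique[of x y]) auto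
        then show ?thesis using xy(4) xy'(4) 1 by simp
      next
        case 2
        then have "s = 1 - s'" using xy(2,3) xy'(3)
          by (intro segment_param_unique[of x y]) (auto simp: algebra_simps)
        then show ?thesis using xy(4) xy'(4) 2 ept_flip by metis
      qed
    qed
  qed
qed

lemma cpt_bounds:
  assumes m: "1 \<le> m" "m < len" and t: "cb t"
  shows "0 \<le> lam n (fd m) t" "0 \<le> ulam n (fd m) t"
    "hgt m (planar (cpt m t)) = hgt (m-1) (planar (cpt m t)) + lam n (fd m) t + ulam n (fd m) t"
proof -
  show "0 \<le> lam n (fd m) t" "0 \<le> ulam n (fd m) t" using cube_iff[OF valid[OF m]] t by blast+
  show "hgt m (planar (cpt m t)) = hgt (m-1) (planar (cpt m t)) + lam n (fd m) t + ulam n (fd m) t"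
    unfolding hgt_step[OF m(1)] planar_cpt[OF m] flen_cube[OF valid[OF m] t] by simp
qed

lemma cpt_bottom:
  assumes m: "1 \<le> m" "m < len" and t: "cb t" and l: "lam n (fd m) t = 0"
  shows "cpt m t \<in> surf (m-1)"
  using lam_zero_iff(1)[OF m t] l cpt_in_surf[OF m _ t, of _ False] by auto

lemma cpt_top:
  assumes m: "1 \<le> m" "m < len" and t: "cb t" and l: "ulam n (fd m) t = 0"
  shows "cpt m t \<in> surf m"
    "hgt (m-1) (planar (cpt m t)) + lam n (fd m) t = hgt m (planar (cpt m t))"
  using lam_zero_iff(2)[OF m t] l cpt_in_surf[OF m _ t, of _ True] cpt_bounds(3)[OF m t] by auto

lemma cpt_lam_eq:
  assumes m: "1 \<le> m" "m < len" and t: "cb t" "cb s" and eq: "planar (cpt m t) = planar (cpt m s)"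
    "lam n (fd m) t = lam n (fd m) s"
  shows "cpt m t = cpt m s"
proof -
  note v = valid[OF m]
  obtain \<mu> where mu: "\<forall>a\<in>axes. s a = t a + \<mu> * dcoef n (fd m) a"
    using qpt_eq_imp[OF v] eq(1) unfolding planar_cpt[OF m] by blast
  then have "\<mu> = 0" using lam_shift[OF v mu] eq(2) by simp
  then have "s 0 = t 0" "s 1 = t 1" "s 2 = t 2" using mu by auto
  then have "cube_weight t = cube_weight s" by (intro ext) (simp add: cube_weight_alt)
  then show ?thesis unfolding cpt_def by (rule arg_cong)
qed

text \<open>Recovers the cube coordinate \<open>t a\<close> as a linear functional of the point,
  which makes \<open>lam\<close> independent of the representation and continuous.\<close>

definition tco :: "nat \<Rightarrow> nat \<Rightarrow> (kvert \<Rightarrow> real) \<Rightarrow> real" where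
  "tco m a f = (\<Sum>B\<in>{B \<in> Pow axes. a \<in> B}. f (cv m B))"

lemma tco_cpt:
  assumes m: "1 \<le> m" "m < len" and a: "a \<in> axes"
  shows "tco m a (cpt m t) = t a"
proof -
  have "tco m a (cpt m t) = (\<Sum>B\<in>{B \<in> Pow axes. a \<in> B}. cube_weight t B)"
    unfolding tco_def by (rule sum.cong[OF refl]) (auto intro: cpt_at_vertex[OF m])
  also have "\<dots> = (\<Sum>B\<in>Pow axes. cube_weight t B * of_bool (a \<in> B))"
  proof -
    have "(\<Sum>B\<in>{B \<in> Pow axes. a \<in> B}. cube_weight t B) = (\<Sum>B\<in>Pow axes. if a \<in> B then cube_weight t B else 0)"
      by (rule sum.inter_filter) simp
    also have "\<dots> = (\<Sum>B\<in>Pow axes. cube_weight t B * of_bool (a \<in> B))"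
      by (rule sum.cong) auto
    finally show ?thesis .
  qed
  also have "\<dots> = t a" using a by (elim insertE emptyE) (simp_all only: sum_cube_weight)
  finally show ?thesis .
qed

lemma lam_tco:
  assumes m: "1 \<le> m" "m < len"
  shows "lam n (fd m) (\<lambda>a. tco m a (cpt m t)) = lam n (fd m) t"
  unfolding lam_def using tco_cpt[OF m] by simp

section \<open>Uniqueness of the height of a point\<close>

lemma hgt_surf_surf:
  assumes "k \<le> m" "m < len" "f \<in> surf k" "f \<in> surf m"
  shows "hgt k (planar f) = hgt m (planar f)"
  using surf_chain_support[OF assms(1-3)] surf_support[OF assms(4)] by simp

text \<open>A surface from time \<open>m\<close> on has lost the bottom vertex of the cube, so the
  point lies on a top face; an earlier one lacks the top vertex, so the point lies on a bottom face.
  Either way the comparison is between surfaces.\<close>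

lemma hgt_cube_surf:
  assumes m: "1 \<le> m" "m < len" and t: "cb t" and k: "k < len" "cpt m t \<in> surf k"
  shows "hgt (m-1) (planar (cpt m t)) + lam n (fd m) t = hgt k (planar (cpt m t))"
proof (cases "m \<le> k")
  case True
  have "cpt m t (cv m {}) = 0"
    using surf_support[OF k(2)] bot_vertex_dead[OF m(1) True k(1)] by blast
  then have "\<exists>a\<in>axes. t a = 1" using cpt_at_vertex[OF m, of "{}" t] cube_weight_zero(1)[of t] by simp
  then have u: "ulam n (fd m) t = 0" using lam_zero_iff(2)[OF m t] by blast
  show ?thesis using cpt_top[OF m t u] hgt_surf_surf[OF True k(1) _ k(2)] by simp
next
  case False
  have "cpt m t (cv m {0,1,2}) = 0"
    using surf_support[OF k(2)] verts_at_Inr[of m k] False by (metis cv_simps(1))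
  then have "\<exists>a\<in>axes. t a = 0" using cpt_at_vertex[OF m, of "{0,1,2}" t] cube_weight_zero(2)[of t] by simp
  then have l: "lam n (fd m) t = 0" using lam_zero_iff(1)[OF m t] by blast
  have "k \<le> m - 1" "m - 1 < len" using False m by auto
  then show ?thesis using hgt_surf_surf[OF _ _ k(2) cpt_bottom[OF m t l]] l by simp
qed

text \<open>The later cube does not contain the bottom vertex of the earlier one, so the point lies
  on a top face of the earlier cube, that is, on a surface.\<close>

lemma hgt_cube_cube:
  assumes m: "1 \<le> m" "m < len" and t: "cb t" and k: "1 \<le> k" "k < len" and s: "cb s"
    and eq: "cpt m t = cpt k s" and mk: "m < k"
  shows "hgt (m-1) (planar (cpt m t)) + lam n (fd m) t = hgt (k-1) (planar (cpt m t)) + lam n (fd k) s"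
proof -
  have "cpt k s (cv m {}) = 0"
  proof (rule ccontr)
    assume "cpt k s (cv m {}) \<noteq> 0"
    then obtain B where B: "B \<subseteq> axes" "cv m {} = cv k B" by (rule cpt_support)
    show False
    proof (cases "B = {0,1,2}")
      case True
      then have "kname n Ts (m-1) (fpos n (fd m) {}) = Inr k" using B(2) by (simp add: cv_simps neq_012)
      then show False using kname_Inr mk by fastforce
    next
      case False
      then have "cv m {} \<in> verts_at (k-1)" using cv_kappa0(2)[OF k B(1)] B(2) by simp
      then show False using bot_vertex_dead[OF m(1), of "k-1"] mk k by simp
    qed
  qed
  then have "\<exists>a\<in>axes. t a = 1" using cpt_at_vertex[OF m, of "{}" t] cube_weight_zero(1)[of t] eq by simp
  then have u: "ulam n (fd m) t = 0" using lam_zero_iff(2)[OF m t] by blast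
  have "cpt k s \<in> surf m" using cpt_top(1)[OF m t u] eq by simp
  from hgt_cube_surf[OF k s m(2) this] cpt_top(2)[OF m t u] eq show ?thesis by simp
qed

lemma has_hgt_cases:
  assumes "has_hgt f h"
  obtains (cube) m t where "1 \<le> m" "m < len" "cb t" "f = cpt m t"
      "h = hgt (m-1) (planar f) + lam n (fd m) t"
    | (surf) m where "m < len" "f \<in> surf m" "h = hgt m (planar f)"
  using assms unfolding has_hgt_def by blast

lemma has_hgt_unique:
  assumes f: "has_hgt f h" and f': "has_hgt f h'"
  shows "h = h'"
  using f
proof (cases rule: has_hgt_cases)
  case (cube m t)
  note 1 = cube
  from f' show ?thesis
  proof (cases rule: has_hgt_cases)
    case (cube k s)
    consider "m < k" | "k < m" | "k = m" by linarith
    then show ?thesis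
    proof cases
      case 1
      then show ?thesis using hgt_cube_cube[OF \<open>1 \<le> m\<close> \<open>m < len\<close> \<open>cb t\<close> cube(1-3)]
          \<open>f = cpt m t\<close> cube(4,5) \<open>h = _\<close> by simp
    next
      case 2
      then show ?thesis using hgt_cube_cube[OF cube(1-3) \<open>1 \<le> m\<close> \<open>m < len\<close> \<open>cb t\<close>]
          \<open>f = cpt m t\<close> cube(4,5) \<open>h = _\<close> by simp
    next
      case 3
      have "lam n (fd m) t = lam n (fd m) s"
        using lam_tco[OF \<open>1 \<le> m\<close> \<open>m < len\<close>, of t] lam_tco[OF \<open>1 \<le> m\<close> \<open>m < len\<close>, of s]
          \<open>f = cpt m t\<close> cube(4) 3 by simp
      then show ?thesis using 3 cube(5) \<open>h = _\<close> by simp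
    qed
  next
    case (surf k)
    note eq = 1(4)[symmetric]
    show ?thesis unfolding 1(5) surf(3)
      by (rule hgt_cube_surf[OF 1(1-3) surf(1), unfolded eq, OF surf(2)])
  qed
next
  case (surf m)
  note 1 = surf
  from f' show ?thesis
  proof (cases rule: has_hgt_cases)
    case (cube k s)
    note eq = cube(4)[symmetric]
    show ?thesis unfolding 1(3) cube(5)
      by (rule hgt_cube_surf[OF cube(1-3) 1(1), unfolded eq, OF 1(2), symmetric])
  next
    case (surf k)
    show ?thesis
    proof (cases "k \<le> m")
      case True
      show ?thesis unfolding 1(3) surf(3) by (rule hgt_surf_surf[OF True 1(1) surf(2) 1(2), symmetric])
    next
      case False
      then have "m \<le> k" by simp
      show ?thesis unfolding 1(3) surf(3) by (rule hgt_surf_surf[OF \<open>m \<le> k\<close> surf(1) 1(2) surf(2)])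
    qed
  qed
qed

section \<open>Position and height determine the point\<close>

lemma surf_surf_inj:
  assumes "k \<le> m" "m < len" "f \<in> surf k" "g \<in> surf m" "planar f = planar g"
    "hgt k (planar f) = hgt m (planar f)"
  shows "f = g"
proof -
  have "f \<in> surf m" using surf_chain[OF assms(1-3)] assms(6) by simp
  then show ?thesis using surf_unique[OF assms(2)] assms(4,5) by blast
qed

text \<open>Monotonicity of \<open>hgt\<close> pinches the cube point onto the top or the bottom of
  its cube, which again leaves two surfaces to compare.\<close>

lemma cube_surf_inj:
  assumes m: "1 \<le> m" "m < len" and t: "cb t" and k: "k < len" "g \<in> surf k"
    and P: "planar (cpt m t) = planar g"
    and h: "hgt (m-1) (planar g) + lam n (fd m) t = hgt k (planar g)"
  shows "cpt m t = g"
proof (cases "m \<le> k")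
  case True
  have "hgt m (planar g) \<le> hgt k (planar g)" by (rule hgt_mono[OF True])
  then have u: "ulam n (fd m) t = 0" using cpt_bounds[OF m t] h P by simp
  show ?thesis using surf_surf_inj[OF True k(1) cpt_top(1)[OF m t u] k(2) P] cpt_top(2)[OF m t u] h P by simp
next
  case False
  then have k': "k \<le> m - 1" "m - 1 < len" using m by auto
  have "hgt k (planar g) \<le> hgt (m-1) (planar g)" by (rule hgt_mono[OF k'(1)])
  then have l: "lam n (fd m) t = 0" using cpt_bounds[OF m t] h by simp
  show ?thesis using surf_surf_inj[OF k' k(2) cpt_bottom[OF m t l] P[symmetric]] h l by simp
qed

lemma cube_cube_inj:
  assumes m: "1 \<le> m" "m < len" and t: "cb t" and k: "1 \<le> k" "k < len" and s: "cb s" and mk: "m < k"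
    and P: "planar (cpt m t) = planar (cpt k s)"
    and h: "hgt (m-1) (planar (cpt m t)) + lam n (fd m) t = hgt (k-1) (planar (cpt m t)) + lam n (fd k) s"
  shows "cpt m t = cpt k s"
proof -
  have "hgt m (planar (cpt m t)) \<le> hgt (k-1) (planar (cpt m t))"
    using mk by (intro hgt_mono) simp
  then have u: "ulam n (fd m) t = 0" using cpt_bounds[OF m t] cpt_bounds(1)[OF k s] h by simp
  have "cpt k s = cpt m t"
    using cube_surf_inj[OF k s m(2) cpt_top(1)[OF m t u] P[symmetric]] cpt_top(2)[OF m t u] h by simp
  then show ?thesis by simp
qed

lemma has_hgt_inj:
  assumes f: "has_hgt f h" and g: "has_hgt g h" and P: "planar f = planar g"
  shows "f = g"
  using f
proof (cases rule: has_hgt_cases)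
  case (cube m t)
  note 1 = cube
  from g show ?thesis
  proof (cases rule: has_hgt_cases)
    case (cube k s)
    note 2 = cube
    consider "m < k" | "k < m" | "k = m" by linarith
    then show ?thesis
    proof cases
      case a: 1
      show ?thesis unfolding 1(4) 2(4)
        by (rule cube_cube_inj[OF 1(1-3) 2(1-3) a]) (use 1(4,5) 2(4,5) P in \<open>simp_all only:\<close>)
    next
      case a: 2
      have "cpt k s = cpt m t"
        by (rule cube_cube_inj[OF 2(1-3) 1(1-3) a]) (use 1(4,5) 2(4,5) P in \<open>simp_all only:\<close>)
      then show ?thesis unfolding 1(4) 2(4) by simp
    next
      case a: 3
      have h: "lam n (fd m) t = lam n (fd m) s" using 1(5) 2(5) P unfolding a by simp
      have P': "planar (cpt m t) = planar (cpt m s)" using 1(4) 2(4) P a by simp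
      show ?thesis unfolding 1(4) 2(4) a by (rule cpt_lam_eq[OF 1(1-3) 2(3) P' h])
    qed
  next
    case (surf k)
    show ?thesis unfolding 1(4)
      by (rule cube_surf_inj[OF 1(1-3) surf(1,2)])
        (use 1(4,5) surf(3) P in \<open>simp_all only:\<close>)
  qed
next
  case (surf m)
  note 1 = surf
  from g show ?thesis
  proof (cases rule: has_hgt_cases)
    case (cube k s)
    have "cpt k s = f"
      by (rule cube_surf_inj[OF cube(1-3) 1(1,2)])
        (use cube(4,5) 1(3) P in \<open>simp_all only:\<close>)
    then show ?thesis using cube(4) by simp
  next
    case (surf k)
    show ?thesis
    proof (cases "k \<le> m")
      case True
      have "g = f"
        by (rule surf_surf_inj[OF True 1(1) surf(2) 1(2)]) (use 1(3) surf(3) P in \<open>simp_all only:\<close>)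
      then show ?thesis by simp
    next
      case False
      then have "m \<le> k" by simp
      then show ?thesis
        by (rule surf_surf_inj[OF _ surf(1) 1(2) surf(2)]) (use 1(3) surf(3) P in \<open>simp_all only:\<close>)
    qed
  qed
qed

section \<open>The range of the height\<close>

lemma has_hgt_bounds:
  assumes "has_hgt f h"
  shows "0 \<le> h" "h \<le> hgt (len - 1) (planar f)"
proof -
  have nn: "0 \<le> hgt m p" for m p unfolding hgt_def by (intro sum_nonneg) (rule flen_nonneg)
  have mono: "hgt m p \<le> hgt (len - 1) p" if "m < len" for m p
    using that by (intro hgt_mono) simp
  have "0 \<le> h \<and> h \<le> hgt (len - 1) (planar f)"
    using assms
  proof (cases rule: has_hgt_cases)
    case (cube m t)
    show ?thesis using cpt_bounds[OF cube(1-3)] cube(4,5) mono[OF cube(2)] nn[of "m-1"] by (smt (verit))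
  next
    case (surf m)
    then show ?thesis using nn mono by simp
  qed
  then show "0 \<le> h" "h \<le> hgt (len - 1) (planar f)" by auto
qed

lemma has_hgt_exists:
  assumes p: "p \<in> Pn n" and h: "0 \<le> h" "h \<le> hgt (len - 1) p"
  shows "\<exists>f. has_hgt f h \<and> planar f = p"
proof -
  \<comment> \<open>The first surface whose height over \<open>p\<close> reaches \<open>h\<close>.
    For \<open>m = 0\<close> this forces \<open>h = 0\<close>; otherwise the point sought lies in
    the cube of flip \<open>m\<close>.\<close>
  define m where "m = (LEAST m. h \<le> hgt m p)"
  have hm: "h \<le> hgt m p" unfolding m_def using h(2) by (rule LeastI)
  have "m \<le> len - 1" unfolding m_def using h(2) by (rule Least_le)
  then have mL: "m < len" using nonempty by arith
  show ?thesis
  proof (cases "m = 0")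
    case True
    then have h0: "h = 0" using hm h(1) by (simp add: hgt_def)
    obtain i j t where \<tau>: "(i,j,t) \<in> Ts ! 0" "p \<in> rhomb n (i,j,t)"
      using p tiling_cover[OF tiling[OF nonempty]] by (metis UN_E prod_cases3)
    then obtain a b where ab: "p = t + of_real a * ee n i + of_real b * ee n j" "0 \<le> a" "a \<le> 1" "0 \<le> b" "b \<le> 1"
      unfolding rhomb_eq by blast
    let ?f = "bil (tile_face n Ts 0 (i,j,t)) a b"
    have "?f \<in> face_cell (tile_face n Ts 0 (i,j,t))" unfolding face_cell_bil using ab(2-5) by blast
    then have "?f \<in> surf 0" unfolding surf_def faces_at_def by (intro UN_I[OF imageI[OF \<tau>(1)]])
    moreover have "planar ?f = p" using planar_bil[OF nonempty \<tau>(1)] ab(1) by simp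
    ultimately show ?thesis using h0 nonempty unfolding has_hgt_def by (intro exI[of _ ?f]) (auto simp: hgt_def)
  next
    case False
    then have m: "1 \<le> m" by simp
    note v = valid[OF m mL]
    have lo: "hgt (m-1) p < h" using not_less_Least[of "m-1" "\<lambda>m. h \<le> hgt m p"] False
      unfolding m_def[symmetric] by simp
    let ?x = "h - hgt (m-1) p"
    have fl: "?x \<le> flen n (fd m) p" using hm hgt_step[OF m] by simp
    let ?s = "sect n (fd m) p"
    \<comment> \<open>Slide the section along its fibre until the distance from the lower end is the
      missing height \<open>?x\<close>.\<close>
    define t where "t = (\<lambda>a. ?s a + (?x - lam n (fd m) ?s) * dcoef n (fd m) a)"
    have l: "lam n (fd m) t = ?x" using lam_shift[OF v, of t ?s "?x - lam n (fd m) ?s"] by (simp add: t_def)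
    have u: "ulam n (fd m) t = ulam n (fd m) ?s + lam n (fd m) ?s - ?x"
      using ulam_shift[OF v, of t ?s "?x - lam n (fd m) ?s"] by (simp add: t_def)
    have "flen n (fd m) p > 0" using fl lo by simp
    then have "flen n (fd m) p = lam n (fd m) ?s + ulam n (fd m) ?s" unfolding flen_def by (simp add: max_def split: if_splits)
    then have cb: "cb t" using cube_iff[OF v] l u fl lo by simp
    have "planar (cpt m t) = p" unfolding planar_cpt[OF m mL] t_def qpt_shift qpt_sect[OF v] ..
    moreover from this have "has_hgt (cpt m t) h" unfolding has_hgt_def
      using m mL cb l by (intro disjI1 exI[of _ m] exI[of _ t]) simp
    ultimately show ?thesis by blast
  qed
qed

lemma vpt_surf:
  assumes "m < len" "v \<in> verts_at m"
  shows "vpt v \<in> surf m" "planar (vpt v) = kpos v"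
proof -
  obtain p where p: "v = kname n Ts m p" "p \<in> tiling_verts n (Ts ! m)" using assms(2) unfolding verts_at_def by blast
  then obtain i j t where \<tau>: "(i,j,t) \<in> Ts ! m" "p \<in> set (corners n (i,j,t))"
    unfolding tiling_verts_def by (metis UN_E prod_cases3)
  obtain a b :: real where ab: "a \<in> {0,1}" "b \<in> {0,1}" "p = t + of_real a * ee n i + of_real b * ee n j"
    using \<tau>(2) by (rule corner_coord)
  have e: "bil (tile_face n Ts m (i,j,t)) a b = vpt v" using bil_corner[OF \<tau>(1) assms(1) \<tau>(2) ab(3)] p(1) by simp
  have "vpt v \<in> face_cell (tile_face n Ts m (i,j,t))" unfolding face_cell_bil using ab(1,2) e[symmetric]
    by (intro CollectI exI[of _ a] exI[of _ b]) auto
  then show "vpt v \<in> surf m" unfolding surf_def faces_at_def by (intro UN_I[OF imageI[OF \<tau>(1)]])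
  show "planar (vpt v) = kpos v"
    using planar_bil[OF assms(1) \<tau>(1), of a b] unfolding e by (simp add: p(1) ab(3))
qed

end

subsection \<open>Interior vertices\<close>

lemma compact_imp_closed_fun:
  fixes S :: "('a \<Rightarrow> real) set"
  assumes "compact S"
  shows "closed S"
proof -
  have "Hausdorff_space (product_topology (\<lambda>i::'a. euclidean :: real topology) UNIV)"
    by (simp add: Hausdorff_space_product_topology)
  then have "Hausdorff_space (euclidean :: ('a \<Rightarrow> real) topology)"
    by (simp only: euclidean_product_topology)
  moreover have "compactin euclidean S" using assms by (simp only: compactin_euclidean_iff)
  ultimately show ?thesis unfolding closed_closedin by (rule compactin_imp_closedin)
qed

lemma continuous_on_coord: "continuous_on S (\<lambda>f. (f :: 'a \<Rightarrow> real) u)"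
  using continuous_on_product_then_coordinatewise[OF continuous_on_id] .

lemma vertical_in_ball:
  fixes q :: "complex \<times> real"
  assumes "\<bar>s\<bar> < e"
  shows "(fst q, snd q + s) \<in> ball q e"
  using assms by (cases q) (simp add: dist_Pair_Pair dist_real_def)

lemma compact_face_cell: "compact (face_cell s)"
proof -
  have "face_cell s = (\<lambda>(a,b). bil s a b) ` ({0..1} \<times> {0..1})"
    unfolding face_cell_bil by (auto simp: image_iff) (metis+)
  moreover have "continuous_on ({0..1} \<times> {0..1}) (\<lambda>(a,b). bil s a b)"
  proof (rule continuous_on_coordinatewise_then_product)
    fix u
    have if_cont: "continuous_on S (\<lambda>x. if P then f x else 0)" if "continuous_on S f"
      for S :: "(real \<times> real) set" and f :: "_ \<Rightarrow> real" and P using that by (cases P) auto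
    show "continuous_on ({0..1} \<times> {0..1}) (\<lambda>x. (case x of (a,b) \<Rightarrow> bil s a b) u)"
      unfolding bil_def case_prod_unfold by (intro continuous_intros if_cont)
  qed
  ultimately show ?thesis by (auto intro!: compact_continuous_image compact_Times)
qed

context pile
begin

lemma compact_cube_cell: "compact (cube_cell n Ts m)"
proof -
  let ?t = "\<lambda>x y z (a::nat). if a = 0 then x else if a = 1 then y else (z::real)"
  let ?F = "\<lambda>p. cpt m (?t (fst p) (fst (snd p)) (snd (snd p)))"
  have "cube_cell n Ts m = ?F ` ({0..1} \<times> {0..1} \<times> {0..1})"
  proof (intro equalityI subsetI)
    fix f assume "f \<in> cube_cell n Ts m"
    then obtain t where t: "f = cpt m t" "cb t" unfolding cube_cell_cpt by blast
    have "cube_weight t = cube_weight (?t (t 0) (t 1) (t 2))" by (intro ext) (simp add: cube_weight_alt)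
    then have "cpt m t = cpt m (?t (t 0) (t 1) (t 2))" unfolding cpt_def by (rule arg_cong)
    then have "f = ?F (t 0, t 1, t 2)" unfolding t(1) fst_conv snd_conv .
    then show "f \<in> ?F ` ({0..1} \<times> {0..1} \<times> {0..1})" using t(2) by (intro image_eqI[of _ _ "(t 0, t 1, t 2)"]) auto
  next
    fix f assume "f \<in> ?F ` ({0..1} \<times> {0..1} \<times> {0..1})"
    then obtain x y z where "f = ?F (x,y,z)" "0 \<le> x" "x \<le> 1" "0 \<le> y" "y \<le> 1" "0 \<le> z" "z \<le> 1" by auto
    then show "f \<in> cube_cell n Ts m" unfolding cube_cell_cpt
      by (intro CollectI exI[of _ "?t x y z"]) (simp cong: if_cong)
  qed
  moreover have "continuous_on ({0..1} \<times> {0..1} \<times> {0..1}) ?F"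
  proof (rule continuous_on_coordinatewise_then_product)
    fix u
    have if_cont: "continuous_on S (\<lambda>x. if P then f x else g x)" if "continuous_on S f" "continuous_on S g"
      for S :: "(real \<times> real \<times> real) set" and f g :: "_ \<Rightarrow> real" and P using that by (cases P) auto
    show "continuous_on ({0..1} \<times> {0..1} \<times> {0..1}) (\<lambda>p. ?F p u)"
      unfolding cpt_def cube_weight_alt by (intro continuous_intros if_cont)
  qed
  ultimately show ?thesis by (auto intro!: compact_continuous_image compact_Times)
qed

abbreviation "K \<equiv> realization n Ts"

lemma realization_iff: "f \<in> K \<longleftrightarrow> (\<exists>h. has_hgt f h)"
proof -
  have "f \<in> K \<longleftrightarrow> (\<exists>m\<in>{1..<len}. f \<in> cube_cell n Ts m) \<or> (\<exists>m<len. f \<in> surf m)"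
    unfolding realization_def kcubes_def kappa2_faces surf_def by blast
  also have "\<dots> \<longleftrightarrow> (\<exists>h. has_hgt f h)"
  proof
    assume "\<exists>h. has_hgt f h"
    then obtain h where "has_hgt f h" by blast
    then show "(\<exists>m\<in>{1..<len}. f \<in> cube_cell n Ts m) \<or> (\<exists>m<len. f \<in> surf m)"
    proof (cases rule: has_hgt_cases)
      case (cube m t)
      then have "m \<in> {1..<len}" "f \<in> cube_cell n Ts m" unfolding cube_cell_cpt by (simp, blast)
      then show ?thesis by blast
    qed blast
  next
    assume "(\<exists>m\<in>{1..<len}. f \<in> cube_cell n Ts m) \<or> (\<exists>m<len. f \<in> surf m)"
    then show "\<exists>h. has_hgt f h"
    proof
      assume "\<exists>m\<in>{1..<len}. f \<in> cube_cell n Ts m"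
      then obtain m t where "1 \<le> m" "m < len" "cb t" "f = cpt m t" unfolding cube_cell_cpt by fastforce
      then have "has_hgt f (hgt (m-1) (planar f) + lam n (fd m) t)" unfolding has_hgt_def by blast
      then show ?thesis by blast
    next
      assume "\<exists>m<len. f \<in> surf m"
      then show ?thesis unfolding has_hgt_def by blast
    qed
  qed
  finally show ?thesis .
qed

definition hfun :: "(kvert \<Rightarrow> real) \<Rightarrow> real" where
  "hfun f = (THE h. has_hgt f h)"

lemma hfun_eq: "has_hgt f h \<Longrightarrow> hfun f = h"
  unfolding hfun_def using has_hgt_unique by blast

lemma has_hgt_hfun: "f \<in> K \<Longrightarrow> has_hgt f (hfun f)"
  using hfun_eq realization_iff by metis

lemma continuous_planar: "continuous_on S (planar)"
  unfolding planar_def by (intro continuous_intros continuous_on_coord)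

lemma continuous_hgt:
  assumes "m < len"
  shows "continuous_on S (hgt m)"
  unfolding hgt_def by (intro continuous_on_sum continuous_on_flen valid) (use assms in auto)

lemma continuous_hgt_planar:
  assumes "m < len"
  shows "continuous_on S (\<lambda>f. hgt m (planar f))"
  by (rule continuous_on_compose2[OF continuous_hgt[OF assms, of UNIV] continuous_planar]) simp

text \<open>There are finitely many cells, they are compact, hence closed, and on each of them the
  height has an explicit continuous formula; these formulas are pasted.\<close>

lemma continuous_hfun: "continuous_on K hfun"
proof -
  have c1: "continuous_on (cube_cell n Ts m) hfun" if "m \<in> {1..<len}" for m
  proof -
    from that have m: "1 \<le> m" "m < len" "m - 1 < len" by auto
    have "continuous_on (cube_cell n Ts m) (\<lambda>f. hgt (m-1) (planar f) + lam n (fd m) (\<lambda>a. tco m a f))"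
      unfolding lam_def tco_def using dcoef_pos[OF valid[OF m(1,2)]]
      by (intro continuous_intros continuous_hgt_planar m continuous_on_coord) (auto simp: less_imp_neq[THEN not_sym])
    moreover have "hfun f = hgt (m-1) (planar f) + lam n (fd m) (\<lambda>a. tco m a f)" if "f \<in> cube_cell n Ts m" for f
    proof -
      from that obtain t where t: "f = cpt m t" "cb t" unfolding cube_cell_cpt by blast
      have "has_hgt f (hgt (m-1) (planar f) + lam n (fd m) t)"
        unfolding has_hgt_def using t m by blast
      then show ?thesis using hfun_eq lam_tco[OF m(1,2), of t] t(1) by simp
    qed
    ultimately show ?thesis by (simp cong: continuous_on_cong)
  qed
  have c2: "continuous_on (face_cell s) hfun" if "s \<in> kappa2 n Ts" for s
  proof -
    from that obtain m where m: "m < len" "s \<in> faces_at m" unfolding kappa2_faces by blast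
    have "hfun f = hgt m (planar f)" if "f \<in> face_cell s" for f
    proof (rule hfun_eq)
      have "f \<in> surf m" using that m(2) unfolding surf_def by blast
      then show "has_hgt f (hgt m (planar f))" unfolding has_hgt_def using m(1) by blast
    qed
    then show ?thesis using continuous_hgt_planar[OF m(1), of "face_cell s"] by (simp cong: continuous_on_cong)
  qed
  have fin: "finite (kappa2 n Ts)" unfolding kappa2_faces using finite_faces by auto
  have "continuous_on (\<Union>m\<in>kcubes Ts. cube_cell n Ts m) hfun"
    by (rule continuous_on_closed_Union) (use c1 in \<open>auto simp: kcubes_def compact_imp_closed_fun compact_cube_cell\<close>)
  moreover have "continuous_on (\<Union>s\<in>kappa2 n Ts. face_cell s) hfun"
    by (rule continuous_on_closed_Union) (use c2 fin in \<open>auto simp: compact_imp_closed_fun compact_face_cell\<close>)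
  moreover have "closed (\<Union>m\<in>kcubes Ts. cube_cell n Ts m)" "closed (\<Union>s\<in>kappa2 n Ts. face_cell s)"
    using fin by (auto intro!: closed_UN simp: kcubes_def compact_imp_closed_fun compact_cube_cell compact_face_cell)
  ultimately show ?thesis unfolding realization_def by (intro continuous_on_closed_Un)
qed

lemma compact_K: "compact K"
proof -
  have "finite (kappa2 n Ts)" unfolding kappa2_faces using finite_faces by auto
  then show ?thesis unfolding realization_def kcubes_def
    by (intro compact_Un compact_UN) (auto simp: compact_cube_cell compact_face_cell)
qed

definition emb :: "(kvert \<Rightarrow> real) \<Rightarrow> complex \<times> real" where
  "emb f = (planar f, hfun f)"

lemma continuous_emb: "continuous_on K emb"
  unfolding emb_def by (intro continuous_on_Pair continuous_planar continuous_hfun)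

lemma inj_emb: "inj_on emb K"
proof (rule inj_onI)
  fix f g assume fg: "f \<in> K" "g \<in> K" "emb f = emb g"
  then have "planar f = planar g" "hfun f = hfun g" by (simp_all add: emb_def)
  then show "f = g" using has_hgt_inj[OF has_hgt_hfun[OF fg(1)]] has_hgt_hfun[OF fg(2)] by metis
qed

lemma vpt_K:
  assumes "m < len" "v \<in> verts_at m"
  shows "vpt v \<in> K" "emb (vpt v) = (kpos v, hgt m (kpos v))"
proof -
  have h: "has_hgt (vpt v) (hgt m (kpos v))"
    unfolding has_hgt_def using vpt_surf[OF assms] assms(1) by auto
  then show "vpt v \<in> K" using realization_iff by blast
  show "emb (vpt v) = (kpos v, hgt m (kpos v))"
    unfolding emb_def using hfun_eq[OF h] vpt_surf(2)[OF assms] by simp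
qed

text \<open>Invariance of domain: near an interior vertex the embedding covers points both above
  and below, but the bottom and top tilings are the extreme levels of the image.\<close>

lemma interior_vertex_imp:
  assumes "interior_vertex n Ts v"
  shows "v \<notin> verts_at 0" "v \<notin> verts_at (len - 1)"
proof -
  obtain U c r where U: "openin (top_of_set K) U" "vpt v \<in> U" "U homeomorphic ball (c::real^3) r"
    using assms unfolding interior_vertex_def by blast
  have UK: "U \<subseteq> K" using U(1) by (simp add: openin_imp_subset)
  obtain \<phi> \<psi> where hom: "homeomorphism (ball c r) U \<phi> \<psi>"
    using U(3) homeomorphic_sym unfolding homeomorphic_def by blast
  have \<phi>: "continuous_on (ball c r) \<phi>" "\<phi> ` ball c r = U" "inj_on \<phi> (ball c r)"
    using hom unfolding homeomorphism_def by (auto intro: inj_on_inverseI)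
  have "open ((emb \<circ> \<phi>) ` ball c r)"
  proof (rule invariance_of_domain_gen)
    show "continuous_on (ball c r) (emb \<circ> \<phi>)"
      using \<phi> UK by (intro continuous_on_compose) (auto intro: continuous_on_subset[OF continuous_emb])
    show "inj_on (emb \<circ> \<phi>) (ball c r)"
      using \<phi> UK inj_emb by (intro comp_inj_on) (auto intro: inj_on_subset)
  qed simp_all
  then have "open (emb ` U)" unfolding image_comp[symmetric] \<phi>(2) .
  moreover have "emb (vpt v) \<in> emb ` U" using U(2) by blast
  ultimately obtain e where e: "e > 0" "ball (emb (vpt v)) e \<subseteq> emb ` U" by (meson openE)
  have near: "\<exists>f\<in>K. emb f = (fst (emb (vpt v)), snd (emb (vpt v)) + s)" if "\<bar>s\<bar> < e" for s
  proof -
    have "(fst (emb (vpt v)), snd (emb (vpt v)) + s) \<in> emb ` U"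
      using e(2) vertical_in_ball[OF that] by (rule subsetD)
    then obtain f where "f \<in> U" "emb f = (fst (emb (vpt v)), snd (emb (vpt v)) + s)" by (metis imageE)
    then show ?thesis using UK by blast
  qed
  show "v \<notin> verts_at 0"
  proof
    assume "v \<in> verts_at 0"
    then have "emb (vpt v) = (kpos v, 0)" using vpt_K(2)[OF nonempty] by (simp add: hgt_def)
    with near[of "-(e/2)"] e(1) obtain f where "f \<in> K" "hfun f = -(e/2)" by (auto simp: emb_def)
    then show False using has_hgt_bounds(1)[OF has_hgt_hfun] e(1) by fastforce
  qed
  show "v \<notin> verts_at (len - 1)"
  proof
    assume "v \<in> verts_at (len - 1)"
    then have "emb (vpt v) = (kpos v, hgt (len - 1) (kpos v))" using vpt_K(2) nonempty by simp
    with near[of "e/2"] e(1) obtain f where f: "f \<in> K" "planar f = kpos v"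
       "hfun f = hgt (len - 1) (kpos v) + e/2" by (auto simp: emb_def)
    then show False using has_hgt_bounds(2)[OF has_hgt_hfun[OF f(1)]] e(1) by simp
  qed
qed

text \<open>The fibre of cube \<open>m\<close> puts the vertex strictly below the last surface, and
  the fibre of the cube that created it puts it strictly above the first. A ball around its image is
  then filled by the complex and pulls back along the embedding, a homeomorphism by
  compactness.\<close>

lemma interior_vertexI:
  assumes m: "1 \<le> m" "m < len" and v0: "cv m {} \<notin> verts_at 0"
  shows "interior_vertex n Ts (cv m {})"
proof -
  let ?v = "cv m {}" and ?L = "len - 1"
  let ?p = "kpos ?v"
  have vm: "?v \<in> verts_at (m-1)" using cv_kappa0(2)[OF m empty_subsetI] neq_012(1) by simp
  have m1: "m - 1 < len" using m by simp
  have e: "emb (vpt ?v) = (?p, hgt (m-1) ?p)" using vpt_K(2)[OF m1 vm] .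
  have fm: "flen n (fd m) ?p > 0" unfolding kpos_cv
    using flen_center_pos[OF valid[OF m], of False] by (simp add: center_def)
  have up: "hgt (m-1) ?p < hgt ?L ?p"
  proof -
    have "hgt (m-1) ?p < hgt m ?p" using hgt_step[OF m(1)] fm by simp
    also have "\<dots> \<le> hgt ?L ?p" using m by (intro hgt_mono) simp
    finally show ?thesis .
  qed
  have pint: "?p \<in> interior (Pn n)"
    using center_interior_Pn[OF tiling[OF m1] valid[OF m] bot_tiles[OF m]] fm by blast
  have down: "0 < hgt (m-1) ?p"
  proof (cases ?v)
    case (Inl p)
    \<comment> \<open>A vertex named by \<open>Inl\<close> was created by no flip; followed back in
      time it reaches the initial tiling.\<close>
    have "?v \<in> verts_at k \<Longrightarrow> k < len \<Longrightarrow> ?v \<in> verts_at 0" for k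
    proof (induction k)
      case (Suc k)
      then show ?case using verts_step[of "Suc k"] Inl by auto
    qed
    then show ?thesis using vm m1 v0 by blast
  next
    case (Inr k)
    have k: "1 \<le> k" "k \<le> m - 1" using verts_at_Inr[of k "m-1"] vm Inr by auto
    then have kL: "k < len" using m by simp
    have "?v = cv k {0,1,2}" using Inr by (simp add: cv_simps)
    then have "?p = fpos n (fd k) (center True)" by (simp add: kpos_cv center_def)
    then have "flen n (fd k) ?p > 0" using flen_center_pos[OF valid[OF k(1) kL], of True] by simp
    moreover have "flen n (fd k) ?p \<le> hgt (m-1) ?p"
      unfolding hgt_def using k by (intro member_le_sum) (auto simp: flen_nonneg)
    ultimately show ?thesis by simp
  qed
  \<comment> \<open>The strict inequalities cut out an open set, and \<open>has_hgt_exists\<close>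
    shows that the embedding covers all of it.\<close>
  let ?W = "{q. fst q \<in> interior (Pn n) \<and> 0 < snd q \<and> snd q < hgt ?L (fst q)}"
  have LL: "?L < len" using nonempty by simp
  have ch: "continuous_on UNIV (\<lambda>q. hgt ?L (fst q))"
    by (rule continuous_on_compose2[OF continuous_hgt[OF LL, of UNIV]]) (auto intro: continuous_intros)
  have "?W = (fst -` interior (Pn n)) \<inter> {q. 0 < snd q} \<inter> {q. snd q < hgt ?L (fst q)}" by auto
  then have "open ?W"
    by (simp only:) (intro open_Int open_vimage_fst open_interior open_Collect_less continuous_intros ch)
  moreover have "emb (vpt ?v) \<in> ?W" using e up down pint by simp
  ultimately obtain r where r: "r > 0" "ball (emb (vpt ?v)) r \<subseteq> ?W" by (meson openE)
  let ?B = "ball (emb (vpt ?v)) r"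
  have W: "?W \<subseteq> emb ` K"
  proof
    fix q assume q: "q \<in> ?W"
    then have "fst q \<in> Pn n" "0 \<le> snd q" "snd q \<le> hgt ?L (fst q)" using interior_subset by auto
    then obtain f where f: "has_hgt f (snd q)" "planar f = fst q" using has_hgt_exists by blast
    then have "f \<in> K" "emb f = q" using realization_iff hfun_eq[OF f(1)] by (auto simp: emb_def)
    then show "q \<in> emb ` K" by blast
  qed
  obtain g where g: "homeomorphism K (emb ` K) emb g"
    using homeomorphism_compact[OF compact_K continuous_emb refl inj_emb] by blast
  let ?U = "K \<inter> emb -` ?B"
  have vU: "vpt ?v \<in> ?U" using vpt_K(1)[OF m1 vm] r(1) by simp
  have oU: "openin (top_of_set K) ?U" by (rule continuous_openin_preimage_gen[OF continuous_emb]) simp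
  have eU: "emb ` ?U = ?B" using r(2) W by blast
  have "homeomorphism ?U ?B emb g"
    by (rule homeomorphism_of_subsets[OF g]) (use eU in auto)
  then have h1: "?U homeomorphic ?B" unfolding homeomorphic_def by blast
  \<comment> \<open>A linear isometry identifies the target of the embedding with
    \<open>real^3\<close>.\<close>
  have h2: "?B homeomorphic ball (0::real^3) r"
  proof -
    have "DIM(complex \<times> real) = DIM(real^3)" by simp
    then obtain F :: "complex \<times> real \<Rightarrow> real^3" and G where FG: "linear F" "linear G"
       "\<And>x. norm (F x) = norm x" "\<And>y. norm (G y) = norm y" "\<And>x. G (F x) = x" "\<And>y. F (G y) = y"
      by (rule isomorphisms_UNIV_UNIV) blast
    have cF: "continuous_on S F" "continuous_on S' G" for S S'
      using FG(1,2) by (auto simp: linear_continuous_on linear_linear)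
    have "F ` ball 0 r = ball 0 r"
    proof (intro equalityI subsetI)
      fix y :: "real^3" assume "y \<in> ball 0 r"
      then show "y \<in> F ` ball 0 r" using FG(4,6) by (intro image_eqI[of _ _ "G y"]) simp_all
    qed (use FG(3) in auto)
    moreover have "G ` ball 0 r = ball 0 r"
    proof (intro equalityI subsetI)
      fix q :: "complex \<times> real" assume "q \<in> ball 0 r"
      then show "q \<in> G ` ball 0 r" using FG(3,5)[of q] by (intro image_eqI[of _ _ "F q"]) simp_all
    qed (use FG(4) in auto)
    ultimately have "homeomorphism (ball 0 r) (ball 0 r) F G"
      unfolding homeomorphism_def using FG(5,6) cF by blast
    then have "ball (0::complex \<times> real) r homeomorphic ball (0::real^3) r" unfolding homeomorphic_def by blast
    then show ?thesis using homeomorphic_balls(1)[OF r(1) r(1)] homeomorphic_trans by blast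
  qed
  have "?v \<in> kappa0 n Ts" by (rule cv_kappa0(3)[OF m empty_subsetI])
  then show ?thesis unfolding interior_vertex_def using oU vU homeomorphic_trans[OF h1 h2] by blast
qed

end

subsection \<open>Sign bookkeeping along the pile\<close>

lemma khex_alt: "khex n Ts x y \<longleftrightarrow> (\<forall>v\<in>kappa0 n Ts. x v \<noteq> 0) \<and> (\<forall>s\<in>kappa2 n Ts. (y s)^2 = face_sum x s) \<and>
    (\<forall>m\<in>kcubes Ts. khex_cube (\<lambda>B. x (cvert n Ts m B)) (\<lambda>a \<beta>. y (cface n Ts m a \<beta>)))"
  unfolding khex_def khex_cube_def Let_def by (rule refl)

lemma face_term_eq: "v \<in> face_verts s \<Longrightarrow> face_term x v s = face_sum x s"
  by (cases s) (auto simp: face_term_def face_sum_def face_verts_def mult.commute add.commute)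

context pile
begin

abbreviation "lst \<equiv> len - 1"

lemma lst: "lst < len"
  using nonempty by simp

lemma kcubes_iff: "m \<in> kcubes Ts \<longleftrightarrow> 1 \<le> m \<and> m < len"
  by (auto simp: kcubes_def)

lemma cubes_upto_lst: "{m \<in> kcubes Ts. v \<in> cvert n Ts m ` Pow axes} = cubes_upto lst v"
proof -
  have "Suc lst = len" using nonempty by arith
  then have "kcubes Ts = {1..lst}" unfolding kcubes_def by (metis atLeastLessThanSuc_atLeastAtMost)
  then show ?thesis by (simp add: cubes_upto_def)
qed

lemma star_upto_lst: "{s \<in> kappa2 n Ts. v \<in> face_verts s} = star_upto lst v"
proof -
  have "Suc lst = len" using nonempty by arith
  then have "{..<len} = {..lst}" using lessThan_Suc_atMost[of lst] by simp
  then show ?thesis by (simp add: star_upto_def kappa2_faces)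
qed

lemma Kv_at_eq:
  assumes "1 \<le> m" "m < len" "B \<subseteq> axes" "cv m B = v"
  shows "Kv_at n Ts m v x = kvc (\<lambda>B. x (cv m B)) B"
proof -
  have "(SOME B0. B0 \<subseteq> axes \<and> cv m B0 = v) = B"
    using assms(3,4) by (intro some_equality) (auto dest: inj_onD[OF cv_inj[OF assms(1,2)]])
  then show ?thesis by (simp add: Kv_at_def kvc_def)
qed

lemma vertex_born:
  assumes "m < len" "v \<in> verts_at m" "v \<notin> verts_at 0"
  obtains k where "v = Inr k" "1 \<le> k" "k \<le> m"
proof -
  have "v \<in> verts_at 0 \<or> (\<exists>k. v = Inr k)"
    using assms(1,2)
  proof (induction m)
    case (Suc m)
    then show ?case using verts_step[of "Suc m"] by auto
  qed simp
  then obtain k where "v = Inr k" using assms(3) by blast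
  then show ?thesis using that verts_at_Inr assms(2) by blast
qed

text \<open>Every other corner of a bottom face also lies on a top face and survives.\<close>

lemma vertex_dies:
  assumes m: "1 \<le> m" "m < len" and v: "v \<in> verts_at (m-1)" "v \<notin> verts_at m"
  shows "v = cv m {}"
proof -
  obtain s where s: "s \<in> faces_at (m-1)" "v \<in> face_verts s" using v(1) unfolding verts_at_faces by blast
  then have n: "s \<notin> faces_at m" using v(2) unfolding verts_at_faces by blast
  have gen: "s \<in> b" if "s \<in> X" "s \<notin> (X - b) \<union> t" for X b t :: "kface set" using that by blast
  have "s \<in> bface m ` axes" by (rule gen[OF s(1) n[unfolded faces_step[OF m]]])
  then obtain a where a: "a \<in> axes" "s = bface m a" by (rule imageE)
  have "v \<in> cvert n Ts m ` {B. B \<subseteq> axes \<and> (a \<in> B \<longleftrightarrow> False)}"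
    using s(2) unfolding a(2) face_verts_cface[OF m a(1)] .
  then obtain B where "B \<in> {B. B \<subseteq> axes \<and> (a \<in> B \<longleftrightarrow> False)}" "v = cv m B" by (rule imageE)
  then have B: "B \<subseteq> axes" "v = cv m B" by simp_all
  have "B = {}"
  proof (rule ccontr)
    assume "B \<noteq> {}"
    then obtain b where b: "b \<in> B" by blast
    then have b': "b \<in> axes" using B(1) by (rule subsetD[rotated])
    have "v \<in> face_verts (tface m b)" using cv_in_cface[OF m b' B(1)] B(2) b by simp
    then show False using tface_in[OF m b'] v(2) unfolding verts_at_faces by blast
  qed
  then show ?thesis using B(2) by simp
qed

lemma vertex_dies_eventually:
  assumes "k < len" "v \<in> verts_at k" "v \<notin> verts_at lst"
  obtains m where "1 \<le> m" "m < len" "v = cv m {}"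
proof -
  have "\<exists>m. 1 \<le> m \<and> m < len \<and> v = cv m {}" if "v \<notin> verts_at j" "k \<le> j" "j < len" for j
    using that(2,1,3)
  proof (induction j rule: dec_induct)
    case base
    then show ?case using assms(2) by simp
  next
    case (step j)
    show ?case
    proof (cases "v \<in> verts_at j")
      case True
      then show ?thesis using vertex_dies[of "Suc j" v] step.prems by (intro exI[of _ "Suc j"]) simp
    next
      case False
      then show ?thesis using step by simp
    qed
  qed
  from this[OF assms(3) _ lst] show ?thesis using that assms(1) by force
qed

lemma bot_in: "\<lbrakk>1 \<le> m; m < len\<rbrakk> \<Longrightarrow> cv m {} \<in> verts_at (m-1)"
  using cv_kappa0(2)[OF _ _ empty_subsetI] neq_012(1) by simp

lemma bot_unique:
  assumes "1 \<le> m" "m < len" "1 \<le> k" "k < len" "cv m {} = cv k {}"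
  shows "m = k"
proof (rule ccontr)
  assume "m \<noteq> k"
  then consider "m < k" | "k < m" by linarith
  then show False
  proof cases
    case 1
    then have "m \<le> k - 1" "k - 1 < len" using assms by auto
    then show False using bot_vertex_dead[OF assms(1)] bot_in[OF assms(3,4)] assms(5) by simp
  next
    case 2
    then have "k \<le> m - 1" "m - 1 < len" using assms by auto
    then show False using bot_vertex_dead[OF assms(3)] bot_in[OF assms(1,2)] assms(5) by simp
  qed
qed

lemma cv_verts_at:
  assumes "1 \<le> k" "k < len" "B \<subseteq> axes" "B \<noteq> {}"
  shows "cv k B \<in> verts_at k"
proof -
  obtain b where b: "b \<in> B" using assms(4) by blast
  then have b': "b \<in> axes" using assms(3) by (rule subsetD[rotated])
  have "cv k B \<in> face_verts (tface k b)" using cv_in_cface[OF assms(1,2) b' assms(3)] b by simp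
  then show ?thesis using tface_in[OF assms(1,2) b'] unfolding verts_at_faces by blast
qed

text \<open>After its removal the vertex meets no later cube or tile, so the global products in the
  coherence condition are complete at time \<open>m - 1\<close> except for the factor of cube
  \<open>m\<close>.\<close>

lemma dead_sets:
  assumes m: "1 \<le> m" "m < len"
  shows "cubes_upto lst (cv m {}) = insert m (cubes_upto (m-1) (cv m {}))"
    "star_upto lst (cv m {}) = star_upto (m-1) (cv m {})"
proof -
  let ?w = "cv m {}"
  have dead: "?w \<notin> verts_at k" if "m \<le> k" "k < len" for k using bot_vertex_dead[OF m(1) that] .
  have no: "?w \<notin> cvert n Ts k ` Pow axes" if "m < k" "k < len" for k
  proof
    assume "?w \<in> cvert n Ts k ` Pow axes"
    then obtain B where B: "B \<in> Pow axes" "?w = cv k B" by (rule imageE)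
    have k: "1 \<le> k" using that by simp
    show False
    proof (cases "B = {}")
      case True
      then show False using bot_unique[OF m k that(2)] B(2) that(1) by simp
    next
      case False
      then show False using cv_verts_at[OF k that(2) PowD[OF B(1)]] B(2) dead[of k] that by simp
    qed
  qed
  have self: "?w \<in> cvert n Ts m ` Pow axes" by (rule imageI) simp
  show "cubes_upto lst ?w = insert m (cubes_upto (m-1) ?w)"
  proof (intro equalityI subsetI)
    fix k assume "k \<in> cubes_upto lst ?w"
    then have k: "1 \<le> k" "k < len" "?w \<in> cvert n Ts k ` Pow axes"
      using nonempty unfolding cubes_upto_def by auto
    then have "k \<le> m" using no[of k] by (meson not_le)
    then show "k \<in> insert m (cubes_upto (m-1) ?w)" using k unfolding cubes_upto_def by auto
  next
    fix k assume "k \<in> insert m (cubes_upto (m-1) ?w)"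
    then show "k \<in> cubes_upto lst ?w" using self m unfolding cubes_upto_def by auto
  qed
  show "star_upto lst ?w = star_upto (m-1) ?w"
  proof (intro equalityI subsetI)
    fix s assume "s \<in> star_upto lst ?w"
    then obtain k where k: "k \<le> lst" "s \<in> faces_at k" "?w \<in> face_verts s" unfolding star_upto_def by blast
    then have "?w \<in> verts_at k" unfolding verts_at_faces by blast
    then have "k \<le> m - 1" using dead[of k] k(1) nonempty by (cases "m \<le> k") auto
    then show "s \<in> star_upto (m-1) ?w" using k unfolding star_upto_def by blast
  next
    fix s assume "s \<in> star_upto (m-1) ?w"
    then show "s \<in> star_upto lst ?w" using m unfolding star_upto_def by force
  qed
qed

text \<open>The sign of K^C_v relative to the product of the values -y at the three faces, as
  computed in \<open>cube_props\<close>.\<close>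

definition sg :: "kvert \<Rightarrow> nat \<Rightarrow> complex" where
  "sg v m = (if v = cv m {} \<or> v = cv m {0,1,2} then -1 else 1)"

text \<open>A vertex is the bottom of one cube only, here cube \<open>m\<close>; among the earlier
  cubes just the one that created it, if any, contributes -1.\<close>

lemma prod_sg_bot:
  assumes m: "1 \<le> m" "m < len"
  shows "(\<Prod>k\<in>cubes_upto (m-1) (cv m {}). sg (cv m {}) k) = (if cv m {} \<in> verts_at 0 then 1 else -1)"
proof -
  let ?w = "cv m {}"
  have sg: "sg ?w k = (if ?w = Inr k then -1 else 1)" if "k \<in> cubes_upto (m-1) ?w" for k
  proof -
    have k: "1 \<le> k" "k \<le> m - 1" using that unfolding cubes_upto_def by auto
    then have kl: "k < len" "k \<noteq> m" using m by arith+
    have "?w \<noteq> cv k {}" using bot_unique[OF m k(1) kl(1)] kl(2) by metis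
    then show ?thesis by (simp add: sg_def cv_simps(1))
  qed
  then have e: "(\<Prod>k\<in>cubes_upto (m-1) ?w. sg ?w k) = (\<Prod>k\<in>cubes_upto (m-1) ?w. if ?w = Inr k then -1 else 1)"
    by (rule prod.cong[OF refl])
  have fin: "finite (cubes_upto (m-1) ?w)" unfolding cubes_upto_def by simp
  show ?thesis
  proof (cases "?w \<in> verts_at 0")
    case True
    then have "?w \<noteq> Inr k" for k using verts_at_Inr[of k 0] by auto
    then show ?thesis using e True by simp
  next
    case False
    obtain k where k: "?w = Inr k" "1 \<le> k" "k \<le> m - 1"
      using vertex_born[OF _ bot_in[OF m] False] m by (metis less_imp_diff_less)
    have "k \<in> cubes_upto (m-1) ?w"
    proof -
      have "?w = cv k {0,1,2}" using k(1) by (simp add: cv_simps(1))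
      then have "?w \<in> cvert n Ts k ` Pow axes" by (rule image_eqI) simp
      then show ?thesis using k unfolding cubes_upto_def by auto
    qed
    then show ?thesis unfolding e using fin False k(1) by (simp add: prod.delta')
  qed
qed

text \<open>Two factors -1 cancel: one from the cube that created the vertex, one from the cube that
  removes it.\<close>

lemma prod_sg_all:
  assumes m: "1 \<le> m" "m < len" and v0: "cv m {} \<notin> verts_at 0"
  shows "(\<Prod>k\<in>cubes_upto lst (cv m {}). sg (cv m {}) k) = 1"
proof -
  have "m \<notin> cubes_upto (m-1) (cv m {})" "finite (cubes_upto (m-1) (cv m {}))"
    unfolding cubes_upto_def using m by auto
  moreover have "sg (cv m {}) m = -1" by (simp add: sg_def)
  ultimately show ?thesis unfolding dead_sets(1)[OF m] using prod_sg_bot[OF m] v0 by simp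
qed

lemma cube_props:
  assumes m: "1 \<le> m" "m < len" and x: "\<And>v. v \<in> kappa0 n Ts \<Longrightarrow> x v \<noteq> 0"
    and sq: "\<And>a. a \<in> axes \<Longrightarrow> (y (bface m a))^2 = face_sum x (bface m a)"
    and kh: "khex_cube (\<lambda>B. x (cv m B)) (\<lambda>a \<beta>. y (cface n Ts m a \<beta>))"
  shows "Kpoly (\<lambda>B. x (cv m B)) = 0"
    and "a \<in> axes \<Longrightarrow> (y (tface m a))^2 = face_sum x (tface m a)"
    and "B \<subseteq> axes \<Longrightarrow> Kv_at n Ts m (cv m B) x = sg (cv m B) m * (\<Prod>a\<in>axes. - y (cface n Ts m a (a \<in> B)))"
proof -
  have w: "x (cv m {}) \<noteq> 0" using x cv_kappa0(3)[OF m empty_subsetI] .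
  have sq': "(y (bface m a))^2 = fsum (\<lambda>B. x (cv m B)) a False" if "a \<in> axes" for a
    using sq[OF that] face_sum_cface[OF m that] by simp
  note props = khex_cube_props[OF kh w sq']
  show "Kpoly (\<lambda>B. x (cv m B)) = 0" by (rule props(1))
  show "(y (tface m a))^2 = face_sum x (tface m a)" if "a \<in> axes" for a
    using props(2)[OF _ that] face_sum_cface[OF m that] by simp
  show "Kv_at n Ts m (cv m B) x = sg (cv m B) m * (\<Prod>a\<in>axes. - y (cface n Ts m a (a \<in> B)))" if B: "B \<subseteq> axes" for B
  proof -
    have "cv m B = cv m {} \<longleftrightarrow> B = {}" "cv m B = cv m {0,1,2} \<longleftrightarrow> B = {0,1,2}"
      using inj_on_eq_iff[OF cv_inj[OF m], of B "{}"] inj_on_eq_iff[OF cv_inj[OF m], of B "{0,1,2}"] B by simp_all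
    then have "sg (cv m B) m = - (if B = {} \<or> B = {0,1,2} then 1 else -1)" by (simp add: sg_def)
    moreover have "(\<Prod>a\<in>axes. - y (cface n Ts m a (a \<in> B))) = - (\<Prod>a\<in>axes. y (cface n Ts m a (a \<in> B)))"
      by (simp add: prod_uminus)
    moreover have "kvc (\<lambda>B. x (cv m B)) B = (if B = {} \<or> B = {0,1,2} then 1 else -1) * (\<Prod>a\<in>axes. y (cface n Ts m a (a \<in> B)))"
      by (rule khex_cube_props(3)[OF kh w sq' B])
    ultimately show ?thesis unfolding Kv_at_eq[OF m B refl] by (simp only: minus_mult_minus)
  qed
qed

lemma star_at_empty: "v \<notin> verts_at m \<Longrightarrow> star_at m v = {}"
  unfolding star_at_def verts_at_faces by blast

lemma star_upto_kappa2: "m < len \<Longrightarrow> star_upto m v \<subseteq> kappa2 n Ts"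
  unfolding star_upto_def kappa2_faces by force

lemma prod_face_sum_nonzero:
  assumes "m < len" "\<And>s. s \<in> kappa2 n Ts \<Longrightarrow> face_sum x s \<noteq> 0"
  shows "(\<Prod>s\<in>star_upto m v. face_sum x s) \<noteq> 0"
proof -
  have "face_sum x s \<noteq> 0" if "s \<in> star_upto m v" for s
    by (rule assms(2)[OF subsetD[OF star_upto_kappa2[OF assms(1)] that]])
  then show ?thesis unfolding prod_zero_iff[OF finite_star_upto[OF assms(1)]] by blast
qed

lemma bface_kappa2: "\<lbrakk>1 \<le> m; m < len; a \<in> axes\<rbrakk> \<Longrightarrow> bface m a \<in> kappa2 n Ts"
  using bface_in[of m a] unfolding kappa2_faces by force

lemma khex_imp_coherent:
  assumes kh: "khex n Ts x y"
  shows "coherent n Ts x"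
proof -
  have x: "x v \<noteq> 0" if "v \<in> kappa0 n Ts" for v using kh that unfolding khex_alt by blast
  have sq: "(y s)^2 = face_sum x s" if "s \<in> kappa2 n Ts" for s using kh that unfolding khex_alt by blast
  have cube: "khex_cube (\<lambda>B. x (cv m B)) (\<lambda>a \<beta>. y (cface n Ts m a \<beta>))" if "1 \<le> m" "m < len" for m
  proof -
    have "m \<in> kcubes Ts" using that by (simp add: kcubes_iff)
    then show ?thesis using kh unfolding khex_alt by simp
  qed
  have sqb: "(y (bface m a))^2 = face_sum x (bface m a)" if "1 \<le> m" "m < len" "a \<in> axes" for m a
    by (rule sq[OF bface_kappa2[OF that]])
  show ?thesis unfolding coherent_def
  proof (intro conjI ballI allI impI)
    fix m assume "m \<in> kcubes Ts"
    then have m: "1 \<le> m" "m < len" by (simp_all add: kcubes_iff)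
    show "Kpoly (\<lambda>B. x (cv m B)) = 0" by (rule cube_props(1)[where y = y, OF m x sqb[OF m] cube[OF m]])
  next
    fix v assume v: "interior_vertex n Ts v"
    note out = interior_vertex_imp[OF v]
    obtain k where k: "k < len" "v \<in> verts_at k"
      using v unfolding interior_vertex_def kappa0_verts by blast
    obtain m where m: "1 \<le> m" "m < len" "v = cv m {}"
      by (rule vertex_dies_eventually[OF k out(2)])
    have "(\<Prod>k\<in>cubes_upto lst v. Kv_at n Ts k v x) * (\<Prod>s\<in>star_at lst v. - y s) * (\<Prod>s\<in>star_at 0 v. - y s)
      = (\<Prod>k\<in>cubes_upto lst v. sg v k) * (\<Prod>s\<in>star_upto lst v. (- y s)^2)"
    proof (rule star_product[OF lst])
      fix k B assume k: "1 \<le> k" "k \<le> lst" and B: "B \<subseteq> axes" "cv k B = v"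
      have kl: "k < len" using k(2) lst by (rule le_less_trans)
      from cube_props(3)[where y = y, OF k(1) kl x sqb[OF k(1) kl] cube[OF k(1) kl] B(1)]
      show "Kv_at n Ts k v x = sg v k * (\<Prod>a\<in>axes. - y (cface n Ts k a (a \<in> B)))"
        unfolding B(2) .
    qed
    \<comment> \<open>An interior vertex has empty stars in the first and the last tiling, so both
      boundary factors of \<open>star_product\<close> are 1.\<close>
    then have "(\<Prod>k\<in>cubes_upto lst v. Kv_at n Ts k v x) = (\<Prod>s\<in>star_upto lst v. (y s)^2)"
      unfolding star_at_empty[OF out(1)] star_at_empty[OF out(2)]
      using prod_sg_all[OF m(1,2)] out(1) m(3) by simp
    also have "\<dots> = (\<Prod>s\<in>star_upto lst v. face_term x v s)"
    proof (rule prod.cong[OF refl])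
      fix s assume s: "s \<in> star_upto lst v"
      then have "s \<in> kappa2 n Ts" "v \<in> face_verts s"
        using star_upto_kappa2[OF lst] unfolding star_upto_def by blast+
      then show "(y s)^2 = face_term x v s" using sq face_term_eq by simp
    qed
    finally show "(\<Prod>m\<in>{m\<in>kcubes Ts. v \<in> cvert n Ts m ` Pow axes}. Kv_at n Ts m v x)
        = (\<Prod>s\<in>{s\<in>kappa2 n Ts. v \<in> face_verts s}. face_term x v s)"
      unfolding cubes_upto_lst star_upto_lst .
  qed
qed

text \<open>The sign condition under which a cube whose bottom vertex \<open>w\<close> is initial
  can be solved. It involves \<open>y\<close> only on the initial tiling, so it can be arranged
  beforehand. The minus sign is that of a product of -y over three faces.\<close>

definition init_sign :: "(kvert \<Rightarrow> complex) \<Rightarrow> (kface \<Rightarrow> complex) \<Rightarrow> kvert \<Rightarrow> bool" where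
  "init_sign x y w \<longleftrightarrow> (\<Prod>s\<in>star_at 0 w. - y s) * (\<Prod>k\<in>cubes_upto lst w. Kv_at n Ts k w x)
     = - (\<Prod>s\<in>star_upto lst w. face_sum x s)"

text \<open>Any choice of square roots meets the conditions up to sign by the squared product
  formula; the wrong signs are then corrected tile by tile through
  \<open>tile_realizable_all\<close>.\<close>

lemma init_signs_exist:
  assumes K: "\<And>m. \<lbrakk>1 \<le> m; m < len\<rbrakk> \<Longrightarrow> Kpoly (\<lambda>B. x (cv m B)) = 0"
    and fs: "\<And>s. s \<in> kappa2 n Ts \<Longrightarrow> face_sum x s \<noteq> 0"
  shows "\<exists>y. (\<forall>s\<in>faces_at 0. (y s)^2 = face_sum x s) \<and>
     (\<forall>m w. 1 \<le> m \<and> m < len \<and> w = cv m {} \<and> w \<in> verts_at 0 \<longrightarrow> init_sign x y w)"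
proof -
  define y0 where "y0 s = csqrt (face_sum x s)" for s
  define PK where "PK w = (\<Prod>k\<in>cubes_upto lst w. Kv_at n Ts k w x)" for w
  define PF where "PF w = (\<Prod>s\<in>star_upto lst w. face_sum x s)" for w
  define P0 where "P0 w = (\<Prod>s\<in>star_at 0 w. - y0 s)" for w
  \<comment> \<open>The correction factor for the initial star: the required product over the one
    given by the principal square roots.\<close>
  define R where "R w = - PF w / (P0 w * PK w)" for w
  let ?D = "{w. \<exists>m. 1 \<le> m \<and> m < len \<and> w = cv m {}}"
  have PF0: "PF w \<noteq> 0" for w
    unfolding PF_def by (rule prod_face_sum_nonzero[OF lst fs])
  \<comment> \<open>\<open>star_product\<close> for the squares, with face sums as factors and all
    signs 1; the star in the last tiling is empty because \<open>w\<close> has been removed.\<close>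
  have sqr: "(P0 w * PK w)^2 = (PF w)^2" if "w \<in> ?D" for w
  proof -
    from that obtain m where m: "1 \<le> m" "m < len" "w = cv m {}" by blast
    have "m \<le> lst" using m(2) by simp
    then have wl: "w \<notin> verts_at lst" using bot_vertex_dead[OF m(1) _ lst] m(3) by simp
    have "(\<Prod>k\<in>cubes_upto lst w. (Kv_at n Ts k w x)^2) * (\<Prod>s\<in>star_at lst w. face_sum x s) * (\<Prod>s\<in>star_at 0 w. face_sum x s)
      = (\<Prod>k\<in>cubes_upto lst w. 1) * (\<Prod>s\<in>star_upto lst w. (face_sum x s)^2)"
    proof (rule star_product[OF lst])
      fix k B assume k: "1 \<le> k" "k \<le> lst" and B: "B \<subseteq> axes" "cv k B = w"
      have kl: "k < len" using k(2) lst by (rule le_less_trans)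
      have "(Kv_at n Ts k w x)^2 = (\<Prod>a\<in>axes. fsum (\<lambda>B. x (cv k B)) a (a \<in> B))"
        using kvc_square[OF B(1), of "\<lambda>B. x (cv k B)"] K[OF k(1) kl] Kv_at_eq[OF k(1) kl B] by simp
      also have "\<dots> = (\<Prod>a\<in>axes. face_sum x (cface n Ts k a (a \<in> B)))"
        by (rule prod.cong[OF refl]) (simp only: face_sum_cface[OF k(1) kl])
      finally show "(Kv_at n Ts k w x)^2 = 1 * (\<Prod>a\<in>axes. face_sum x (cface n Ts k a (a \<in> B)))" by simp
    qed
    then have "(PK w)^2 * (\<Prod>s\<in>star_at 0 w. face_sum x s) = (PF w)^2"
      unfolding star_at_empty[OF wl] by (simp add: PK_def PF_def prod_power_distrib)
    moreover have "(P0 w)^2 = (\<Prod>s\<in>star_at 0 w. face_sum x s)"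
      by (simp add: P0_def y0_def prod_power_distrib)
    ultimately show ?thesis by (simp add: power_mult_distrib mult.commute)
  qed
  have R: "R w \<in> {1,-1}" "P0 w * R w * PK w = - PF w" if "w \<in> ?D" for w
  proof -
    have nz: "P0 w * PK w \<noteq> 0" using sqr[OF that] PF0[of w] by (metis power_eq_0_iff zero_neq_numeral zero_power2)
    have "(R w)^2 = 1" unfolding R_def using sqr[OF that] PF0[of w] by (simp add: power_divide)
    then show "R w \<in> {1,-1}" by (simp add: power2_eq_1_iff)
    show "P0 w * R w * PK w = - PF w" unfolding R_def using nz by simp
  qed
  define g where "g p = (if Inl p \<in> ?D then R (Inl p) else 1)" for p
  have g1: "g p \<in> {1,-1}" for p unfolding g_def using R(1)[of "Inl p"] by (cases "Inl p \<in> ?D") simp_all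
  obtain \<epsilon> where e: "\<forall>\<tau>. \<epsilon> \<tau> \<in> {1,-1::complex}" "\<forall>p\<in>interior (Pn n) \<inter> tiling_verts n (Ts ! 0).
      (\<Prod>\<tau>\<in>{\<tau>\<in>Ts ! 0. p \<in> set (corners n \<tau>)}. \<epsilon> \<tau>) = g p"
    using tile_realizable_all[where g = g, OF tiling[OF nonempty] g1] by blast
  let ?f = "tile_face n Ts 0"
  have inj: "inj_on ?f (Ts ! 0)" using tile_face_inj_on[OF nonempty nonempty] by (auto intro: inj_onI)
  define \<eta> where "\<eta> s = \<epsilon> (the_inv_into (Ts ! 0) ?f s)" for s
  have \<eta>: "\<eta> (?f \<tau>) = \<epsilon> \<tau>" if "\<tau> \<in> Ts ! 0" for \<tau>
    unfolding \<eta>_def using the_inv_into_f_f[OF inj that] by simp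
  have eta_sq: "(\<eta> s)^2 = 1" for s
    using spec[OF e(1), of "the_inv_into (Ts ! 0) ?f s"] unfolding \<eta>_def by auto
  have "(\<eta> s * y0 s)^2 = face_sum x s" for s by (simp add: power_mult_distrib eta_sq y0_def)
  moreover have "init_sign x (\<lambda>s. \<eta> s * y0 s) w"
    if m: "1 \<le> m" "m < len" and w: "w = cv m {}" "w \<in> verts_at 0" for m w
  proof -
    obtain p where p: "w = Inl p" "p \<in> tiling_verts n (Ts ! 0)" using w(2) unfolding verts_at_def by auto
    have m1: "m - 1 < len" using m by simp
    have "kpos w = p" using p(1) by (simp add: kpos_def)
    then have pf: "p = fpos n (fd m) {}" using kpos_cv[of m "{}"] w(1) by simp
    have "flen n (fd m) p > 0" using flen_center_pos[OF valid[OF m], of False] pf by (simp add: center_def)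
    then have pint: "p \<in> interior (Pn n)"
      using center_interior_Pn[OF tiling[OF m1] valid[OF m] bot_tiles[OF m]] by blast
    have wD: "w \<in> ?D" using m w(1) by blast
    have star: "star_at 0 w = ?f ` {\<tau>\<in>Ts ! 0. p \<in> set (corners n \<tau>)}"
      unfolding star_at_def faces_at_def using p(1) by (auto simp: face_verts_tile_face)
    have "(\<Prod>s\<in>star_at 0 w. \<eta> s) = (\<Prod>\<tau>\<in>{\<tau>\<in>Ts ! 0. p \<in> set (corners n \<tau>)}. \<eta> (?f \<tau>))"
      unfolding star by (rule prod.reindex_cong[OF inj_on_subset[OF inj] refl refl]) blast
    also have "\<dots> = (\<Prod>\<tau>\<in>{\<tau>\<in>Ts ! 0. p \<in> set (corners n \<tau>)}. \<epsilon> \<tau>)"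
      by (rule prod.cong) (auto simp: \<eta>)
    also have "\<dots> = R w" using e(2) pint p wD by (simp add: g_def)
    finally have eta: "(\<Prod>s\<in>star_at 0 w. \<eta> s) = R w" .
    have "(\<Prod>s\<in>star_at 0 w. - (\<eta> s * y0 s)) = (\<Prod>s\<in>star_at 0 w. \<eta> s * - y0 s)"
      by simp
    also have "\<dots> = P0 w * R w" unfolding prod.distrib eta P0_def by (rule mult.commute)
    finally have "(\<Prod>s\<in>star_at 0 w. - (\<eta> s * y0 s)) = P0 w * R w" .
    then show ?thesis using R(2)[OF wD] unfolding init_sign_def PK_def PF_def by simp
  qed
  ultimately show ?thesis by (intro exI[of _ "\<lambda>s. \<eta> s * y0 s"]) blast
qed

text \<open>The product formula for the cubes before \<open>m\<close> and the full product known
  from coherence or from \<open>init_sign\<close> share all factors except that of cube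
  \<open>m\<close>. The shared factors are nonzero because the face sums are.\<close>

lemma bottom_sign:
  assumes m: "1 \<le> m" "m < len"
    and x: "\<And>v. v \<in> kappa0 n Ts \<Longrightarrow> x v \<noteq> 0" and coh: "coherent n Ts x"
    and fs: "\<And>s. s \<in> kappa2 n Ts \<Longrightarrow> face_sum x s \<noteq> 0"
    and sq: "\<And>k s. \<lbrakk>k < m; s \<in> faces_at k\<rbrakk> \<Longrightarrow> (y s)^2 = face_sum x s"
    and cube: "\<And>k. \<lbrakk>1 \<le> k; k < m\<rbrakk> \<Longrightarrow> khex_cube (\<lambda>B. x (cv k B)) (\<lambda>a \<beta>. y (cface n Ts k a \<beta>))"
    and init: "cv m {} \<in> verts_at 0 \<Longrightarrow> init_sign x y (cv m {})"
  shows "Kv_at n Ts m (cv m {}) x = (\<Prod>a\<in>axes. y (bface m a))"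
proof -
  let ?w = "cv m {}"
  have m1: "m - 1 < len" using m by simp
  define PK where "PK = (\<Prod>k\<in>cubes_upto (m-1) ?w. Kv_at n Ts k ?w x)"
  define PF where "PF = (\<Prod>s\<in>star_upto (m-1) ?w. face_sum x s)"
  define FFF where "FFF = (\<Prod>a\<in>axes. y (bface m a))"
  have PF0: "PF \<noteq> 0"
    unfolding PF_def by (rule prod_face_sum_nonzero[OF m1 fs])
  have nin: "m \<notin> cubes_upto (m-1) ?w" "finite (cubes_upto (m-1) ?w)"
    unfolding cubes_upto_def using m by auto
  have all: "(\<Prod>k\<in>cubes_upto lst ?w. Kv_at n Ts k ?w x) = Kv_at n Ts m ?w x * PK"
    unfolding dead_sets(1)[OF m] PK_def using nin by simp
  have allF: "(\<Prod>s\<in>star_upto lst ?w. face_sum x s) = PF" unfolding dead_sets(2)[OF m] PF_def ..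
  have "PK * (\<Prod>s\<in>star_at (m-1) ?w. - y s) * (\<Prod>s\<in>star_at 0 ?w. - y s)
      = (\<Prod>k\<in>cubes_upto (m-1) ?w. sg ?w k) * (\<Prod>s\<in>star_upto (m-1) ?w. (- y s)^2)"
    unfolding PK_def
  proof (rule star_product[OF m1])
    fix k B assume k: "1 \<le> k" "k \<le> m - 1" and B: "B \<subseteq> axes" "cv k B = ?w"
    have kl: "k < len" "k < m" "k - 1 < m" using k m by auto
    have "(y (bface k a))^2 = face_sum x (bface k a)" if "a \<in> axes" for a
      using sq[OF kl(3) bface_in[OF k(1) kl(1) that]] .
    from cube_props(3)[where y = y, OF k(1) kl(1) x this cube[OF k(1) kl(2)] B(1)]
    show "Kv_at n Ts k ?w x = sg ?w k * (\<Prod>a\<in>axes. - y (cface n Ts k a (a \<in> B)))"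
      unfolding B(2) .
  qed
  moreover have "(\<Prod>s\<in>star_upto (m-1) ?w. (- y s)^2) = PF"
    unfolding PF_def
  proof (rule prod.cong[OF refl])
    fix s assume "s \<in> star_upto (m-1) ?w"
    then obtain k where "k \<le> m - 1" "s \<in> faces_at k" unfolding star_upto_def by blast
    then show "(- y s)^2 = face_sum x s" using sq[of k s] m by simp
  qed
  \<comment> \<open>The star of the bottom vertex consists of three faces, an odd number of sign
    changes.\<close>
  moreover have "(\<Prod>s\<in>star_at (m-1) ?w. - y s) = - FFF"
  proof -
    have "inj_on (bface m) {0,1,2}" using cface_inj[OF m] by (meson inj_onI)
    then have "(\<Prod>s\<in>star_at (m-1) ?w. - y s) = (\<Prod>a\<in>axes. - y (bface m a))"
      unfolding bot_vertex_star[OF m] by (rule prod.reindex_cong[OF _ refl refl])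
    then show ?thesis unfolding FFF_def by (simp add: prod_uminus)
  qed
  ultimately have main: "PK * (- FFF) * (\<Prod>s\<in>star_at 0 ?w. - y s) = (if ?w \<in> verts_at 0 then 1 else -1) * PF"
    unfolding prod_sg_bot[OF m] by simp
  show ?thesis
  proof (cases "?w \<in> verts_at 0")
    case True
    define P0 where "P0 = (\<Prod>s\<in>star_at 0 ?w. - y s)"
    have i: "P0 * (Kv_at n Ts m ?w x * PK) = - PF"
      using init[OF True] unfolding init_sign_def all allF P0_def .
    have "PK * (- FFF) * P0 = PF" using main True unfolding P0_def by simp
    then have "- (PK * P0 * FFF) = PF" by (simp add: mult_ac)
    then have "PK * P0 * FFF = - PF" by (metis minus_minus)
    moreover have "PK * P0 * Kv_at n Ts m ?w x = - PF" using i by (simp add: mult_ac)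
    ultimately have "PK * P0 * FFF = PK * P0 * Kv_at n Ts m ?w x" by simp
    moreover have "PK * P0 \<noteq> 0" using i PF0 by auto
    ultimately show ?thesis unfolding FFF_def by simp
  next
    case False
    have "interior_vertex n Ts ?w" using interior_vertexI[OF m False] .
    then have "(\<Prod>k\<in>cubes_upto lst ?w. Kv_at n Ts k ?w x) = (\<Prod>s\<in>star_upto lst ?w. face_term x ?w s)"
      using coh unfolding coherent_def cubes_upto_lst star_upto_lst by blast
    also have "\<dots> = (\<Prod>s\<in>star_upto lst ?w. face_sum x s)"
      by (rule prod.cong[OF refl], rule face_term_eq) (simp add: star_upto_def)
    finally have i: "Kv_at n Ts m ?w x * PK = PF" unfolding all allF .
    have "PK * FFF = PF" using main False unfolding star_at_empty[OF False] by simp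
    then have "PK * FFF = PK * Kv_at n Ts m ?w x" using i by (simp add: mult.commute)
    moreover have "PK \<noteq> 0" using i PF0 by auto
    ultimately show ?thesis unfolding FFF_def by simp
  qed
qed

text \<open>Induction over the flips. The initial sign conditions belong to the invariant; they
  persist because each step changes \<open>y\<close> on new faces only.\<close>

lemma coherent_imp_khex:
  assumes x: "\<And>v. v \<in> kappa0 n Ts \<Longrightarrow> x v \<noteq> 0" and coh: "coherent n Ts x"
    and fs: "\<And>s. s \<in> kappa2 n Ts \<Longrightarrow> face_sum x s \<noteq> 0"
  shows "\<exists>y. khex n Ts x y"
proof -
  have K: "Kpoly (\<lambda>B. x (cv m B)) = 0" if "1 \<le> m" "m < len" for m
  proof -
    have "m \<in> kcubes Ts" using that by (simp add: kcubes_iff)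
    then show ?thesis using coh unfolding coherent_def by simp
  qed
  have "\<exists>y. (\<forall>k\<le>m. \<forall>s\<in>faces_at k. (y s)^2 = face_sum x s) \<and>
     (\<forall>k. 1 \<le> k \<and> k \<le> m \<longrightarrow> khex_cube (\<lambda>B. x (cv k B)) (\<lambda>a \<beta>. y (cface n Ts k a \<beta>))) \<and>
     (\<forall>k w. 1 \<le> k \<and> k < len \<and> w = cv k {} \<and> w \<in> verts_at 0 \<longrightarrow> init_sign x y w)"
    if "m < len" for m
    using that
  proof (induction m)
    case 0
    obtain y where "\<forall>s\<in>faces_at 0. (y s)^2 = face_sum x s"
      "\<forall>m w. 1 \<le> m \<and> m < len \<and> w = cv m {} \<and> w \<in> verts_at 0 \<longrightarrow> init_sign x y w"
      using init_signs_exist[of x, OF K fs] by metis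
    then show ?case by (intro exI[of _ y]) simp
  next
    case (Suc m)
    let ?m = "Suc m"
    have m: "1 \<le> ?m" "?m < len" using Suc.prems by auto
    obtain y where y: "\<And>k s. \<lbrakk>k \<le> m; s \<in> faces_at k\<rbrakk> \<Longrightarrow> (y s)^2 = face_sum x s"
      "\<And>k. \<lbrakk>1 \<le> k; k \<le> m\<rbrakk> \<Longrightarrow> khex_cube (\<lambda>B. x (cv k B)) (\<lambda>a \<beta>. y (cface n Ts k a \<beta>))"
      "\<And>k w. \<lbrakk>1 \<le> k; k < len; w = cv k {}; w \<in> verts_at 0\<rbrakk> \<Longrightarrow> init_sign x y w"
      using Suc by (metis Suc_lessD)
    have KF: "Kv_at n Ts ?m (cv ?m {}) x = (\<Prod>a\<in>axes. y (bface ?m a))"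
      by (rule bottom_sign[OF m x coh fs]) (use y m in \<open>auto simp: less_Suc_eq_le\<close>)
    define z where "z B = x (cv ?m B)" for B
    define F where "F a = y (bface ?m a)" for a
    \<comment> \<open>The values that the first three equations force on the top faces.\<close>
    define G where "G a = (if a = 0 then (F 1 * F 2 + F 0 * z {0}) / z {}
       else if a = 1 then (F 0 * F 2 + F 1 * z {1}) / z {} else (F 0 * F 1 + F 2 * z {2}) / z {})" for a :: nat
    define y' where "y' s = (if s = tface ?m 0 then G 0 else if s = tface ?m 1 then G 1
       else if s = tface ?m 2 then G 2 else y s)" for s
    have old: "y' s = y s" if "s \<in> faces_at k" "k \<le> m" for s k
      using that tface_fresh[OF m, of 0 k] tface_fresh[OF m, of 1 k] tface_fresh[OF m, of 2 k]
      unfolding y'_def by auto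
    have new: "y' (tface ?m 0) = G 0" "y' (tface ?m 1) = G 1" "y' (tface ?m 2) = G 2"
      using cface_inj[OF m, of 1 0 True True] cface_inj[OF m, of 2 0 True True] cface_inj[OF m, of 2 1 True True]
      unfolding y'_def by auto
    have oldb: "y' (bface ?m a) = F a" if "a \<in> axes" for a
      using old[of "bface ?m a" m] bface_in[OF m that] unfolding F_def by simp
    have z0: "z {} \<noteq> 0" unfolding z_def by (rule x[OF cv_kappa0(3)[OF m empty_subsetI]])
    have "kvc z {} = F 0 * F 1 * F 2"
      using KF Kv_at_eq[OF m empty_subsetI refl, of x] unfolding z_def F_def by (simp add: mult.assoc)
    \<comment> \<open>The product formula at the bottom vertex is the equation for z_111 with its
      denominator cleared.\<close>
    then have top: "z {0,1,2} * (z {})^2 = 2 * z {0} * z {1} * z {2}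
        + z {} * (z {0} * z {1,2} + z {1} * z {0,2} + z {2} * z {0,1}) + 2 * F 0 * F 1 * F 2"
      unfolding kvc_def Kvpoly_def symdiff_table by (simp add: field_simps)
    have kh: "khex_cube (\<lambda>B. x (cv ?m B)) (\<lambda>a \<beta>. y' (cface n Ts ?m a \<beta>))"
      unfolding khex_cube_def Let_def z_def[symmetric] using new oldb top z0
      by (simp add: G_def eq_divide_eq)
    have sqb: "(y' (bface ?m a))^2 = face_sum x (bface ?m a)" if "a \<in> axes" for a
      using oldb[OF that] y(1)[of m "bface ?m a"] bface_in[OF m that] unfolding F_def by simp
    \<comment> \<open>The square equations on the top faces follow from the cube equations by the
      algebra of one cube.\<close>
    note sqt = cube_props(2)[where y = y', OF m x sqb kh]
    have sq': "(y' s)^2 = face_sum x s" if "k \<le> ?m" "s \<in> faces_at k" for k s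
    proof (cases "k \<le> m")
      case True
      then show ?thesis using old[OF that(2)] y(1) that(2) by simp
    next
      case False
      then have k: "k = ?m" using that(1) by simp
      have gen: "s \<in> X \<or> s \<in> t" if "s \<in> (X - b) \<union> t" for X b t :: "kface set" using that by blast
      have "s \<in> faces_at m \<or> s \<in> tface ?m ` axes"
        by (rule gen[OF that(2)[unfolded k faces_step[OF m] diff_Suc_1]])
      then show ?thesis
      proof
        assume "s \<in> faces_at m"
        then show ?thesis using old[of s m] y(1)[of m s] by simp
      next
        assume "s \<in> tface ?m ` axes"
        then obtain a where "a \<in> axes" "s = tface ?m a" by (rule imageE)
        then show ?thesis using sqt by simp
      qed
    qed
    have kh': "khex_cube (\<lambda>B. x (cv k B)) (\<lambda>a \<beta>. y' (cface n Ts k a \<beta>))" if "1 \<le> k" "k \<le> ?m" for k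
    proof (cases "k = ?m")
      case True
      then show ?thesis using kh by simp
    next
      case False
      then have k: "1 \<le> k" "k \<le> m" "k < len" using that m by auto
      have "y' (bface k a) = y (bface k a)" "y' (tface k a) = y (tface k a)" if "a \<in> axes" for a
        using old[OF bface_in[OF k(1,3) that]] old[OF tface_in[OF k(1,3) that]] k by auto
      then show ?thesis using y(2)[OF k(1,2)] unfolding khex_cube_def by simp
    qed
    have "init_sign x y' w" if "1 \<le> k" "k < len" "w = cv k {}" "w \<in> verts_at 0" for k w
    proof -
      have "(\<Prod>s\<in>star_at 0 w. - y' s) = (\<Prod>s\<in>star_at 0 w. - y s)"
        by (rule prod.cong[OF refl]) (use old[of _ 0] in \<open>simp add: star_at_def\<close>)
      then show ?thesis using y(3)[OF that] unfolding init_sign_def by simp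
    qed
    then show ?case using sq' kh' by (intro exI[of _ y']) blast
  qed
  from this[OF lst] obtain y where y: "\<And>k s. \<lbrakk>k \<le> lst; s \<in> faces_at k\<rbrakk> \<Longrightarrow> (y s)^2 = face_sum x s"
      "\<And>k. \<lbrakk>1 \<le> k; k \<le> lst\<rbrakk> \<Longrightarrow> khex_cube (\<lambda>B. x (cv k B)) (\<lambda>a \<beta>. y (cface n Ts k a \<beta>))"
    by blast
  have le: "k \<le> lst" if "k < len" for k using that by arith
  have sq: "(y s)^2 = face_sum x s" if s: "s \<in> kappa2 n Ts" for s
  proof -
    obtain k where k: "k < len" "s \<in> faces_at k" using s unfolding kappa2_faces by blast
    show ?thesis by (rule y(1)[OF le[OF k(1)] k(2)])
  qed
  have kh: "khex_cube (\<lambda>B. x (cv m B)) (\<lambda>a \<beta>. y (cface n Ts m a \<beta>))" if m: "m \<in> kcubes Ts" for m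
  proof -
    have "1 \<le> m" "m < len" using m by (simp_all add: kcubes_iff)
    then show ?thesis by (intro y(2) le)
  qed
  have "khex n Ts x y" unfolding khex_alt
    by (intro conjI ballI; (erule x | erule sq | erule kh))
  then show ?thesis by (rule exI[of _ y])
qed

end

theorem theorem4p19:
  fixes n :: nat and Ts :: "tile set list"
  assumes "is_pile n Ts"
  shows "(\<forall>x :: kvert \<Rightarrow> complex.
            (\<forall>v\<in>kappa0 n Ts. x v \<noteq> 0) \<and> coherent n Ts x \<and>
            (\<forall>s\<in>kappa2 n Ts. face_sum x s \<noteq> 0)
            \<longrightarrow> (\<exists>y :: kface \<Rightarrow> complex. khex n Ts x y))
       \<and> (\<forall>(x :: kvert \<Rightarrow> complex) (y :: kface \<Rightarrow> complex).
            (\<forall>v\<in>kappa0 n Ts. x v \<noteq> 0) \<and> (\<forall>s\<in>kappa2 n Ts. y s \<noteq> 0) \<and> khex n Ts x y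
            \<longrightarrow> coherent n Ts x)"
proof -
  interpret pile n Ts by unfold_locales (rule assms)
  show ?thesis
  proof (intro conjI allI impI)
    fix x :: "kvert \<Rightarrow> complex"
    assume "(\<forall>v\<in>kappa0 n Ts. x v \<noteq> 0) \<and> coherent n Ts x \<and> (\<forall>s\<in>kappa2 n Ts. face_sum x s \<noteq> 0)"
    then show "\<exists>y. khex n Ts x y" by (intro coherent_imp_khex) blast+
  next
    fix x :: "kvert \<Rightarrow> complex" and y :: "kface \<Rightarrow> complex"
    assume "(\<forall>v\<in>kappa0 n Ts. x v \<noteq> 0) \<and> (\<forall>s\<in>kappa2 n Ts. y s \<noteq> 0) \<and> khex n Ts x y"
    then show "coherent n Ts x" by (intro khex_imp_coherent) blast
  qed
qed

end
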